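(* Let $d\geq 2$ be an integer and let $\alpha,\beta$ be real numbers with $2\leq\alpha\leq 4$, $\beta_*(\alpha)\leq\beta\leq 2$ and $\beta<\alpha$. Then $$ E_{\alpha,\beta} = \begin{cases} - \pi^{-\frac12} \, 2^{d+\alpha-3}\, \dfrac{\Gamma(\frac d2)\,\Gamma(\frac{d+\alpha-1}{2})}{\Gamma(\frac{2d+\alpha-2}{2})} \left( \dfrac1\beta - \dfrac1\alpha \right) R_{\alpha,\beta}^\alpha & \text{if } \beta\neq 0,\\[2ex] \dfrac1{2\alpha}\left( 1 - \ln \dfrac{\Gamma(\frac{d-1}2)\,\Gamma(\frac{2d+\alpha-2}{2})}{\Gamma(d-1)\,\Gamma(\frac{d+\alpha-1}{2})} \right) + \dfrac14 \left( \dfrac{\Gamma'(d-1)}{\Gamma(d-1)} - \dfrac{\Gamma'(\frac{d-1}{2})}{\Gamma(\frac{d-1}{2})} \right) & \text{if } \beta =0. \end{cases} $$ The infimum defining $E_{\alpha,\beta}$ is attained at $\mu$ if, for some $a\in\mathbb{R}^d$, $$ \mu = \left(|\mathbb{S}^{d-1}|\,R_{\alpha,\beta}^{d-1}\right)^{-1}\ \delta_{\partial B_{R_{\alpha,\beta}}(a)}. $$ Provided $(\alpha,\beta)\neq (4,2)$, these are the only minimizers of $\mathcal{E}_{\alpha,\beta}$ over $P(\mathbb{R}^d)$.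
   Context: $P(\mathbb{R}^d)$ denotes the set of Borel probability measures on $\mathbb{R}^d$. For $-d<\beta<\alpha<\infty$ and $\mu\in P(\mathbb{R}^d)$, $$ \mathcal E_{\alpha,\beta}[\mu] := \frac12 \iint_{\mathbb{R}^d\times\mathbb{R}^d} \left( \alpha^{-1}|x-y|^\alpha - \beta^{-1}|x-y|^\beta \right) d\mu(x)\,d\mu(y), $$ where $\gamma^{-1}|x-y|^\gamma$ for $\gamma=0$ is interpreted as $\ln|x-y|$. For $\alpha>0$ and $\beta\le 0$ the integrand is understood to be $+\infty$ when $x=y$; for $\alpha>0$ the integrand is bounded below, so $\mathcal E_{\alpha,\beta}[\mu]\in(-\infty,+\infty]$. The minimal energy is $$E_{\alpha,\beta} := \inf\{ \mathcal E_{\alpha,\beta}[\mu] : \mu\in P(\mathbb{R}^d)\},$$ and a minimizer is a $\mu\in P(\mathbb{R}^d)$ with $\mathcal E_{\alpha,\beta}[\mu]=E_{\alpha,\beta}$. For $\alpha\ge2$, $d\ge 2$, $$ \beta_*(\alpha) := \frac{-10+3\alpha+7d-\alpha d- d^2}{d+\alpha-3}. $$ For $\beta_*(\alpha)\leq\beta<\alpha$, $$ R_{\alpha,\beta} := \frac12 \left( \frac{\Gamma(\frac{d+\beta-1}{2})\, \Gamma(\frac{2d+\alpha-2}{2})}{\Gamma(\frac{d+\alpha-1}{2})\, \Gamma(\frac{2d+\beta-2}{2})} \right)^{\frac{1}{\alpha-\beta}} . $$ $B_R(a)$ is the open ball of radius $R$ centered at $a$, $\delta_{\partial B_R(a)}$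 is the surface measure (of total mass $|\mathbb{S}^{d-1}|R^{d-1}$) on the sphere $\partial B_R(a)$, $|\mathbb{S}^{d-1}|$ is the surface area of the unit sphere in $\mathbb{R}^d$, and $\Gamma$ is the gamma function. *)

theory Defs
  imports "HOL-Probability.Probability"
begin

subsection \<open>Interaction energies\<close>

definition borel_prob_measures :: "'a::euclidean_space measure set" where
  "borel_prob_measures = {\<mu>. prob_space \<mu> \<and> sets \<mu> = sets borel}"

text \<open>The value of \<open>\<gamma>\<^sup>-\<^sup>1 r\<^sup>\<gamma>\<close> for \<open>r > 0\<close>, which stands for \<open>ln r\<close> when \<open>\<gamma> = 0\<close>.\<close>

definition power_potential :: "real \<Rightarrow> real \<Rightarrow> real" where
  "power_potential \<gamma> r = (if \<gamma> = 0 then ln r else r powr \<gamma> / \<gamma>)"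

text \<open>On the diagonal the library conventions \<open>ln 0 = 0\<close> and \<open>0 powr \<gamma> = 0\<close> would give a
  finite value for \<open>\<beta> \<le> 0\<close>, hence the explicit case. For \<open>0 < \<beta> < \<alpha>\<close> they give the
  correct value 0.\<close>

definition kernel :: "real \<Rightarrow> real \<Rightarrow> 'a::euclidean_space \<Rightarrow> 'a \<Rightarrow> ereal" where
  "kernel \<alpha> \<beta> x y =
     (if x = y \<and> \<beta> \<le> 0 then \<infinity>
      else ereal (power_potential \<alpha> (dist x y) - power_potential \<beta> (dist x y)))"

text \<open>The integral of an extended real function as the integral of its positive part minus the
  integral of its negative part (\<open>e2ennreal\<close> sends negative numbers to 0). It is
  meaningful when one of the two is finite; for the kernel with \<open>\<alpha> > 0\<close> and a probability
  measure the second one is, since the kernel is bounded below.\<close>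

definition ereal_integral :: "'b measure \<Rightarrow> ('b \<Rightarrow> ereal) \<Rightarrow> ereal" where
  "ereal_integral M f =
     enn2ereal (\<integral>\<^sup>+ z. e2ennreal (f z) \<partial>M) - enn2ereal (\<integral>\<^sup>+ z. e2ennreal (- f z) \<partial>M)"

definition energy :: "real \<Rightarrow> real \<Rightarrow> 'a::euclidean_space measure \<Rightarrow> ereal" where
  "energy \<alpha> \<beta> \<mu> = ereal (1 / 2) * ereal_integral (\<mu> \<Otimes>\<^sub>M \<mu>) (\<lambda>(x, y). kernel \<alpha> \<beta> x y)"

definition minimal_energy :: "'a::euclidean_space itself \<Rightarrow> real \<Rightarrow> real \<Rightarrow> ereal" where
  "minimal_energy TYPE('a) \<alpha> \<beta> = (INF \<mu> \<in> (borel_prob_measures :: 'a measure set). energy \<alpha> \<beta> \<mu>)"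

definition minimizer :: "real \<Rightarrow> real \<Rightarrow> 'a::euclidean_space measure \<Rightarrow> bool" where
  "minimizer \<alpha> \<beta> \<mu> \<longleftrightarrow>
     \<mu> \<in> borel_prob_measures \<and> energy \<alpha> \<beta> \<mu> = minimal_energy TYPE('a) \<alpha> \<beta>"


subsection \<open>Parameters\<close>

definition beta_star :: "nat \<Rightarrow> real \<Rightarrow> real" where
  "beta_star d \<alpha> =
     (- 10 + 3 * \<alpha> + 7 * real d - \<alpha> * real d - (real d)\<^sup>2) / (real d + \<alpha> - 3)"

definition sphere_radius :: "nat \<Rightarrow> real \<Rightarrow> real \<Rightarrow> real" where
  "sphere_radius d \<alpha> \<beta> = 1 / 2 *
     ((Gamma ((real d + \<beta> - 1) / 2) * Gamma ((2 * real d + \<alpha> - 2) / 2)) /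
      (Gamma ((real d + \<alpha> - 1) / 2) * Gamma ((2 * real d + \<beta> - 2) / 2))) powr (1 / (\<alpha> - \<beta>))"


subsection \<open>Surface measure on spheres\<close>

text \<open>The library has no surface measure. We use the description of the surface measure on
  \<open>sphere a R\<close> from integration in polar coordinates: a Borel set \<open>A\<close> gets \<open>d / R\<close> times
  the Lebesgue measure of the cone \<open>{a + t *\<^sub>R (x - a) | x \<in> A \<inter> sphere a R, 0 < t < 1}\<close> over
  \<open>A\<close> (see \<open>emeasure_surface_measure_cone\<close> below). As a measure, this is a multiple of the
  image of Lebesgue measure on the ball under the radial projection onto the sphere.
  The centre, which the projection does not move, is a null set.\<close>

definition surface_measure :: "'a::euclidean_space \<Rightarrow> real \<Rightarrow> 'a measure" where
  "surface_measure a R =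
     scale_measure (ennreal (real DIM('a) / R))
       (distr (restrict_space lborel (ball a R)) borel
          (\<lambda>y. a + (R / norm (y - a)) *\<^sub>R (y - a)))"

definition unit_sphere_area :: "'a::euclidean_space itself \<Rightarrow> real" where
  "unit_sphere_area TYPE('a) = measure (surface_measure (0 :: 'a) 1) (sphere 0 1)"

definition uniform_sphere :: "'a::euclidean_space \<Rightarrow> real \<Rightarrow> 'a measure" where
  "uniform_sphere a R =
     scale_measure (ennreal (inverse (unit_sphere_area TYPE('a) * R ^ (DIM('a) - 1))))
       (surface_measure a R)"

lemma radial_projection_measurable:
  "(\<lambda>y. a + (R / norm (y - a)) *\<^sub>R (y - a)) \<in> borel_measurable (restrict_space lborel (ball a R))"
  for a :: "'a::euclidean_space"
  by (rule measurable_restrict_space1) measurable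

lemma emeasure_surface_measure:
  fixes a :: "'a::euclidean_space"
  assumes "A \<in> sets borel"
  shows "emeasure (surface_measure a R) A =
    ennreal (real DIM('a) / R) *
      emeasure lborel {y \<in> ball a R. a + (R / norm (y - a)) *\<^sub>R (y - a) \<in> A}"
proof -
  let ?f = "\<lambda>y. a + (R / norm (y - a)) *\<^sub>R (y - a)"
  have "emeasure (distr (restrict_space lborel (ball a R)) borel ?f) A =
      emeasure (restrict_space lborel (ball a R)) (?f -` A \<inter> space (restrict_space lborel (ball a R)))"
    by (rule emeasure_distr[OF radial_projection_measurable assms])
  also have "?f -` A \<inter> space (restrict_space lborel (ball a R)) = {y \<in> ball a R. ?f y \<in> A}"
    by (auto simp: space_restrict_space)
  also have "emeasure (restrict_space lborel (ball a R)) {y \<in> ball a R. ?f y \<in> A} =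
      emeasure lborel {y \<in> ball a R. ?f y \<in> A}"
    by (rule emeasure_restrict_space) auto
  finally show ?thesis
    by (simp add: surface_measure_def)
qed

lemma emeasure_surface_measure_cone:
  fixes a :: "'a::euclidean_space"
  assumes "A \<in> sets borel" "A \<subseteq> sphere a R" "R > 0"
  shows "emeasure (surface_measure a R) A =
    ennreal (real DIM('a) / R) * emeasure lborel {a + t *\<^sub>R (x - a) | t x. x \<in> A \<and> 0 < t \<and> t < 1}"
proof -
  have "{y \<in> ball a R. a + (R / norm (y - a)) *\<^sub>R (y - a) \<in> A} =
      {a + t *\<^sub>R (x - a) | t x. x \<in> A \<and> 0 < t \<and> t < 1}" (is "?L = ?C")
  proof (intro set_eqI iffI)
    fix y assume y: "y \<in> ?L"
    define x where "x = a + (R / norm (y - a)) *\<^sub>R (y - a)"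
    have "x \<in> A" using y by (simp add: x_def)
    hence "y \<noteq> a" using assms by (auto simp: x_def)
    hence "y = a + (norm (y - a) / R) *\<^sub>R (x - a)" "0 < norm (y - a) / R" "norm (y - a) / R < 1"
      using y assms by (auto simp: x_def dist_norm norm_minus_commute)
    thus "y \<in> ?C" using \<open>x \<in> A\<close> by blast
  next
    fix y assume "y \<in> ?C"
    then obtain t x where y: "y = a + t *\<^sub>R (x - a)" and x: "x \<in> A" and t: "0 < t" "t < 1"
      by blast
    have "norm (x - a) = R" using x assms by (auto simp: dist_norm norm_minus_commute)
    hence n: "norm (y - a) = t * R" using y t by simp
    have "a + (R / norm (y - a)) *\<^sub>R (y - a) = x"
      unfolding n using y t assms by simp
    moreover have "t * R < R" using t assms by simp
    ultimately show "y \<in> ?L" using n x by (simp add: dist_norm norm_minus_commute)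
  qed
  thus ?thesis using emeasure_surface_measure[OF assms(1)] by simp
qed

lemma emeasure_surface_measure_sphere:
  fixes a :: "'a::euclidean_space"
  assumes "R > 0"
  shows "emeasure (surface_measure a R) (sphere a R) =
    ennreal (2 * pi powr (real DIM('a) / 2) / Gamma (real DIM('a) / 2) * R ^ (DIM('a) - 1))"
proof -
  let ?d = "real DIM('a)"
  have "{y \<in> ball a R. a + (R / norm (y - a)) *\<^sub>R (y - a) \<in> sphere a R} = ball a R - {a}"
    using assms by (auto simp: dist_norm)
  moreover have "emeasure lborel (ball a R - {a}) = emeasure lborel (ball a R)"
    by (rule emeasure_Diff_null_set) auto
  moreover have "emeasure lborel (ball a R) = ennreal (unit_ball_vol ?d * R ^ DIM('a))"
    using assms by (simp add: emeasure_ball)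
  ultimately have "emeasure (surface_measure a R) (sphere a R) =
      ennreal (?d / R * (unit_ball_vol ?d * R ^ DIM('a)))"
    using assms by (subst ennreal_mult) (auto simp: emeasure_surface_measure)
  also have "?d / R * (unit_ball_vol ?d * R ^ DIM('a)) = ?d * unit_ball_vol ?d * R ^ (DIM('a) - 1)"
    using assms by (cases "DIM('a)") auto
  also have "?d * unit_ball_vol ?d = 2 * pi powr (?d / 2) / Gamma (?d / 2)"
  proof -
    have *: "Gamma (?d / 2 + 1) = ?d / 2 * Gamma (?d / 2)"
      by (rule Gamma_plus1) (auto dest!: nonpos_Ints_nonpos)
    show ?thesis
      unfolding unit_ball_vol_def * by simp
  qed
  finally show ?thesis .
qed

lemma unit_sphere_area_eq:
  "unit_sphere_area TYPE('a::euclidean_space) =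
     2 * pi powr (real DIM('a) / 2) / Gamma (real DIM('a) / 2)"
proof -
  have "0 \<le> 2 * pi powr (real DIM('a) / 2) / Gamma (real DIM('a) / 2)"
    by (intro divide_nonneg_nonneg mult_nonneg_nonneg Gamma_real_nonneg) auto
  thus ?thesis
    by (simp add: unit_sphere_area_def measure_def emeasure_surface_measure_sphere)
qed

end

theory Submission
  imports Defs
begin

text \<open>Write \<open>\<sigma>\<close> for the uniform probability measure on the sphere of radius \<open>R\<close> about the mean of a
competitor \<open>\<mu>\<close> of finite energy, \<open>k\<close> for the kernel, and \<open>k(A, B)\<close> for the integral of \<open>k\<close> over \<open>A
\<otimes> B\<close>. The proof compares \<open>\<mu>\<close> with \<open>\<sigma>\<close> through the identity

  \<open>k(\<mu>, \<mu>) = k(\<mu> - \<sigma>, \<mu> - \<sigma>) + 2 \<integral> \<Phi> d\<mu> - k(\<sigma>, \<sigma>)\<close>,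

where \<open>\<Phi>\<close> is the potential of \<open>\<sigma>\<close>. Two facts finish the argument: the first term is nonnegative,
and \<open>\<Phi>\<close> attains its minimum \<open>k(\<sigma>, \<sigma>)\<close> on the sphere itself. Together they give \<open>k(\<mu>, \<mu>) \<ge> k(\<sigma>,
\<sigma>)\<close>.

\<open>Positive definiteness\<close> (\<open>defect_kernel\<close>). The quadratic form of a Gaussian kernel \<open>exp (- t \<rho>\<^sup>2)\<close>
is a squared \<open>L\<^sup>2\<close> norm, namely that of the difference of the two measures smoothed by a narrower
Gaussian. For \<open>2 < \<alpha> < 4\<close> the power \<open>\<rho> powr \<alpha>\<close> is, up to a multiple of \<open>\<rho>\<^sup>2\<close> and a constant for
each \<open>t\<close>, a positive mixture of Gaussians, and for \<open>\<beta> < 2\<close> so is \<open>- \<rho> powr \<beta> / \<beta>\<close> (and \<open>- ln \<rho>\<close>),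
without the \<open>\<rho>\<^sup>2\<close>. Constants and \<open>\<rho>\<^sup>2\<close> do not contribute, because \<open>\<mu>\<close> and \<open>\<sigma>\<close> have the same mass and
the same mean; this is why the sphere is centred at the mean of \<open>\<mu>\<close>. The endpoint \<open>\<alpha> = 4\<close> is a
limit, which loses strictness; \<open>\<alpha> = 2\<close> and \<open>\<beta> = 2\<close> contribute nothing. Strictness survives in one
of the two powers unless \<open>(\<alpha>, \<beta>) = (4, 2)\<close>, and then vanishing of the form forces equality of all
smoothed measures for a sequence of widths tending to \<open>0\<close>, hence \<open>\<mu> = \<sigma>\<close>.

\<open>The potential of the sphere\<close> (\<open>sphere_potential_minimal\<close>). Rescaled to the unit sphere, \<open>\<Phi>\<close> is a
radial function \<open>C Pot n \<alpha> r - Pot n \<beta> r\<close>, where the choice of \<open>R\<close> makes its derivative vanish at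
\<open>r = 1\<close>. Its Laplacian is \<open>C (\<alpha> + n - 2) Psi n (\<alpha> - 2) r - (\<beta> + n - 2) Psi n (\<beta> - 2) r\<close>, and by
the recursion of the moments of the sphere the condition \<open>\<beta>_* \<le> \<beta>\<close> says exactly that this is
nonnegative at \<open>r = 1\<close>. Outside the sphere the Laplacian is at least as large, since there \<open>Psi n
\<gamma>\<close> is at least its value at \<open>1\<close> for \<open>\<gamma> \<ge> 0\<close> and at most that value for \<open>\<gamma> \<le> 0\<close>; so \<open>\<Phi>\<close> increases.
Inside, the Bilaplacian is nonnegative if \<open>\<beta> + n \<ge> 4\<close>. Otherwise the ratio \<open>Psi n (\<beta> - 4) / Psi n
(\<alpha> - 4)\<close> is increasing, by the log-convexity of \<open>\<gamma> \<mapsto> Psi n \<gamma>\<close> (Chebyshev's inequality), so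
the Bilaplacian changes sign at most once, from plus to minus. Three integrations carry this
pattern to the flux \<open>r^(n-1) \<Phi>'(r)\<close>, which vanishes at both ends of \<open>[0, 1]\<close> and therefore cannot
be positive in between: \<open>\<Phi>\<close> decreases on \<open>[0, 1]\<close>.

The averages over the sphere are reduced to one-dimensional integrals: for a unit vector \<open>e\<close> and a
uniform point \<open>y\<close> of the unit sphere, \<open>y \<bullet> e\<close> is distributed like \<open>cos \<theta>\<close> with \<open>\<theta>\<close> having
density proportional to \<open>sin \<theta> ^ (n - 2)\<close> (\<open>nn_integral_usphere_inner\<close>). This is proved by
comparing moments, since both families satisfy the same two-step recursion. At \<open>r = 1\<close> the
integrals are Beta functions (\<open>Psi_1\<close>), which gives the minimal energy for \<open>\<beta> \<noteq> 0\<close>; the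
logarithmic value is the derivative at \<open>\<gamma> = 0\<close> of the moment (\<open>sphere_log_moment\<close>).\<close>

section \<open>The angle of a uniform point on the sphere\<close>

definition angle_const :: "nat \<Rightarrow> real" where
  "angle_const n = integral {0..pi} (\<lambda>\<theta>. sin \<theta> ^ (n - 2))"

text \<open>The law of the angle between a fixed direction and a uniform point on the unit sphere of
dimension \<open>n - 1\<close> in \<open>n\<close>-space, normalised to mass \<open>1\<close>.\<close>

definition angle_measure :: "nat \<Rightarrow> real measure" where
  "angle_measure n =
     density lborel (\<lambda>\<theta>. ennreal (indicator {0..pi} \<theta> * sin \<theta> ^ (n - 2) / angle_const n))"

lemma angle_const_pos: "angle_const n > 0"
proof -
  have c: "continuous_on {0..pi} (\<lambda>\<theta>::real. sin \<theta> ^ (n - 2))" by (intro continuous_intros)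
  have nn: "0 \<le> sin \<theta> ^ (n - 2)" if "\<theta> \<in> {0..pi}" for \<theta> :: real
    using that by (intro zero_le_power sin_ge_zero) auto
  have "angle_const n \<noteq> 0"
  proof
    assume "angle_const n = 0"
    then have *: "((\<lambda>\<theta>::real. sin \<theta> ^ (n - 2)) has_integral 0) (cbox 0 pi)"
      unfolding angle_const_def using c integrable_integral[OF integrable_continuous_interval[OF c]] by simp
    have "sin (pi / 2) ^ (n - 2) = (0::real)"
    proof (rule has_integral_0_cbox_imp_0[OF _ _ *])
      have "pi / 2 \<in> box 0 pi" by (simp add: box_real)
      then show "box 0 pi \<noteq> {}" by blast
    qed (use c nn in simp_all)
    then show False by simp
  qed
  moreover have "angle_const n \<ge> 0"
    unfolding angle_const_def using nn by (intro integral_nonneg integrable_continuous_interval c) auto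
  ultimately show ?thesis by simp
qed

lemma sets_angle_measure [measurable_cong, simp]: "sets (angle_measure n) = sets borel"
  by (simp add: angle_measure_def)

lemma space_angle_measure [simp]: "space (angle_measure n) = UNIV"
  by (simp add: angle_measure_def)

lemma AE_angle_measure: "AE \<theta> in angle_measure n. 0 < \<theta> \<and> \<theta> < pi"
proof -
  have "AE \<theta> in lborel. (\<theta>::real) \<noteq> 0 \<and> \<theta> \<noteq> pi"
    using AE_lborel_singleton[of "0::real"] AE_lborel_singleton[of "pi"] by eventually_elim auto
  then have "AE \<theta> in lborel. 0 < ennreal (indicator {0..pi} \<theta> * sin \<theta> ^ (n - 2) / angle_const n) \<longrightarrow> 0 < \<theta> \<and> \<theta> < pi"
    by eventually_elim (auto simp: indicator_def split: if_splits)
  then show ?thesis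
    unfolding angle_measure_def by (subst AE_density) simp_all
qed

lemma nn_integral_angle_measure:
  assumes [measurable]: "h \<in> borel_measurable borel"
  shows "(\<integral>\<^sup>+\<theta>. h \<theta> \<partial>angle_measure n) =
    (\<integral>\<^sup>+\<theta>. ennreal (indicator {0..pi} \<theta> * sin \<theta> ^ (n - 2) / angle_const n) * h \<theta> \<partial>lborel)"
  unfolding angle_measure_def by (subst nn_integral_density) auto

lemma
  fixes g :: "real \<Rightarrow> real"
  assumes [measurable]: "g \<in> borel_measurable borel" and g: "continuous_on {0..pi} g"
  shows integral_angle_measure:
      "(\<integral>\<theta>. g \<theta> \<partial>angle_measure n) = integral {0..pi} (\<lambda>\<theta>. g \<theta> * sin \<theta> ^ (n - 2)) / angle_const n"
    and integrable_angle_measure: "integrable (angle_measure n) g"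
proof -
  have c: "continuous_on {0..pi} (\<lambda>\<theta>. g \<theta> * sin \<theta> ^ (n - 2) / angle_const n)"
    using angle_const_pos[of n] by (intro continuous_intros g) auto
  have si: "set_integrable lborel {0..pi} (\<lambda>\<theta>. g \<theta> * sin \<theta> ^ (n - 2) / angle_const n)"
    using borel_integrable_atLeastAtMost'[OF c] .
  have nn: "AE \<theta> in lborel. 0 \<le> indicator {0..pi} \<theta> * sin \<theta> ^ (n - 2) / angle_const n"
    using angle_const_pos[of n]
    by (intro AE_I2 divide_nonneg_pos) (auto simp: indicator_def intro!: zero_le_power sin_ge_zero)
  have eq: "(\<lambda>\<theta>. (indicator {0..pi} \<theta> * sin \<theta> ^ (n - 2) / angle_const n) *\<^sub>R g \<theta>) =
     (\<lambda>\<theta>. indicator {0..pi} \<theta> *\<^sub>R (g \<theta> * sin \<theta> ^ (n - 2) / angle_const n))"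
    by (auto simp: indicator_def)
  have "(\<integral>\<theta>. g \<theta> \<partial>angle_measure n) =
      (\<integral>\<theta>. (indicator {0..pi} \<theta> * sin \<theta> ^ (n - 2) / angle_const n) *\<^sub>R g \<theta> \<partial>lborel)"
    unfolding angle_measure_def by (rule integral_density) (use nn in measurable)
  also have "\<dots> = integral {0..pi} (\<lambda>\<theta>. g \<theta> * sin \<theta> ^ (n - 2) / angle_const n)"
    using set_borel_integral_eq_integral(2)[OF si] unfolding eq set_lebesgue_integral_def .
  also have "\<dots> = integral {0..pi} (\<lambda>\<theta>. g \<theta> * sin \<theta> ^ (n - 2)) / angle_const n"
    by (rule integral_divide)
  finally show "(\<integral>\<theta>. g \<theta> \<partial>angle_measure n) = integral {0..pi} (\<lambda>\<theta>. g \<theta> * sin \<theta> ^ (n - 2)) / angle_const n" .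
  show "integrable (angle_measure n) g"
    unfolding angle_measure_def
    using nn si unfolding set_integrable_def by (subst integrable_density) (simp_all only: eq, measurable)
qed

lemma prob_space_angle_measure: "prob_space (angle_measure n)"
proof
  have i: "integrable (angle_measure n) (\<lambda>_. 1::real)"
    by (rule integrable_angle_measure) auto
  have "(\<integral>\<theta>. (\<lambda>_. 1) \<theta> \<partial>angle_measure n) = integral {0..pi} (\<lambda>\<theta>. (\<lambda>_. 1) \<theta> * sin \<theta> ^ (n - 2)) / angle_const n"
    by (rule integral_angle_measure) auto
  also have "\<dots> = 1" using angle_const_pos[of n] by (simp add: angle_const_def)
  finally have "(\<integral>\<theta>. 1 \<partial>angle_measure n) = (1::real)" .
  then have "(\<integral>\<^sup>+\<theta>. ennreal 1 \<partial>angle_measure n) = ennreal 1"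
    using i by (subst nn_integral_eq_integral) auto
  then show "emeasure (angle_measure n) (space (angle_measure n)) = 1" by simp
qed

lemma DERIV_power_plus1:
  fixes f :: "real \<Rightarrow> real"
  assumes "(f has_real_derivative D) (at x within S)"
  shows "((\<lambda>x. f x ^ (m + 1)) has_real_derivative (real m + 1) * f x ^ m * D) (at x within S)"
  using DERIV_power[OF assms, of "m + 1"] by (simp add: algebra_simps)

text \<open>The integrand of the difference of the two sides is the derivative of
\<open>cos \<theta> ^ (k + 1) * sin \<theta> ^ (n - 1)\<close>, which vanishes at \<open>0\<close> and at \<open>\<pi>\<close>.\<close>

lemma cos_moment_rec:
  assumes "n \<ge> 2"
  shows "(real k + real n) * (\<integral>\<theta>. cos \<theta> ^ (k + 2) \<partial>angle_measure n) =
         (real k + 1) * (\<integral>\<theta>. cos \<theta> ^ k \<partial>angle_measure n)"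
proof -
  obtain m where n: "n = m + 2" by (rule that[of "n - 2"]) (use assms in simp)
  define I where "I j = integral {0..pi} (\<lambda>\<theta>. cos \<theta> ^ j * sin \<theta> ^ m)" for j
  have I: "((\<lambda>\<theta>. cos \<theta> ^ j * sin \<theta> ^ m) has_integral I j) {0..pi}" for j
    unfolding I_def by (intro integrable_integral integrable_continuous_interval continuous_intros)
  have "((\<lambda>\<theta>. (real k + real n) * (cos \<theta> ^ (k+2) * sin \<theta> ^ m) - (real k + 1) * (cos \<theta> ^ k * sin \<theta> ^ m))
      has_integral (real k + real n) * I (k+2) - (real k + 1) * I k) {0..pi}"
    by (intro has_integral_diff has_integral_mult_right I)
  moreover have "((\<lambda>\<theta>. (real k + real n) * (cos \<theta> ^ (k+2) * sin \<theta> ^ m) - (real k + 1) * (cos \<theta> ^ k * sin \<theta> ^ m))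
      has_integral (cos pi ^ (k+1) * sin pi ^ (m+1)) - (cos 0 ^ (k+1) * sin 0 ^ (m+1))) {0..pi}"
  proof (rule fundamental_theorem_of_calculus)
    fix \<theta> :: real
    have s2: "sin \<theta> * sin \<theta> = 1 - cos \<theta> * cos \<theta>"
      by (simp add: sin_squared_eq power2_eq_square[symmetric])
    have "((\<lambda>\<theta>. cos \<theta> ^ (k+1) * sin \<theta> ^ (m+1)) has_real_derivative
      (real k + real n) * (cos \<theta> ^ (k+2) * sin \<theta> ^ m) - (real k + 1) * (cos \<theta> ^ k * sin \<theta> ^ m)) (at \<theta>)"
    proof (rule DERIV_cong)
      show "((\<lambda>\<theta>. cos \<theta> ^ (k+1) * sin \<theta> ^ (m+1)) has_real_derivative
         (real k + 1) * cos \<theta> ^ k * (- sin \<theta>) * sin \<theta> ^ (m+1)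
          + cos \<theta> ^ (k+1) * ((real m + 1) * sin \<theta> ^ m * cos \<theta>)) (at \<theta>)"
        using DERIV_mult[OF DERIV_power_plus1[OF DERIV_cos[of \<theta>], where m=k]
            DERIV_power_plus1[OF DERIV_sin[of \<theta>], where m=m]]
        by (simp add: algebra_simps)
      have "(real k + 1) * cos \<theta> ^ k * (- sin \<theta>) * sin \<theta> ^ (m+1)
          = - (real k + 1) * cos \<theta> ^ k * sin \<theta> ^ m * (sin \<theta> * sin \<theta>)"
        by (simp only: power_add power_one_right mult_minus_left mult_minus_right mult_ac)
      then show "(real k + 1) * cos \<theta> ^ k * (- sin \<theta>) * sin \<theta> ^ (m+1)
          + cos \<theta> ^ (k+1) * ((real m + 1) * sin \<theta> ^ m * cos \<theta>) =
         (real k + real n) * (cos \<theta> ^ (k+2) * sin \<theta> ^ m) - (real k + 1) * (cos \<theta> ^ k * sin \<theta> ^ m)"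
        unfolding s2 by (simp add: n algebra_simps power2_eq_square)
    qed
    then show "((\<lambda>\<theta>. cos \<theta> ^ (k+1) * sin \<theta> ^ (m+1)) has_vector_derivative
      (real k + real n) * (cos \<theta> ^ (k+2) * sin \<theta> ^ m) - (real k + 1) * (cos \<theta> ^ k * sin \<theta> ^ m)) (at \<theta> within {0..pi})"
      by (simp add: has_real_derivative_iff_has_vector_derivative has_vector_derivative_at_within)
  qed simp
  ultimately have "(real k + real n) * I (k+2) - (real k + 1) * I k =
      cos pi ^ (k+1) * sin pi ^ (m+1) - cos 0 ^ (k+1) * sin 0 ^ (m+1)"
    by (rule has_integral_unique)
  then have "(real k + real n) * I (k+2) - (real k + 1) * I k = 0"
    by simp
  moreover have "(\<integral>\<theta>. cos \<theta> ^ j \<partial>angle_measure n) = I j / angle_const n" for j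
    by (subst integral_angle_measure) (auto simp: I_def n intro!: continuous_intros)
  ultimately show ?thesis
    by (simp only: times_divide_eq_right) simp
qed

lemma cos_moment_1:
  assumes "n \<ge> 2"
  shows "(\<integral>\<theta>. cos \<theta> \<partial>angle_measure n) = 0"
proof -
  obtain m where n: "n = m + 2" by (rule that[of "n - 2"]) (use assms in simp)
  have "((\<lambda>\<theta>. cos \<theta> * sin \<theta> ^ m) has_integral
      (sin pi ^ (m+1) / (real m + 1)) - (sin 0 ^ (m+1) / (real m + 1))) {0..pi}"
  proof (rule fundamental_theorem_of_calculus)
    fix \<theta> :: real
    have "((\<lambda>\<theta>. sin \<theta> ^ (m+1) / (real m + 1)) has_real_derivative (cos \<theta> * sin \<theta> ^ m)) (at \<theta>)"
      using DERIV_cdivide[OF DERIV_power_plus1[OF DERIV_sin[of \<theta>], where m=m], of "real m + 1"] by (simp add: mult.commute)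
    then show "((\<lambda>\<theta>. sin \<theta> ^ (m+1) / (real m + 1)) has_vector_derivative (cos \<theta> * sin \<theta> ^ m)) (at \<theta> within {0..pi})"
      by (simp add: has_real_derivative_iff_has_vector_derivative has_vector_derivative_at_within)
  qed simp
  then show ?thesis
    by (subst integral_angle_measure) (auto simp: n dest!: integral_unique intro!: continuous_intros)
qed

lemma cos_moment_odd:
  assumes "n \<ge> 2" "odd k"
  shows "(\<integral>\<theta>. cos \<theta> ^ k \<partial>angle_measure n) = 0"
  using assms(2)
proof (induction k rule: less_induct)
  case (less k)
  show ?case
  proof (cases "k = 1")
    case True
    then show ?thesis using cos_moment_1[OF assms(1)] by simp
  next
    case False
    then obtain j where j: "k = j + 2" "odd j"
      using less.prems False by (auto elim!: oddE intro!: that[of "k - 2"])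
    have "(\<integral>\<theta>. cos \<theta> ^ j \<partial>angle_measure n) = 0" using less.IH[OF _ j(2)] j(1) by simp
    then have "(real j + real n) * (\<integral>\<theta>. cos \<theta> ^ (j + 2) \<partial>angle_measure n) = 0"
      using cos_moment_rec[OF assms(1), of j] by simp
    then show ?thesis using j(1) assms(1) by simp
  qed
qed

section \<open>Finite Borel measures and Gaussian integrals\<close>

text \<open>Indicators of closed sets are decreasing limits of continuous functions of the distance to the
set, and the closed sets generate the Borel sets.\<close>

lemma finite_measure_eqI_continuous:
  fixes M N :: "'a::metric_space measure"
  assumes "finite_measure M" "finite_measure N"
    and [measurable_cong, simp]: "sets M = sets borel" "sets N = sets borel"
    and eq: "\<And>f::'a \<Rightarrow> real. continuous_on UNIV f \<Longrightarrow> (\<And>x. 0 \<le> f x \<and> f x \<le> 1) \<Longrightarrow>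
                (\<integral>x. f x \<partial>M) = (\<integral>x. f x \<partial>N)"
  shows "M = N"
proof -
  interpret M: finite_measure M by fact
  interpret N: finite_measure N by fact
  have closed: "measure M C = measure N C" if C: "closed C" for C :: "'a set"
  proof (cases "C = {}")
    case False
    define f :: "nat \<Rightarrow> 'a \<Rightarrow> real" where "f n x = max 0 (1 - real n * infdist x C)" for n x
    have cont: "continuous_on UNIV (f n)" for n
      unfolding f_def by (intro continuous_intros)
    have bd: "0 \<le> f n x \<and> f n x \<le> 1" for n x
      unfolding f_def by (auto simp: infdist_nonneg)
    have lim: "(\<lambda>n. f n x) \<longlonglongrightarrow> indicator C x" for x
    proof (cases "x \<in> C")
      case True
      then show ?thesis using False by (simp add: f_def)
    next
      case x: False
      then have pos: "infdist x C > 0"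
        using C False by (simp add: infdist_pos_not_in_closed)
      obtain n0 where n0: "1 < real n0 * infdist x C"
        using reals_Archimedean3[OF pos] by blast
      have "f n x = 0" if "n \<ge> n0" for n
      proof -
        have "real n0 * infdist x C \<le> real n * infdist x C"
          using that pos by (intro mult_right_mono) auto
        then show ?thesis using n0 unfolding f_def by linarith
      qed
      then have "eventually (\<lambda>n. f n x = indicator C x) sequentially"
        using x by (auto simp: eventually_sequentially)
      then show ?thesis by (rule tendsto_eventually)
    qed
    have [measurable]: "f n \<in> borel_measurable borel" for n
      using cont by (rule borel_measurable_continuous_onI)
    have Cb[measurable]: "C \<in> sets borel" using C by auto
    have M: "(\<lambda>n. \<integral>x. f n x \<partial>M) \<longlonglongrightarrow> (\<integral>x. indicator C x \<partial>M)"
      by (rule integral_dominated_convergence[where w="\<lambda>_. 1"]) (use lim bd in auto)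
    have N: "(\<lambda>n. \<integral>x. f n x \<partial>N) \<longlonglongrightarrow> (\<integral>x. indicator C x \<partial>N)"
      by (rule integral_dominated_convergence[where w="\<lambda>_. 1"]) (use lim bd in auto)
    have "(\<integral>x. indicator C x \<partial>M) = (\<integral>x. indicator C x \<partial>N :: real)"
      using LIMSEQ_unique[OF M[unfolded eq[OF cont bd]] N] .
    then show ?thesis using sets_eq_imp_space_eq[OF assms(3)] sets_eq_imp_space_eq[OF assms(4)] by simp
  qed simp
  show ?thesis
  proof (rule measure_eqI_generator_eq[where E="Collect closed" and \<Omega>=UNIV and A="\<lambda>_. UNIV"])
    show "Int_stable (Collect closed :: 'a set set)" by (auto simp: Int_stable_def)
    show "sets M = sigma_sets UNIV (Collect closed)" "sets N = sigma_sets UNIV (Collect closed)"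
      by (simp_all add: borel_eq_closed)
    show "emeasure M X = emeasure N X" if "X \<in> Collect closed" for X
      using closed[of X] that by (simp add: M.emeasure_eq_measure N.emeasure_eq_measure)
  qed (auto simp: M.emeasure_eq_measure)
qed

lemma nn_integral_lborel_affine:
  fixes f :: "'a::euclidean_space \<Rightarrow> ennreal"
  assumes [measurable]: "f \<in> borel_measurable borel" and c: "c \<noteq> 0"
  shows "(\<integral>\<^sup>+x. f x \<partial>lborel) = ennreal (\<bar>c\<bar> ^ DIM('a)) * (\<integral>\<^sup>+x. f (t + c *\<^sub>R x) \<partial>lborel)"
  by (subst lborel_affine[OF c, of t])
     (simp add: nn_integral_density nn_integral_distr nn_integral_cmult)

lemma nn_integral_gaussian_finite:
  assumes "c > 0"
  shows "(\<integral>\<^sup>+x. ennreal (exp (- c * (norm (x - m))\<^sup>2)) \<partial>(lborel :: 'a::euclidean_space measure)) < \<infinity>"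
proof -
  have one: "(\<integral>\<^sup>+x. ennreal (exp (- c * x\<^sup>2)) \<partial>lborel) < \<infinity>"
  proof -
    have "integrable lborel (normal_density 0 (1 / sqrt (2 * c)))"
      using assms by (intro integrable_normal_density) auto
    then have "integrable lborel (\<lambda>x. sqrt (2 * pi * (1 / sqrt (2 * c))\<^sup>2) * normal_density 0 (1 / sqrt (2 * c)) x)"
      by (intro integrable_mult_right)
    moreover have "sqrt (2 * pi * (1 / sqrt (2 * c))\<^sup>2) * normal_density 0 (1 / sqrt (2 * c)) x = exp (- c * x\<^sup>2)" for x
      using assms by (simp add: normal_density_def power_divide)
    ultimately have "integrable lborel (\<lambda>x. exp (- c * x\<^sup>2))" by simp
    then show ?thesis by (simp add: integrable_iff_bounded)
  qed
  have "(\<integral>\<^sup>+x. ennreal (exp (- c * (norm (x - m))\<^sup>2)) \<partial>(lborel :: 'a measure))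
      = (\<integral>\<^sup>+x. ennreal (exp (- c * (norm x)\<^sup>2)) \<partial>(lborel :: 'a measure))"
    by (subst nn_integral_lborel_affine[where c=1 and t=m]) auto
  also have "\<dots> = (\<integral>\<^sup>+x. (\<Prod>b\<in>Basis. ennreal (exp (- c * (x \<bullet> b)\<^sup>2))) \<partial>(lborel :: 'a measure))"
  proof (rule nn_integral_cong)
    fix x :: 'a
    have "- c * (norm x)\<^sup>2 = (\<Sum>b\<in>Basis. - c * (x \<bullet> b)\<^sup>2)"
      unfolding power2_norm_eq_inner sum_distrib_left[symmetric] euclidean_inner[of x x]
      by (simp only: power2_eq_square)
    then show "ennreal (exp (- c * (norm x)\<^sup>2)) = (\<Prod>b\<in>Basis. ennreal (exp (- c * (x \<bullet> b)\<^sup>2)))"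
      by (simp only: exp_sum[OF finite_Basis] prod_ennreal exp_ge_zero)
  qed
  also have "\<dots> = (\<Prod>b\<in>(Basis::'a set). (\<integral>\<^sup>+x. ennreal (exp (- c * x\<^sup>2)) \<partial>lborel))"
    by (rule nn_integral_lborel_prod) auto
  also have "\<dots> < \<infinity>"
    using one by (simp add: power_less_top_ennreal)
  finally show ?thesis .
qed

lemma integrable_gaussian:
  "c > 0 \<Longrightarrow> integrable (lborel :: 'a::euclidean_space measure) (\<lambda>x. exp (- c * (norm (x - m))\<^sup>2))"
  using nn_integral_gaussian_finite[of c m] by (simp add: integrable_iff_bounded)

lemma gaussian_integral_pos:
  assumes "c > 0"
  shows "(\<integral>x. exp (- c * (norm (x - m))\<^sup>2) \<partial>(lborel :: 'a::euclidean_space measure)) > 0"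
proof -
  have "(\<integral>x. exp (- c * (norm (x - m))\<^sup>2) \<partial>(lborel :: 'a measure)) \<noteq> 0"
  proof
    assume "(\<integral>x. exp (- c * (norm (x - m))\<^sup>2) \<partial>(lborel :: 'a measure)) = 0"
    then have "AE x in (lborel :: 'a measure). exp (- c * (norm (x - m))\<^sup>2) = 0"
      using integral_nonneg_eq_0_iff_AE[OF integrable_gaussian[OF assms, of m]] by simp
    then have "AE x in (lborel :: 'a measure). False" by simp
    then show False by (auto simp: AE_iff_null null_sets_def)
  qed
  moreover have "(\<integral>x. exp (- c * (norm (x - m))\<^sup>2) \<partial>(lborel :: 'a measure)) \<ge> 0"
    by (intro integral_nonneg_AE) auto
  ultimately show ?thesis by linarith
qed

section \<open>The uniform measure on the sphere\<close>

abbreviation usphere :: "'a::euclidean_space measure" where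
  "usphere \<equiv> uniform_sphere 0 1"

lemma sets_uniform_sphere [measurable_cong, simp]: "sets (uniform_sphere a R) = sets borel"
  by (simp add: uniform_sphere_def surface_measure_def)

lemma space_uniform_sphere [simp]: "space (uniform_sphere a R) = UNIV"
  by (simp add: sets_eq_imp_space_eq[OF sets_uniform_sphere])

lemma nn_integral_uniform_sphere_ball:
  fixes h :: "'a::euclidean_space \<Rightarrow> ennreal"
  assumes [measurable]: "h \<in> borel_measurable borel" and R: "R > 0"
  shows "(\<integral>\<^sup>+y. h y \<partial>uniform_sphere a R) =
    ennreal (1 / unit_ball_vol (real DIM('a))) *
      (\<integral>\<^sup>+y. h (a + R *\<^sub>R sgn y) * indicator (ball 0 1) y \<partial>lborel)"
proof -
  let ?f = "\<lambda>y. a + (R / norm (y - a)) *\<^sub>R (y - a)"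
  define V where "V = unit_ball_vol (real DIM('a))"
  have V: "V > 0" unfolding V_def by simp
  have "(\<integral>\<^sup>+y. h y \<partial>surface_measure a R) =
      ennreal (real DIM('a) / R) * (\<integral>\<^sup>+y. h (?f y) \<partial>restrict_space lborel (ball a R))"
    unfolding surface_measure_def
    by (subst nn_integral_scale_measure)
       (simp_all add: nn_integral_distr[OF radial_projection_measurable])
  also have "(\<integral>\<^sup>+y. h (?f y) \<partial>restrict_space lborel (ball a R)) =
      (\<integral>\<^sup>+y. h (?f y) * indicator (ball a R) y \<partial>lborel)"
    by (subst nn_integral_restrict_space) auto
  also have "\<dots> = ennreal (R ^ DIM('a)) * (\<integral>\<^sup>+y. h (a + R *\<^sub>R sgn y) * indicator (ball 0 1) y \<partial>lborel)"
  proof (subst nn_integral_lborel_affine[where c=R and t=a], goal_cases)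
    case 3
    have "h (?f (a + R *\<^sub>R y)) * indicator (ball a R) (a + R *\<^sub>R y) =
        h (a + R *\<^sub>R sgn y) * indicator (ball 0 1) y" for y
    proof -
      have "(R / norm (R *\<^sub>R y)) *\<^sub>R (R *\<^sub>R y) = R *\<^sub>R sgn y"
        using R by (cases "y = 0") (auto simp: sgn_div_norm field_simps)
      then show ?thesis using R by (simp add: indicator_def dist_norm)
    qed
    then show ?case using R by simp
  next
    case 1
    have [measurable]: "ball a R \<in> sets borel" by simp
    show ?case by measurable
  qed (use R in auto)
  finally have S: "(\<integral>\<^sup>+y. h y \<partial>surface_measure a R) = ennreal (real DIM('a) / R) *
     (ennreal (R ^ DIM('a)) * (\<integral>\<^sup>+y. h (a + R *\<^sub>R sgn y) * indicator (ball 0 1) y \<partial>lborel))" .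
  have area: "unit_sphere_area TYPE('a) = real DIM('a) * V"
  proof -
    have *: "Gamma (real DIM('a) / 2 + 1) = real DIM('a) / 2 * Gamma (real DIM('a) / 2)"
      by (rule Gamma_plus1) (auto dest!: nonpos_Ints_nonpos)
    show ?thesis
      unfolding unit_sphere_area_eq V_def unit_ball_vol_def * by simp
  qed
  have "inverse (unit_sphere_area TYPE('a) * R ^ (DIM('a) - 1)) * (real DIM('a) / R) * R ^ DIM('a) = 1 / V"
  proof -
    obtain n where n: "DIM('a) = Suc n" using DIM_positive[where 'a='a] by (cases "DIM('a)") auto
    have "real DIM('a) > 0" by simp
    then show ?thesis using R V unfolding area by (simp add: n field_simps del: of_nat_Suc)
  qed
  then have c: "ennreal (inverse (unit_sphere_area TYPE('a) * R ^ (DIM('a) - 1))) *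
      (ennreal (real DIM('a) / R) * ennreal (R ^ DIM('a))) = ennreal (1 / V)"
    using R V by (simp add: ennreal_mult[symmetric] area mult.assoc)
  define J where "J = (\<integral>\<^sup>+y. h (a + R *\<^sub>R sgn y) * indicator (ball 0 1) y \<partial>(lborel :: 'a measure))"
  have [measurable]: "h \<in> borel_measurable (surface_measure a R)"
    by (simp add: surface_measure_def)
  have "(\<integral>\<^sup>+y. h y \<partial>uniform_sphere a R) =
      ennreal (inverse (unit_sphere_area TYPE('a) * R ^ (DIM('a) - 1))) *
       (ennreal (real DIM('a) / R) * (ennreal (R ^ DIM('a)) * J))"
    unfolding uniform_sphere_def J_def S[symmetric] by (rule nn_integral_scale_measure) measurable
  also have "\<dots> = ennreal (inverse (unit_sphere_area TYPE('a) * R ^ (DIM('a) - 1))) *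
      (ennreal (real DIM('a) / R) * ennreal (R ^ DIM('a))) * J"
    by (simp only: mult.assoc)
  finally show ?thesis unfolding c J_def V_def .
qed

lemma nn_integral_uniform_sphere:
  fixes h :: "'a::euclidean_space \<Rightarrow> ennreal"
  assumes [measurable]: "h \<in> borel_measurable borel" and R: "R > 0"
  shows "(\<integral>\<^sup>+y. h y \<partial>uniform_sphere a R) = (\<integral>\<^sup>+y. h (a + R *\<^sub>R y) \<partial>usphere)"
  using R by (simp add: nn_integral_uniform_sphere_ball)

lemma prob_space_uniform_sphere:
  assumes R: "R > 0"
  shows "prob_space (uniform_sphere (a :: 'a::euclidean_space) R)"
proof
  have "(\<integral>\<^sup>+y. 1 \<partial>uniform_sphere a R) =
      ennreal (1 / unit_ball_vol (real DIM('a))) * emeasure lborel (ball 0 1 :: 'a set)"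
    using R by (subst nn_integral_uniform_sphere_ball) auto
  also have "\<dots> = 1"
    using less_imp_neq[OF unit_ball_vol_pos[of "real DIM('a)"]] by (simp add: emeasure_ball ennreal_mult[symmetric])
  finally show "emeasure (uniform_sphere a R) (space (uniform_sphere a R)) = 1" by simp
qed

lemma AE_usphere_norm: "AE y in (usphere :: 'a::euclidean_space measure). norm y = 1"
proof -
  have "(\<integral>\<^sup>+y. indicator {y. norm y \<noteq> 1} y \<partial>(usphere :: 'a measure)) = 
     ennreal (1 / unit_ball_vol (real DIM('a))) *
      (\<integral>\<^sup>+y. indicator {y. norm y \<noteq> 1} (0 + 1 *\<^sub>R sgn y) * indicator (ball 0 1) y \<partial>(lborel :: 'a measure))"
    by (rule nn_integral_uniform_sphere_ball) auto
  also have "(\<integral>\<^sup>+y. indicator {y. norm y \<noteq> 1} (0 + 1 *\<^sub>R sgn y) * indicator (ball 0 1) y \<partial>(lborel :: 'a measure))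
      = (\<integral>\<^sup>+y. 0 \<partial>(lborel :: 'a measure))"
    by (rule nn_integral_cong_AE) (use AE_lborel_singleton[of "0::'a"] in
        \<open>auto simp: norm_sgn elim!: eventually_mono\<close>)
  finally have "(\<integral>\<^sup>+y. indicator {y. norm y \<noteq> 1} y \<partial>(usphere :: 'a measure)) = 0" by simp
  then have "emeasure (usphere :: 'a measure) {y. norm y \<noteq> 1} = 0"
    by (subst (asm) nn_integral_indicator) auto
  then show ?thesis by (subst AE_iff_null) (auto simp: null_sets_def)
qed

lemma nn_integral_usphere_uminus:
  fixes h :: "'a::euclidean_space \<Rightarrow> ennreal"
  assumes [measurable]: "h \<in> borel_measurable borel"
  shows "(\<integral>\<^sup>+y. h (- y) \<partial>usphere) = (\<integral>\<^sup>+y. h y \<partial>usphere)"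
proof -
  have "(\<integral>\<^sup>+y. h (sgn y) * indicator (ball 0 1) y \<partial>lborel) =
        (\<integral>\<^sup>+y. h (- sgn y) * indicator (ball 0 1) y \<partial>(lborel :: 'a measure))"
    by (subst nn_integral_lborel_affine[where c="-1" and t=0])
       (auto simp: sgn_minus indicator_def intro!: nn_integral_cong)
  then show ?thesis
    by (simp add: nn_integral_uniform_sphere_ball)
qed

text \<open>Integration in polar coordinates for integrands that are a product of a function of the direction
and a function of the norm. Both sides are integrals of \<open>\<rho>\<close> against measures on the half-line, so
it suffices to compare these on the intervals \<open>{..<T}\<close>, where scaling reduces the claim to the unit
ball, that is to the definition of the surface measure. The bound on \<open>h\<close> makes these measures
finite on the intervals.\<close>

lemma nn_integral_polar:
  fixes h :: "'a::euclidean_space \<Rightarrow> ennreal"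
  assumes [measurable]: "h \<in> borel_measurable borel" "\<rho> \<in> borel_measurable borel"
    and bound: "\<And>x. norm x \<le> 1 \<Longrightarrow> h x \<le> 1"
  shows "(\<integral>\<^sup>+x. h (sgn x) * \<rho> (norm x) \<partial>lborel) =
    (\<integral>\<^sup>+y. h y \<partial>usphere) * (\<integral>\<^sup>+x. \<rho> (norm x) \<partial>(lborel :: 'a measure))"
proof -
  define V where "V = unit_ball_vol (real DIM('a))"
  have V: "V > 0" unfolding V_def by simp
  have bnd: "h (sgn x) \<le> 1" for x by (rule bound) (simp add: norm_sgn)
  define M where "M = distr (density lborel (\<lambda>x. h (sgn x))) borel (norm :: 'a \<Rightarrow> real)"
  define N where "N = scale_measure (\<integral>\<^sup>+y. h y \<partial>usphere) (distr lborel borel (norm :: 'a \<Rightarrow> real))"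
  have em: "emeasure M {..<T} = emeasure N {..<T} \<and> emeasure M {..<T} < \<infinity>" for T :: real
  proof -
    have M: "emeasure M {..<T} = (\<integral>\<^sup>+x. h (sgn x) * indicator {..<T} (norm x) \<partial>lborel)"
      unfolding M_def by (subst emeasure_distr; (subst emeasure_density)?)
        (auto simp: vimage_def indicator_def intro!: nn_integral_cong)
    have N: "emeasure N {..<T} = (\<integral>\<^sup>+y. h y \<partial>usphere) * emeasure lborel (ball (0::'a) T)"
      unfolding N_def by (simp add: emeasure_distr vimage_def ball_def lessThan_def)
    show ?thesis
    proof (cases "T > 0")
      case False
      then have z: "indicator {..<T} (norm x) = (0::ennreal)" for x :: 'a
        using norm_ge_zero[of x] by (auto simp: indicator_def simp del: norm_ge_zero)
      show ?thesis using False unfolding M N z by (simp add: ball_empty)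
    next
      case True
      have "(\<integral>\<^sup>+x. h (sgn x) * indicator {..<T} (norm x) \<partial>lborel) =
         ennreal (T ^ DIM('a)) * (\<integral>\<^sup>+x. h (sgn x) * indicator (ball 0 1) x \<partial>(lborel :: 'a measure))"
      proof (subst nn_integral_lborel_affine[where c=T and t=0], goal_cases)
        case 3
        have "h (sgn (0 + T *\<^sub>R y)) * indicator {..<T} (norm (0 + T *\<^sub>R y)) =
            h (sgn y) * indicator (ball 0 1) y" for y :: 'a
          using True by (auto simp: indicator_def sgn_scaleR)
        then show ?case using True by simp
      qed (use True in auto)
      also have "(\<integral>\<^sup>+x. h (sgn x) * indicator (ball 0 1) x \<partial>(lborel :: 'a measure)) =
         ennreal V * (\<integral>\<^sup>+y. h y \<partial>usphere)"
        using V by (simp add: nn_integral_uniform_sphere_ball V_def[symmetric] mult.assoc[symmetric]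
            ennreal_mult[symmetric])
      finally have "emeasure M {..<T} = emeasure N {..<T}"
        unfolding M N using True V by (simp add: emeasure_ball V_def ennreal_mult mult_ac)
      moreover have "emeasure M {..<T} \<le> (\<integral>\<^sup>+x. indicator (ball 0 T) x \<partial>(lborel :: 'a measure))"
        unfolding M using bnd by (intro nn_integral_mono) (auto simp: indicator_def)
      moreover have "\<dots> < \<infinity>" using True by (simp add: emeasure_ball)
      ultimately show ?thesis by (metis le_less_trans)
    qed
  qed
  have "M = N"
  proof (rule measure_eqI_generator_eq[where E="range lessThan" and \<Omega>=UNIV and A="\<lambda>n. {..<real n}"])
    show "Int_stable (range lessThan :: real set set)"
    proof (clarsimp simp: Int_stable_def)
      fix a b :: real
      have "{..<a} \<inter> {..<b} = {..<min a b}" by auto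
      then show "{..<a} \<inter> {..<b} \<in> range lessThan" by blast
    qed
    show "sets M = sigma_sets UNIV (range lessThan)" "sets N = sigma_sets UNIV (range lessThan)"
      by (simp_all add: M_def N_def borel_Iio)
    show "(\<Union>n. {..<real n}) = UNIV" by (auto intro: reals_Archimedean2)
    show "emeasure M {..<real i} \<noteq> \<infinity>" for i using em[of "real i"] by (metis less_irrefl)
  qed (use em in auto)
  have "(\<integral>\<^sup>+x. h (sgn x) * \<rho> (norm x) \<partial>lborel) = (\<integral>\<^sup>+r. \<rho> r \<partial>M)"
    unfolding M_def by (subst nn_integral_distr; (subst nn_integral_density)?) auto
  also have "\<dots> = (\<integral>\<^sup>+y. h y \<partial>usphere) * (\<integral>\<^sup>+x. \<rho> (norm x) \<partial>(lborel :: 'a measure))"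
    unfolding \<open>M = N\<close> N_def by (subst nn_integral_scale_measure) (auto simp: nn_integral_distr)
  finally show ?thesis .
qed

lemma gaussian_radial_moment_scale:
  assumes u: "u > 0"
  shows "(\<integral>\<^sup>+x. ennreal (norm x ^ k * exp (- (u\<^sup>2 * (norm x)\<^sup>2) / 2)) \<partial>(lborel :: 'a::euclidean_space measure)) =
    ennreal (1 / u ^ (k + DIM('a))) * (\<integral>\<^sup>+x. ennreal (norm x ^ k * exp (- (norm x)\<^sup>2 / 2)) \<partial>(lborel :: 'a measure))"
proof (subst nn_integral_lborel_affine[where c="1/u" and t=0], goal_cases)
  case 3
  have "ennreal (norm (0 + (1 / u) *\<^sub>R x) ^ k * exp (- (u\<^sup>2 * (norm (0 + (1 / u) *\<^sub>R x))\<^sup>2) / 2)) =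
      ennreal (1 / u ^ k) * ennreal (norm x ^ k * exp (- (norm x)\<^sup>2 / 2))" for x :: 'a
    using u by (simp add: ennreal_mult[symmetric] power_divide power_mult_distrib)
  moreover have "ennreal (\<bar>1 / u\<bar> ^ DIM('a)) * ennreal (1 / u ^ k) = ennreal (1 / u ^ (k + DIM('a)))"
    using u by (simp add: ennreal_mult[symmetric] power_add power_divide)
  ultimately show ?case
    by (simp only: nn_integral_cmult mult.assoc[symmetric]) (subst nn_integral_cmult, measurable, simp add: mult.assoc[symmetric])
qed (use u in auto)

text \<open>This replaces integration by parts in the radial variable, which would need a density for the
norm. Writing \<open>norm x ^ k * exp (- (norm x)\<^sup>2 / 2)\<close> as the integral over \<open>u \<ge> 1\<close> of minus the
derivative of \<open>norm x ^ k * exp (- u\<^sup>2 (norm x)\<^sup>2 / 2)\<close>, exchanging the integrals and scaling by \<open>u\<close>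
leaves the elementary integral of \<open>u powr (- (k + n) - 1)\<close> over \<open>u \<ge> 1\<close>.\<close>

lemma gaussian_radial_moment_rec:
  "(\<integral>\<^sup>+x. ennreal (norm x ^ (k + 2) * exp (- (norm x)\<^sup>2 / 2)) \<partial>(lborel :: 'a::euclidean_space measure)) =
    ennreal (real (k + DIM('a))) * (\<integral>\<^sup>+x. ennreal (norm x ^ k * exp (- (norm x)\<^sup>2 / 2)) \<partial>(lborel :: 'a measure))"
  (is "?F (k + 2) = _ * ?F k")
proof -
  define n where "n = k + DIM('a)"
  have n: "n > 0" by (simp add: n_def)
  have inner: "(\<integral>\<^sup>+u. ennreal (u * r ^ (k + 2) * exp (- (u\<^sup>2 * r\<^sup>2) / 2)) * indicator {1..} u \<partial>lborel) =
      ennreal (r ^ k * exp (- r\<^sup>2 / 2))" if r: "r > 0" for r :: real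
  proof -
    have "((\<lambda>u. - (r ^ k * exp (- (u\<^sup>2 * r\<^sup>2) / 2))) \<longlongrightarrow> - (r ^ k * 0)) at_top"
      using r by (intro tendsto_intros filterlim_compose[OF exp_at_bot]) real_asymp
    then have "(\<integral>\<^sup>+u. ennreal (u * r ^ (k + 2) * exp (- (u\<^sup>2 * r\<^sup>2) / 2)) * indicator {1..} u \<partial>lborel) =
      ennreal (- (r ^ k * 0) - (- (r ^ k * exp (- (1\<^sup>2 * r\<^sup>2) / 2))))"
      using r by (intro nn_integral_FTC_atLeast)
        (auto intro!: derivative_eq_intros simp: power2_eq_square)
    then show ?thesis by simp
  qed
  have "?F k = (\<integral>\<^sup>+x. (\<integral>\<^sup>+u. ennreal (u * norm x ^ (k + 2) * exp (- (u\<^sup>2 * (norm x)\<^sup>2) / 2)) * indicator {1..} u \<partial>lborel) \<partial>(lborel :: 'a measure))"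
  proof (rule nn_integral_cong_AE)
    show "AE x in (lborel :: 'a measure). ennreal (norm x ^ k * exp (- (norm x)\<^sup>2 / 2)) =
      (\<integral>\<^sup>+u. ennreal (u * norm x ^ (k + 2) * exp (- (u\<^sup>2 * (norm x)\<^sup>2) / 2)) * indicator {1..} u \<partial>lborel)"
      using AE_lborel_singleton[of "0::'a"] by eventually_elim (rule inner[symmetric], simp)
  qed
  also have "\<dots> = (\<integral>\<^sup>+u. (\<integral>\<^sup>+x. ennreal (u * norm x ^ (k + 2) * exp (- (u\<^sup>2 * (norm x)\<^sup>2) / 2)) * indicator {1..} u \<partial>(lborel :: 'a measure)) \<partial>lborel)"
    by (rule lborel_pair.Fubini') measurable
  also have "\<dots> = (\<integral>\<^sup>+u. ennreal (1 / u ^ (n + 1)) * indicator {1..} u * ?F (k + 2) \<partial>lborel)"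
  proof (rule nn_integral_cong)
    fix u :: real
    show "(\<integral>\<^sup>+x. ennreal (u * norm x ^ (k + 2) * exp (- (u\<^sup>2 * (norm x)\<^sup>2) / 2)) * indicator {1..} u \<partial>(lborel :: 'a measure))
       = ennreal (1 / u ^ (n + 1)) * indicator {1..} u * ?F (k + 2)"
    proof (cases "u \<ge> 1")
      case True
      have "(\<integral>\<^sup>+x. ennreal (u * norm x ^ (k + 2) * exp (- (u\<^sup>2 * (norm x)\<^sup>2) / 2)) * indicator {1..} u \<partial>(lborel :: 'a measure))
        = (\<integral>\<^sup>+x. ennreal u * ennreal (norm x ^ (k + 2) * exp (- (u\<^sup>2 * (norm x)\<^sup>2) / 2)) \<partial>(lborel :: 'a measure))"
        using True by (intro nn_integral_cong) (simp add: ennreal_mult[symmetric] mult.assoc)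
      also have "\<dots> = ennreal u * (ennreal (1 / u ^ (k + 2 + DIM('a))) * ?F (k + 2))"
        using True by (subst nn_integral_cmult, measurable, subst gaussian_radial_moment_scale) auto
      also have "\<dots> = ennreal (u * (1 / u ^ (k + 2 + DIM('a)))) * ?F (k + 2)"
      proof -
        have "ennreal u * (ennreal A * X) = ennreal (u * A) * X" if "A \<ge> 0" for A X
          using True that by (simp add: ennreal_mult mult.assoc)
        from this[of "1 / u ^ (k + 2 + DIM('a))"] show ?thesis using True by simp
      qed
      also have "u * (1 / u ^ (k + 2 + DIM('a))) = 1 / u ^ (n + 1)"
        using True by (simp add: n_def power_add)
      finally show ?thesis using True by simp
    qed simp
  qed
  also have "\<dots> = (\<integral>\<^sup>+u. ennreal (1 / u ^ (n + 1)) * indicator {1..} u \<partial>lborel) * ?F (k + 2)"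
    by (rule nn_integral_multc) measurable
  also have "(\<integral>\<^sup>+u. ennreal (1 / u ^ (n + 1)) * indicator {1..} u \<partial>lborel) = ennreal (0 - (- 1 / (real n * 1 ^ n)))"
  proof (rule nn_integral_FTC_atLeast[where F="\<lambda>u. - 1 / (real n * u ^ n)" and T=0])
    show "((\<lambda>u. - 1 / (real n * u ^ n)) \<longlongrightarrow> 0) at_top"
      using n by real_asymp
    show "((\<lambda>u. - 1 / (real n * u ^ n)) has_real_derivative 1 / u ^ (n + 1)) (at u)" if "1 \<le> u" for u
    proof -
      obtain m where m: "n = Suc m" using n by (cases n) auto
      have "((\<lambda>u. - 1 / real n * inverse (u ^ n)) has_real_derivative
          - 1 / real n * - (inverse (u ^ n) * (real n * u ^ (n - Suc 0)) * inverse (u ^ n))) (at u)"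
        using that by (intro DERIV_cmult DERIV_inverse' DERIV_pow) simp
      moreover have "- 1 / real n * - (inverse (u ^ n) * (real n * u ^ (n - Suc 0)) * inverse (u ^ n)) = 1 / u ^ (n + 1)"
        using that n unfolding m by (simp add: divide_simps del: of_nat_Suc)
      ultimately have "((\<lambda>u. - 1 / real n * inverse (u ^ n)) has_real_derivative 1 / u ^ (n + 1)) (at u)"
        by (rule DERIV_cong)
      then show ?thesis by (simp add: divide_inverse)
    qed
  qed auto
  finally have "ennreal (real n) * ?F k = ennreal (real n) * (ennreal (1 / real n) * ?F (k + 2))" using n by simp
  also have "\<dots> = ?F (k + 2)"
    using n by (simp add: mult.assoc[symmetric] ennreal_mult[symmetric])
  finally show ?thesis by (simp add: n_def)
qed

text \<open>The weight \<open>E\<close> depends only on the part of \<open>x\<close> orthogonal to \<open>e\<close>, so the law of \<open>x \<bullet> e\<close> under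
\<open>E\<close> is invariant under translations and must be a multiple of Lebesgue measure. The proof is the one of the
uniqueness of Haar measure, a double integral evaluated in two ways. With it the Gaussian integral can
be split along \<open>e\<close> without choosing an orthonormal basis that contains \<open>e\<close>.\<close>

lemma marginal_translation_invariant:
  fixes e :: "'a::euclidean_space"
  assumes e: "norm e = 1" and [measurable]: "f \<in> borel_measurable borel" "g \<in> borel_measurable borel"
  defines "E \<equiv> (\<lambda>x::'a. ennreal (exp (- ((norm x)\<^sup>2 - (x \<bullet> e)\<^sup>2) / 2)))"
  shows "(\<integral>\<^sup>+x. f (x \<bullet> e) * E x \<partial>lborel) * (\<integral>\<^sup>+t. g t \<partial>lborel) =
         (\<integral>\<^sup>+x. g (x \<bullet> e) * E x \<partial>lborel) * (\<integral>\<^sup>+t. f t \<partial>lborel)"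
proof -
  have [measurable]: "E \<in> borel_measurable borel" unfolding E_def by measurable
  have ee: "e \<bullet> e = 1" using e by (simp add: norm_eq_1)
  \<comment> \<open>\<open>E\<close> is constant along the lines in direction \<open>e\<close>.\<close>
  have E: "E (x - t *\<^sub>R e) = E x" for x t
    using ee unfolding E_def power2_norm_eq_inner
    by (simp add: inner_diff_left inner_diff_right inner_commute power2_eq_square algebra_simps)
  have "(\<integral>\<^sup>+x. f (x \<bullet> e) * E x \<partial>lborel) * (\<integral>\<^sup>+t. g t \<partial>lborel) =
      (\<integral>\<^sup>+x. (\<integral>\<^sup>+t. f (x \<bullet> e) * E x * g t \<partial>lborel) \<partial>lborel)"
    by (simp add: nn_integral_multc nn_integral_cmult)
  also have "\<dots> = (\<integral>\<^sup>+x. (\<integral>\<^sup>+t. f (x \<bullet> e) * E x * g (t + x \<bullet> e) \<partial>lborel) \<partial>lborel)"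
  proof (rule nn_integral_cong)
    fix x :: 'a
    show "(\<integral>\<^sup>+t. f (x \<bullet> e) * E x * g t \<partial>lborel) = (\<integral>\<^sup>+t. f (x \<bullet> e) * E x * g (t + x \<bullet> e) \<partial>lborel)"
      by (subst nn_integral_real_affine[where c=1 and t="x \<bullet> e"]) (auto simp: add.commute)
  qed
  also have "\<dots> = (\<integral>\<^sup>+t. (\<integral>\<^sup>+x. f (x \<bullet> e) * E x * g (t + x \<bullet> e) \<partial>lborel) \<partial>lborel)"
    by (rule lborel_pair.Fubini'[symmetric]) measurable
  also have "\<dots> = (\<integral>\<^sup>+t. (\<integral>\<^sup>+x. f (x \<bullet> e - t) * E x * g (x \<bullet> e) \<partial>lborel) \<partial>lborel)"
  proof (rule nn_integral_cong)
    fix t :: real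
    show "(\<integral>\<^sup>+x. f (x \<bullet> e) * E x * g (t + x \<bullet> e) \<partial>lborel) = (\<integral>\<^sup>+x. f (x \<bullet> e - t) * E x * g (x \<bullet> e) \<partial>lborel)"
      using ee E[of _ t]
      by (subst nn_integral_lborel_affine[where c=1 and t="- (t *\<^sub>R e)"]) (auto simp: inner_diff_left inner_add_left)
  qed
  also have "\<dots> = (\<integral>\<^sup>+x. (\<integral>\<^sup>+t. f (x \<bullet> e - t) * E x * g (x \<bullet> e) \<partial>lborel) \<partial>lborel)"
    by (rule lborel_pair.Fubini') measurable
  also have "\<dots> = (\<integral>\<^sup>+x. (\<integral>\<^sup>+t. f t * (E x * g (x \<bullet> e)) \<partial>lborel) \<partial>lborel)"
  proof (rule nn_integral_cong)
    fix x :: 'a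
    have "(\<integral>\<^sup>+t. f t * (E x * g (x \<bullet> e)) \<partial>lborel) = (\<integral>\<^sup>+t. f (x \<bullet> e - t) * (E x * g (x \<bullet> e)) \<partial>lborel)"
      by (subst nn_integral_real_affine[where c="-1" and t="x \<bullet> e"]) auto
    then show "(\<integral>\<^sup>+t. f (x \<bullet> e - t) * E x * g (x \<bullet> e) \<partial>lborel) = (\<integral>\<^sup>+t. f t * (E x * g (x \<bullet> e)) \<partial>lborel)"
      by (simp add: mult.assoc)
  qed
  also have "\<dots> = (\<integral>\<^sup>+x. g (x \<bullet> e) * E x \<partial>lborel) * (\<integral>\<^sup>+t. f t \<partial>lborel)"
    by (simp add: nn_integral_multc nn_integral_cmult mult.commute)
  finally show ?thesis .
qed

lemma gaussian_radial_moment_finite_pos: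
  "even k \<Longrightarrow> 0 < (\<integral>\<^sup>+x. ennreal (norm x ^ k * exp (- (norm x)\<^sup>2 / 2)) \<partial>(lborel :: 'a::euclidean_space measure)) \<and>
   (\<integral>\<^sup>+x. ennreal (norm x ^ k * exp (- (norm x)\<^sup>2 / 2)) \<partial>(lborel :: 'a measure)) < \<infinity>"
proof (induction k rule: less_induct)
  case (less k)
  show ?case
  proof (cases "k = 0")
    case True
    have "(\<integral>x. exp (- (1/2) * (norm (x - 0))\<^sup>2) \<partial>(lborel :: 'a measure)) > 0"
      by (rule gaussian_integral_pos) simp
    moreover have "(\<integral>\<^sup>+x. ennreal (exp (- (1/2) * (norm (x - 0))\<^sup>2)) \<partial>(lborel :: 'a measure)) =
      ennreal (\<integral>x. exp (- (1/2) * (norm (x - 0))\<^sup>2) \<partial>(lborel :: 'a measure))"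
      by (intro nn_integral_eq_integral integrable_gaussian) auto
    ultimately show ?thesis using True by simp
  next
    case False
    then obtain j where j: "k = j + 2" "even j"
      using less.prems by (auto elim!: evenE intro!: that[of "k - 2"])
    have "0 < ennreal (real (j + DIM('a)))" using DIM_positive[where 'a='a] by (subst ennreal_less_zero_iff) (simp add: add_nonneg_pos)
    then show ?thesis
      unfolding j(1) gaussian_radial_moment_rec
      using less.IH[of j] j
      by (simp only: ennreal_zero_less_mult_iff infinity_ennreal_def ennreal_mult_less_top ennreal_less_top) simp
  qed
qed

text \<open>Evaluates the Gaussian integral of \<open>\<bar>x \<bullet> e\<bar> ^ k\<close> in two ways: in polar coordinates, and by
splitting the Gaussian along \<open>e\<close>.\<close>

lemma sphere_abs_moment_gaussian:
  fixes e :: "'a::euclidean_space"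
  assumes e: "norm e = 1"
  shows "(\<integral>\<^sup>+y. ennreal (\<bar>y \<bullet> e\<bar> ^ k) \<partial>usphere) *
     (\<integral>\<^sup>+x. ennreal (norm x ^ k * exp (- (norm x)\<^sup>2 / 2)) \<partial>(lborel :: 'a measure)) *
     (\<integral>\<^sup>+t. ennreal (norm t ^ 0 * exp (- (norm t)\<^sup>2 / 2)) \<partial>(lborel :: real measure)) =
     (\<integral>\<^sup>+x. ennreal (norm x ^ 0 * exp (- (norm x)\<^sup>2 / 2)) \<partial>(lborel :: 'a measure)) *
     (\<integral>\<^sup>+t. ennreal (norm t ^ k * exp (- (norm t)\<^sup>2 / 2)) \<partial>(lborel :: real measure))"
proof -
  have "(\<integral>\<^sup>+y. ennreal (\<bar>y \<bullet> e\<bar> ^ k) \<partial>usphere) *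
     (\<integral>\<^sup>+x. ennreal (norm x ^ k * exp (- (norm x)\<^sup>2 / 2)) \<partial>(lborel :: 'a measure)) =
     (\<integral>\<^sup>+x. ennreal (\<bar>sgn x \<bullet> e\<bar> ^ k) * ennreal (norm x ^ k * exp (- (norm x)\<^sup>2 / 2)) \<partial>lborel)"
  proof (rule nn_integral_polar[symmetric])
    fix x :: 'a assume "norm x \<le> 1"
    then have "\<bar>x \<bullet> e\<bar> \<le> 1" using Cauchy_Schwarz_ineq2[of x e] e by simp
    then show "ennreal (\<bar>x \<bullet> e\<bar> ^ k) \<le> 1" by (simp add: power_le_one)
  qed measurable
  also have "\<dots> = (\<integral>\<^sup>+x. ennreal (\<bar>x \<bullet> e\<bar> ^ k * exp (- (x \<bullet> e)\<^sup>2 / 2)) *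
        ennreal (exp (- ((norm x)\<^sup>2 - (x \<bullet> e)\<^sup>2) / 2)) \<partial>lborel)"
  proof (rule nn_integral_cong)
    fix x :: 'a
    have "\<bar>sgn x \<bullet> e\<bar> * norm x = \<bar>x \<bullet> e\<bar>"
      by (cases "x = 0") (auto simp: sgn_div_norm abs_mult field_simps)
    then have "\<bar>sgn x \<bullet> e\<bar> ^ k * norm x ^ k = \<bar>x \<bullet> e\<bar> ^ k"
      by (metis power_mult_distrib)
    moreover have "exp (- (x \<bullet> e)\<^sup>2 / 2) * exp (- ((norm x)\<^sup>2 - (x \<bullet> e)\<^sup>2) / 2) = exp (- (norm x)\<^sup>2 / 2)"
      by (simp add: exp_add[symmetric] field_simps)
    ultimately have "\<bar>sgn x \<bullet> e\<bar> ^ k * (norm x ^ k * exp (- (norm x)\<^sup>2 / 2)) =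
        (\<bar>x \<bullet> e\<bar> ^ k * exp (- (x \<bullet> e)\<^sup>2 / 2)) * exp (- ((norm x)\<^sup>2 - (x \<bullet> e)\<^sup>2) / 2)"
      by (metis mult.assoc)
    then show "ennreal (\<bar>sgn x \<bullet> e\<bar> ^ k) * ennreal (norm x ^ k * exp (- (norm x)\<^sup>2 / 2)) =
      ennreal (\<bar>x \<bullet> e\<bar> ^ k * exp (- (x \<bullet> e)\<^sup>2 / 2)) * ennreal (exp (- ((norm x)\<^sup>2 - (x \<bullet> e)\<^sup>2) / 2))"
      by (subst (1 2) ennreal_mult[symmetric]) (auto simp del: exp_minus_inverse)
  qed
  finally have 1: "(\<integral>\<^sup>+y. ennreal (\<bar>y \<bullet> e\<bar> ^ k) \<partial>usphere) *
     (\<integral>\<^sup>+x. ennreal (norm x ^ k * exp (- (norm x)\<^sup>2 / 2)) \<partial>(lborel :: 'a measure)) = \<dots>" .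
  have 0: "(\<integral>\<^sup>+x. ennreal (exp (- (x \<bullet> e)\<^sup>2 / 2)) * ennreal (exp (- ((norm x)\<^sup>2 - (x \<bullet> e)\<^sup>2) / 2)) \<partial>lborel)
     = (\<integral>\<^sup>+x. ennreal (norm x ^ 0 * exp (- (norm x)\<^sup>2 / 2)) \<partial>(lborel :: 'a measure))"
    by (intro nn_integral_cong) (simp add: ennreal_mult[symmetric] exp_add[symmetric] field_simps)
  show ?thesis
    unfolding 1 0[symmetric]
    using marginal_translation_invariant[OF e, of "\<lambda>t. ennreal (\<bar>t\<bar> ^ k * exp (- t\<^sup>2 / 2))" "\<lambda>t. ennreal (exp (- t\<^sup>2 / 2))"]
    by (simp del: exp_minus_inverse)
qed

text \<open>The radial moments of the standard Gaussian in dimension \<open>n\<close> and in dimension \<open>1\<close> satisfy their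
recursions with factors \<open>k + n\<close> and \<open>k + 1\<close>, so the moments of the sphere satisfy the recursion
with the quotient.\<close>

lemma sphere_abs_moment_rec:
  fixes e :: "'a::euclidean_space"
  assumes e: "norm e = 1" and k: "even k"
  shows "ennreal (real k + real DIM('a)) * (\<integral>\<^sup>+y. ennreal (\<bar>y \<bullet> e\<bar> ^ (k + 2)) \<partial>usphere) =
    ennreal (real k + 1) * (\<integral>\<^sup>+y. ennreal (\<bar>y \<bullet> e\<bar> ^ k) \<partial>usphere)"
proof -
  define m where "m k = (\<integral>\<^sup>+y. ennreal (\<bar>y \<bullet> e\<bar> ^ k) \<partial>usphere)" for k
  define F where "F k = (\<integral>\<^sup>+x. ennreal (norm x ^ k * exp (- (norm x)\<^sup>2 / 2)) \<partial>(lborel :: 'a measure))" for k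
  define L where "L k = (\<integral>\<^sup>+t. ennreal (norm t ^ k * exp (- (norm t)\<^sup>2 / 2)) \<partial>(lborel :: real measure))" for k
  have g: "m k * F k * L 0 = F 0 * L k" for k
    using sphere_abs_moment_gaussian[OF e, of k] unfolding m_def F_def L_def .
  have F2: "F (k + 2) = ennreal (real k + real DIM('a)) * F k"
    using gaussian_radial_moment_rec[where 'a='a and k=k] unfolding F_def by simp
  have L2: "L (k + 2) = ennreal (real k + 1) * L k"
    using gaussian_radial_moment_rec[where 'a=real and k=k] unfolding L_def by (simp add: add.commute)
  have F: "0 < F k" "F k < \<infinity>" using gaussian_radial_moment_finite_pos[OF k, where 'a='a] by (auto simp: F_def)
  have L: "0 < L 0" "L 0 < \<infinity>" using gaussian_radial_moment_finite_pos[of 0, where 'a=real] by (auto simp: L_def)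
  have "(F k * L 0) * (ennreal (real k + real DIM('a)) * m (k + 2)) = m (k + 2) * F (k + 2) * L 0"
    unfolding F2 by (simp add: mult_ac)
  also have "\<dots> = F 0 * (ennreal (real k + 1) * L k)" unfolding g L2 ..
  also have "\<dots> = ennreal (real k + 1) * (m k * F k * L 0)" unfolding g by (simp add: mult_ac)
  also have "\<dots> = (F k * L 0) * (ennreal (real k + 1) * m k)" by (simp add: mult_ac)
  finally show ?thesis
    using F L by (auto simp: ennreal_mult_cancel_left m_def ennreal_mult_eq_top_iff)
qed

text \<open>Uniqueness in the moment problem on \<open>[-1, 1]\<close>: polynomials are uniformly dense in the continuous
functions.\<close>

lemma distr_eqI_moments:
  fixes X :: "'a \<Rightarrow> real" and Y :: "'b \<Rightarrow> real"
  assumes "prob_space M" "prob_space N"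
    and [measurable]: "X \<in> borel_measurable M" "Y \<in> borel_measurable N"
    and X: "AE x in M. \<bar>X x\<bar> \<le> 1" and Y: "AE y in N. \<bar>Y y\<bar> \<le> 1"
    and mom: "\<And>k. (\<integral>x. X x ^ k \<partial>M) = (\<integral>y. Y y ^ k \<partial>N)"
  shows "distr M borel X = distr N borel Y"
proof -
  interpret M: prob_space M by fact
  interpret N: prob_space N by fact
  have iX: "integrable M (\<lambda>x. X x ^ k)" for k
  proof (rule M.integrable_const_bound[where B=1])
    show "AE x in M. norm (X x ^ k) \<le> 1"
      using X by eventually_elim (simp add: power_abs power_le_one)
  qed measurable
  have iY: "integrable N (\<lambda>x. Y x ^ k)" for k
  proof (rule N.integrable_const_bound[where B=1])
    show "AE x in N. norm (Y x ^ k) \<le> 1"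
      using Y by eventually_elim (simp add: power_abs power_le_one)
  qed measurable
  have "finite_measure (distr M borel X)" "finite_measure (distr N borel Y)"
    by (auto intro!: M.finite_measure_distr N.finite_measure_distr)
  then show ?thesis
  proof (rule finite_measure_eqI_continuous)
    fix f :: "real \<Rightarrow> real" assume f: "continuous_on UNIV f" and bd: "\<And>x. 0 \<le> f x \<and> f x \<le> 1"
    have [measurable]: "f \<in> borel_measurable borel" using f by (rule borel_measurable_continuous_onI)
    have fX: "integrable M (\<lambda>x. f (X x))"
      by (rule M.integrable_const_bound[where B=1]) (use bd in auto)
    have fY: "integrable N (\<lambda>x. f (Y x))"
      by (rule N.integrable_const_bound[where B=1]) (use bd in auto)
    have "\<bar>(\<integral>x. f (X x) \<partial>M) - (\<integral>x. f (Y x) \<partial>N)\<bar> \<le> 2 * \<epsilon>" if eps: "\<epsilon> > 0" for \<epsilon>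
    proof -
      obtain g where g: "real_polynomial_function g" "\<And>x. x \<in> {-1..1} \<Longrightarrow> \<bar>f x - g x\<bar> < \<epsilon>"
        by (rule Stone_Weierstrass_real_polynomial_function[of "{-1..1}" f \<epsilon>])
           (use eps continuous_on_subset[OF f] that in auto)
      obtain a n where gs: "g = (\<lambda>x. \<Sum>i\<le>(n::nat). a i * x ^ i)"
        using real_polynomial_function_imp_sum[OF g(1)] by blast
      have gX: "integrable M (\<lambda>x. g (X x))" unfolding gs using iX by auto
      have gY: "integrable N (\<lambda>x. g (Y x))" unfolding gs using iY by auto
      have eq: "(\<integral>x. g (X x) \<partial>M) = (\<integral>x. g (Y x) \<partial>N)"
        unfolding gs using iX iY by (simp add: mom)
      have "norm (\<integral>x. f (X x) - g (X x) \<partial>M) \<le> (\<integral>x. \<epsilon> \<partial>M)"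
      proof (rule order_trans[OF integral_norm_bound integral_mono_AE])
        show "AE x in M. norm (f (X x) - g (X x)) \<le> \<epsilon>"
          using X
        proof eventually_elim
          case (elim x)
          have "X x \<in> {-1..1}" using elim by (auto simp: abs_le_iff)
          from g(2)[OF this] show ?case by simp
        qed
      qed (use fX gX in auto)
      moreover have "norm (\<integral>x. f (Y x) - g (Y x) \<partial>N) \<le> (\<integral>x. \<epsilon> \<partial>N)"
      proof (rule order_trans[OF integral_norm_bound integral_mono_AE])
        show "AE x in N. norm (f (Y x) - g (Y x)) \<le> \<epsilon>"
          using Y
        proof eventually_elim
          case (elim x)
          have "Y x \<in> {-1..1}" using elim by (auto simp: abs_le_iff)
          from g(2)[OF this] show ?case by simp
        qed
      qed (use fY gY in auto)
      ultimately show ?thesis using eq fX fY gX gY by (simp add: M.prob_space N.prob_space)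
    qed
    note small = this
    have "(\<integral>x. f (X x) \<partial>M) = (\<integral>x. f (Y x) \<partial>N)"
    proof (rule ccontr)
      assume "(\<integral>x. f (X x) \<partial>M) \<noteq> (\<integral>x. f (Y x) \<partial>N)"
      then have "0 < \<bar>(\<integral>x. f (X x) \<partial>M) - (\<integral>x. f (Y x) \<partial>N)\<bar> / 4" by simp
      from small[OF this] this show False by simp
    qed
    then show "(\<integral>x. f x \<partial>distr M borel X) = (\<integral>x. f x \<partial>distr N borel Y)"
      by (simp add: integral_distr)
  qed auto
qed

lemma AE_usphere_inner_le_1:
  fixes e :: "'a::euclidean_space"
  assumes e: "norm e = 1"
  shows "AE y in usphere. \<bar>y \<bullet> e\<bar> \<le> 1"
  using AE_usphere_norm
proof eventually_elim
  case (elim y)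
  then show ?case using Cauchy_Schwarz_ineq2[of y e] e by simp
qed

text \<open>Odd moments vanish on both sides by symmetry, and the even ones satisfy the same recursion.\<close>

lemma usphere_moment:
  fixes e :: "'a::euclidean_space"
  assumes e: "norm e = 1" and d: "DIM('a) \<ge> 2"
  shows "(\<integral>y. (y \<bullet> e) ^ k \<partial>usphere) = (\<integral>\<theta>. cos \<theta> ^ k \<partial>angle_measure DIM('a))"
proof (cases "even k")
  case False
  have sym: "distr usphere borel uminus = (usphere :: 'a measure)"
    by (rule measure_eqI)
       (simp_all add: nn_integral_indicator[symmetric] nn_integral_distr nn_integral_usphere_uminus del: nn_integral_indicator)
  have "(\<integral>y. (y \<bullet> e) ^ k \<partial>usphere) = (\<integral>y. (y \<bullet> e) ^ k \<partial>distr usphere borel uminus)"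
    unfolding sym ..
  also have "\<dots> = (\<integral>y. - ((y \<bullet> e) ^ k) \<partial>usphere)"
    using False by (subst integral_distr) (auto simp: power_minus_odd)
  finally show ?thesis using cos_moment_odd[OF d False] by simp
next
  case True
  interpret U: prob_space "usphere :: 'a measure" by (rule prob_space_uniform_sphere) simp
  have nn: "(\<integral>\<^sup>+y. ennreal (\<bar>y \<bullet> e\<bar> ^ k) \<partial>usphere) = ennreal (\<integral>y. (y \<bullet> e) ^ k \<partial>usphere)"
    and pos: "0 \<le> (\<integral>y. (y \<bullet> e) ^ k \<partial>usphere)" if "even k" for k
  proof -
    have "integrable usphere (\<lambda>y. (y \<bullet> e) ^ k)"
    proof (rule U.integrable_const_bound[where B=1])
      show "AE y in usphere. norm ((y \<bullet> e) ^ k) \<le> 1"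
        using AE_usphere_inner_le_1[OF e] by eventually_elim (simp add: power_abs power_le_one)
    qed measurable
    then show "(\<integral>\<^sup>+y. ennreal (\<bar>y \<bullet> e\<bar> ^ k) \<partial>usphere) = ennreal (\<integral>y. (y \<bullet> e) ^ k \<partial>usphere)"
      using that by (subst nn_integral_eq_integral[symmetric]) (auto simp: power_even_abs zero_le_even_power)
    show "0 \<le> (\<integral>y. (y \<bullet> e) ^ k \<partial>usphere)"
      using that by (intro integral_nonneg_AE) (auto simp: zero_le_even_power)
  qed
  show ?thesis
    using True
  proof (induction k rule: less_induct)
    case (less k)
    show ?case
    proof (cases "k = 0")
      case True
      then show ?thesis
        using U.prob_space prob_space.prob_space[OF prob_space_angle_measure[of "DIM('a)"]] by simp
    next
      case False
      then obtain j where j: "k = j + 2" "even j"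
        using less.prems by (auto elim!: evenE intro!: that[of "k - 2"])
      have "ennreal ((real j + real DIM('a)) * (\<integral>y. (y \<bullet> e) ^ (j + 2) \<partial>usphere)) =
         ennreal ((real j + 1) * (\<integral>y. (y \<bullet> e) ^ j \<partial>usphere))"
        using sphere_abs_moment_rec[OF e j(2)] nn[of j] nn[of "j + 2"] pos[of j] pos[of "j + 2"] j(2)
        by (simp only: ennreal_mult even_add even_numeral of_nat_0_le_iff add_nonneg_nonneg zero_le_one simp_thms)
      then have "(real j + real DIM('a)) * (\<integral>y. (y \<bullet> e) ^ (j + 2) \<partial>usphere) =
         (real j + 1) * (\<integral>y. (y \<bullet> e) ^ j \<partial>usphere)"
        using pos[of j] pos[of "j + 2"] j(2) by (subst (asm) ennreal_inj) auto
      also have "(\<integral>y. (y \<bullet> e) ^ j \<partial>usphere) = (\<integral>\<theta>. cos \<theta> ^ j \<partial>angle_measure DIM('a))"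
        using less.IH[OF _ j(2)] j(1) by simp
      also have "(real j + 1) * (\<integral>\<theta>. cos \<theta> ^ j \<partial>angle_measure DIM('a)) =
         (real j + real DIM('a)) * (\<integral>\<theta>. cos \<theta> ^ (j + 2) \<partial>angle_measure DIM('a))"
        using cos_moment_rec[OF d, of j] by simp
      finally show ?thesis using d j(1) by (simp only: mult_cancel_left) simp
    qed
  qed
qed

lemma nn_integral_usphere_inner:
  fixes e :: "'a::euclidean_space"
  assumes e: "norm e = 1" and d: "DIM('a) \<ge> 2" and [measurable]: "h \<in> borel_measurable borel"
  shows "(\<integral>\<^sup>+y. h (y \<bullet> e) \<partial>usphere) = (\<integral>\<^sup>+\<theta>. h (cos \<theta>) \<partial>angle_measure DIM('a))"
proof -
  have "distr usphere borel (\<lambda>y. y \<bullet> e) = distr (angle_measure DIM('a)) borel cos"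
    by (rule distr_eqI_moments)
       (auto simp: prob_space_uniform_sphere prob_space_angle_measure AE_usphere_inner_le_1[OF e] usphere_moment[OF e d])
  then have "(\<integral>\<^sup>+s. h s \<partial>distr usphere borel (\<lambda>y. y \<bullet> e)) = (\<integral>\<^sup>+s. h s \<partial>distr (angle_measure DIM('a)) borel cos)"
    by simp
  then show ?thesis by (simp add: nn_integral_distr)
qed

text \<open>The law of cosines in the triangle formed by the centre \<open>a\<close>, the point \<open>x\<close> and the point \<open>y\<close> of the
sphere.\<close>

lemma nn_integral_uniform_sphere_dist:
  fixes x a :: "'a::euclidean_space"
  assumes d: "DIM('a) \<ge> 2" and R: "R > 0" and [measurable]: "h \<in> borel_measurable borel"
  shows "(\<integral>\<^sup>+y. h (dist x y) \<partial>uniform_sphere a R) =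
    (\<integral>\<^sup>+\<theta>. h (sqrt ((dist x a)\<^sup>2 + R\<^sup>2 - 2 * dist x a * R * cos \<theta>)) \<partial>angle_measure DIM('a))"
proof -
  define r where "r = dist x a"
  obtain e :: 'a where e: "norm e = 1" and x: "x - a = r *\<^sub>R e"
  proof (cases "x = a")
    case True
    obtain b :: 'a where "b \<in> Basis" using nonempty_Basis by blast
    then show ?thesis using that[of b] True by (simp add: r_def)
  next
    case False
    then show ?thesis using that[of "sgn (x - a)"]
      by (simp add: r_def dist_norm norm_sgn sgn_div_norm)
  qed
  have "(\<integral>\<^sup>+y. h (dist x y) \<partial>uniform_sphere a R) = (\<integral>\<^sup>+y. h (dist x (a + R *\<^sub>R y)) \<partial>usphere)"
    using R by (subst nn_integral_uniform_sphere) auto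
  also have "\<dots> = (\<integral>\<^sup>+y. h (sqrt (r\<^sup>2 + R\<^sup>2 - 2 * r * R * (y \<bullet> e))) \<partial>usphere)"
  proof (rule nn_integral_cong_AE)
    show "AE y in usphere. h (dist x (a + R *\<^sub>R y)) = h (sqrt (r\<^sup>2 + R\<^sup>2 - 2 * r * R * (y \<bullet> e)))"
      using AE_usphere_norm
    proof eventually_elim
      case (elim y)
      have eq: "x - (a + R *\<^sub>R y) = r *\<^sub>R e - R *\<^sub>R y" using x by (simp add: algebra_simps)
      have "(dist x (a + R *\<^sub>R y))\<^sup>2 = r\<^sup>2 + R\<^sup>2 - 2 * r * R * (y \<bullet> e)"
        unfolding dist_norm eq power2_norm_eq_inner
        using e elim by (simp add: inner_diff_left inner_diff_right inner_commute norm_eq_1 power2_eq_square algebra_simps)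
      then show ?case by (metis real_sqrt_unique zero_le_dist)
    qed
  qed
  also have "\<dots> = (\<integral>\<^sup>+\<theta>. h (sqrt (r\<^sup>2 + R\<^sup>2 - 2 * r * R * cos \<theta>)) \<partial>angle_measure DIM('a))"
    using nn_integral_usphere_inner[OF e d, of "\<lambda>s. h (sqrt (r\<^sup>2 + R\<^sup>2 - 2 * r * R * s))"] by simp
  finally show ?thesis unfolding r_def .
qed

section \<open>Averages of powers of the distance over the unit sphere\<close>

text \<open>The squared distance from a point at distance \<open>r\<close> from the origin to the point of the unit sphere
seen under the angle \<open>\<theta>\<close>.\<close>

definition chord2 :: "real \<Rightarrow> real \<Rightarrow> real" where
  "chord2 r \<theta> = 1 + r\<^sup>2 - 2 * r * cos \<theta>"

text \<open>\<open>Psi n \<gamma> r\<close> is the average of \<open>\<bar>x - y\<bar> powr \<gamma>\<close> over the uniform points \<open>y\<close> of the unit sphere of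
\<open>n\<close>-space when \<open>\<bar>x\<bar> = r\<close>, and \<open>Pot n \<gamma> r\<close> the same average of \<open>\<bar>x - y\<bar> powr \<gamma> / \<gamma>\<close>, or of
\<open>ln \<bar>x - y\<bar>\<close> if \<open>\<gamma> = 0\<close>. The radial derivative of \<open>Pot\<close> is \<open>Slope\<close>, which has the same form for all \<open>\<gamma>\<close>.
On the set \<open>{-1<..<1} \<union> {1<..}\<close> all integrands are smooth; negative \<open>r\<close> are included so that \<open>r = 0\<close>
is an interior point of it.\<close>

definition Psi :: "nat \<Rightarrow> real \<Rightarrow> real \<Rightarrow> real" where
  "Psi n \<gamma> r = (\<integral>\<theta>. chord2 r \<theta> powr (\<gamma> / 2) \<partial>angle_measure n)"

definition Slope :: "nat \<Rightarrow> real \<Rightarrow> real \<Rightarrow> real" where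
  "Slope n \<gamma> r = (\<integral>\<theta>. (r - cos \<theta>) * chord2 r \<theta> powr (\<gamma> / 2 - 1) \<partial>angle_measure n)"

definition Pot :: "nat \<Rightarrow> real \<Rightarrow> real \<Rightarrow> real" where
  "Pot n \<gamma> r = (\<integral>\<theta>. power_potential \<gamma> (sqrt (chord2 r \<theta>)) \<partial>angle_measure n)"

lemma chord2_measurable [measurable]: "chord2 r \<in> borel_measurable borel"
  unfolding chord2_def by measurable

lemma chord2_alt: "chord2 r \<theta> = (1 - r)\<^sup>2 + 2 * r * (1 - cos \<theta>)"
  unfolding chord2_def by (simp add: power2_eq_square algebra_simps)

lemma chord2_nonneg: "chord2 r \<theta> \<ge> 0"
proof -
  have "chord2 r \<theta> = (r - cos \<theta>)\<^sup>2 + (sin \<theta>)\<^sup>2"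
    unfolding chord2_def by (simp add: sin_squared_eq power2_eq_square algebra_simps)
  then show ?thesis by simp
qed

lemma chord2_pos: "r \<in> {-1<..<1} \<union> {1<..} \<Longrightarrow> chord2 r \<theta> > 0"
proof -
  assume r: "r \<in> {-1<..<1} \<union> {1<..}"
  have eq: "chord2 r \<theta> = (r - cos \<theta>)\<^sup>2 + (sin \<theta>)\<^sup>2"
    unfolding chord2_def by (simp add: sin_squared_eq power2_eq_square algebra_simps)
  show ?thesis
  proof (rule ccontr)
    assume "\<not> ?thesis"
    then have "(r - cos \<theta>)\<^sup>2 + (sin \<theta>)\<^sup>2 = 0" using eq chord2_nonneg[of r \<theta>] by linarith
    then have "r = cos \<theta>" "sin \<theta> = 0" by (simp_all add: sum_power2_eq_zero_iff)
    then have "r\<^sup>2 = 1" using sin_cos_squared_add[of \<theta>] by simp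
    then show False using r by (auto simp: power2_eq_1_iff)
  qed
qed

lemma chord2_ge: "r \<ge> 0 \<Longrightarrow> chord2 r \<theta> \<ge> r * (2 - 2 * cos \<theta>)"
  using zero_le_power2[of "1 - r"] unfolding chord2_alt by (simp add: algebra_simps)

lemma chord2_1: "chord2 1 \<theta> = 2 - 2 * cos \<theta>"
  by (simp add: chord2_def)

lemma chord2_1_pos: "0 < \<theta> \<Longrightarrow> \<theta> < pi \<Longrightarrow> chord2 1 \<theta> > 0"
  unfolding chord2_1 using cos_monotone_0_pi[of 0 \<theta>] by simp

lemma continuous_on_chord2_powr [continuous_intros]:
  "r \<in> {-1<..<1} \<union> {1<..} \<Longrightarrow> continuous_on S (\<lambda>\<theta>. chord2 r \<theta> powr p)"
proof -
  assume "r \<in> {-1<..<1} \<union> {1<..}"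
  then have "chord2 r \<theta> \<noteq> 0" for \<theta> using chord2_pos[of r \<theta>] by simp
  then show ?thesis unfolding chord2_def by (intro continuous_intros) auto
qed

lemma integrable_chord2_powr:
  "r \<in> {-1<..<1} \<union> {1<..} \<Longrightarrow> integrable (angle_measure n) (\<lambda>\<theta>. chord2 r \<theta> powr p)"
  by (rule integrable_angle_measure) (auto intro!: continuous_intros)

lemma Psi_pos:
  assumes "r \<in> {-1<..<1} \<union> {1<..}"
  shows "Psi n \<gamma> r > 0"
proof -
  interpret prob_space "angle_measure n" by (rule prob_space_angle_measure)
  have "Psi n \<gamma> r \<noteq> 0"
  proof
    assume "Psi n \<gamma> r = 0"
    then have "AE \<theta> in angle_measure n. chord2 r \<theta> powr (\<gamma> / 2) = 0"
      unfolding Psi_def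
      by (subst (asm) integral_nonneg_eq_0_iff_AE[OF integrable_chord2_powr[OF assms]]) auto
    then have "AE \<theta> in angle_measure n. False"
      by eventually_elim (use chord2_pos[OF assms] in \<open>simp add: less_imp_neq[THEN not_sym]\<close>)
    then show False by simp
  qed
  moreover have "Psi n \<gamma> r \<ge> 0" unfolding Psi_def by (intro integral_nonneg_AE) auto
  ultimately show ?thesis by simp
qed

text \<open>The derivative may be taken under the integral; the hypotheses are those of the integral over the
compact interval \<open>[0, \<pi>]\<close> against a continuous weight.\<close>

lemma angle_leibniz:
  fixes g g' :: "real \<Rightarrow> real \<Rightarrow> real"
  assumes U: "open U" "convex U" "r \<in> U"
    and deriv: "\<And>r \<theta>. r \<in> U \<Longrightarrow> ((\<lambda>r. g r \<theta>) has_real_derivative g' r \<theta>) (at r)"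
    and cont': "continuous_on (U \<times> {0..pi}) (\<lambda>(r, \<theta>). g' r \<theta>)"
    and cont: "\<And>r. r \<in> U \<Longrightarrow> continuous_on {0..pi} (g r)"
    and [measurable]: "\<And>r. g r \<in> borel_measurable borel" "\<And>r. g' r \<in> borel_measurable borel"
  shows "((\<lambda>r. \<integral>\<theta>. g r \<theta> \<partial>angle_measure n) has_real_derivative (\<integral>\<theta>. g' r \<theta> \<partial>angle_measure n)) (at r)"
proof -
  define s where "s \<theta> = sin \<theta> ^ (n - 2) / angle_const n" for \<theta>
  have s: "continuous_on S s" for S unfolding s_def using angle_const_pos[of n] by (intro continuous_intros) auto
  have c': "continuous_on {0..pi} (g' r)" if "r \<in> U" for r
  proof -
    have "continuous_on {0..pi} (\<lambda>\<theta>. (\<lambda>(r, \<theta>). g' r \<theta>) (r, \<theta>))"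
    proof (rule continuous_on_compose2[OF cont', where f="\<lambda>\<theta>. (r, \<theta>)"])
      show "continuous_on {0..pi} (\<lambda>\<theta>. (r, \<theta>))" by (intro continuous_on_Pair continuous_on_const continuous_on_id)
      show "(\<lambda>\<theta>. (r, \<theta>)) ` {0..pi} \<subseteq> U \<times> {0..pi}" by (rule image_subsetI) (simp add: that)
    qed
    then show ?thesis by (simp only: prod.case)
  qed
  have "((\<lambda>r. integral (cbox 0 pi) (\<lambda>\<theta>. g r \<theta> * s \<theta>)) has_real_derivative
      integral (cbox 0 pi) (\<lambda>\<theta>. g' r \<theta> * s \<theta>)) (at r within U)"
  proof (rule leibniz_rule_field_derivative)
    show "((\<lambda>r. g r \<theta> * s \<theta>) has_real_derivative g' r \<theta> * s \<theta>) (at r within U)" if "r \<in> U" for r \<theta>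
      by (rule has_field_derivative_at_within) (intro DERIV_cmult_right deriv that)
    show "(\<lambda>\<theta>. g r \<theta> * s \<theta>) integrable_on cbox 0 pi" if "r \<in> U" for r
      using that by (intro integrable_continuous) (auto intro!: continuous_intros cont s)
    have "continuous_on (U \<times> {0..pi}) (\<lambda>x. (case x of (r, \<theta>) \<Rightarrow> g' r \<theta>) * s (snd x))"
      by (intro continuous_intros cont' continuous_on_compose2[OF s[of UNIV]]) auto
    then show "continuous_on (U \<times> cbox 0 pi) (\<lambda>(r, \<theta>). g' r \<theta> * s \<theta>)"
      by (simp add: case_prod_beta)
  qed (fact U)+
  then have D: "((\<lambda>r. integral (cbox 0 pi) (\<lambda>\<theta>. g r \<theta> * s \<theta>)) has_real_derivative
      integral (cbox 0 pi) (\<lambda>\<theta>. g' r \<theta> * s \<theta>)) (at r)"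
    by (simp only: at_within_open[OF U(3,1)])
  have eq: "(\<integral>\<theta>. h \<theta> \<partial>angle_measure n) = integral (cbox 0 pi) (\<lambda>\<theta>. h \<theta> * s \<theta>)"
    if "h \<in> borel_measurable borel" "continuous_on {0..pi} h" for h
    using that by (subst integral_angle_measure) (auto simp: s_def)
  have "((\<lambda>r. \<integral>\<theta>. g r \<theta> \<partial>angle_measure n) has_real_derivative
      integral (cbox 0 pi) (\<lambda>\<theta>. g' r \<theta> * s \<theta>)) (at r)"
    by (rule has_field_derivative_transform_within_open[OF D U(1,3)])
       (auto simp: cont eq)
  then show ?thesis using c'[OF U(3)] by (simp add: eq)
qed

lemma regular_interval:
  assumes "r \<in> {-1<..<1} \<union> {1<..}"
  obtains U :: "real set" where "open U" "convex U" "r \<in> U" "U \<subseteq> {-1<..<1} \<union> {1<..}"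
  using assms that[of "{-1<..<1}"] that[of "{1<..}"] by auto

lemma has_real_derivative_chord2_powr:
  assumes "r \<in> {-1<..<1} \<union> {1<..}"
  shows "((\<lambda>r. chord2 r \<theta> powr p) has_real_derivative 2 * p * ((r - cos \<theta>) * chord2 r \<theta> powr (p - 1))) (at r)"
proof -
  have "((\<lambda>r. chord2 r \<theta>) has_real_derivative 2 * (r - cos \<theta>)) (at r)"
    unfolding chord2_def by (auto intro!: derivative_eq_intros)
  from has_real_derivative_powr'[OF this DERIV_const[of p]] chord2_pos[OF assms, of \<theta>]
  show ?thesis by (simp add: powr_diff field_simps)
qed

lemma continuous_on_chord2_pair [continuous_intros]:
  assumes "U \<subseteq> {-1<..<1} \<union> {1<..}"
  shows "continuous_on (U \<times> S) (\<lambda>x. chord2 (fst x) (snd x) powr p)"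
proof -
  have "chord2 (fst x) (snd x) \<noteq> 0" if "x \<in> U \<times> S" for x
    using chord2_pos[of "fst x" "snd x"] that assms by auto
  then show ?thesis
    unfolding chord2_def by (intro continuous_intros) auto
qed

lemma Psi_has_derivative:
  assumes r: "r \<in> {-1<..<1} \<union> {1<..}"
  shows "(Psi n \<gamma> has_real_derivative \<gamma> * Slope n \<gamma> r) (at r)"
proof -
  obtain U where U: "open U" "convex U" "r \<in> U" "U \<subseteq> {-1<..<1} \<union> {1<..}"
    using regular_interval[OF r] .
  have "((\<lambda>r. \<integral>\<theta>. chord2 r \<theta> powr (\<gamma> / 2) \<partial>angle_measure n) has_real_derivative
     (\<integral>\<theta>. 2 * (\<gamma> / 2) * ((r - cos \<theta>) * chord2 r \<theta> powr (\<gamma> / 2 - 1)) \<partial>angle_measure n)) (at r)"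
  proof (rule angle_leibniz[OF U(1-3)])
    show "((\<lambda>r. chord2 r \<theta> powr (\<gamma> / 2)) has_real_derivative
        2 * (\<gamma> / 2) * ((r - cos \<theta>) * chord2 r \<theta> powr (\<gamma> / 2 - 1))) (at r)" if "r \<in> U" for r \<theta>
      by (rule has_real_derivative_chord2_powr) (use that U(4) in blast)
    show "continuous_on (U \<times> {0..pi}) (\<lambda>(r, \<theta>). 2 * (\<gamma> / 2) * ((r - cos \<theta>) * chord2 r \<theta> powr (\<gamma> / 2 - 1)))"
      unfolding case_prod_beta by (intro continuous_intros U(4))
    show "continuous_on {0..pi} (\<lambda>\<theta>. chord2 r \<theta> powr (\<gamma> / 2))" if "r \<in> U" for r
      by (rule continuous_on_chord2_powr) (use that U(4) in blast)
  qed measurable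
  then show ?thesis unfolding Psi_def Slope_def by simp
qed

lemma sqrt_powr: "x \<ge> 0 \<Longrightarrow> sqrt x powr \<gamma> = x powr (\<gamma> / 2)"
  by (simp add: powr_half_sqrt[symmetric] powr_powr)

lemma Pot_eq_Psi: "\<gamma> \<noteq> 0 \<Longrightarrow> Pot n \<gamma> r = Psi n \<gamma> r / \<gamma>"
  by (simp add: Pot_def Psi_def power_potential_def sqrt_powr[OF chord2_nonneg])

lemma continuous_on_chord2: "continuous_on S (chord2 r)"
  unfolding chord2_def by (intro continuous_intros)

lemma has_real_derivative_chord2: "((\<lambda>r. chord2 r \<theta>) has_real_derivative 2 * (r - cos \<theta>)) (at r)"
  unfolding chord2_def by (auto intro!: derivative_eq_intros)

lemma Pot_has_derivative:
  assumes r: "r \<in> {-1<..<1} \<union> {1<..}"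
  shows "(Pot n \<gamma> has_real_derivative Slope n \<gamma> r) (at r)"
proof (cases "\<gamma> = 0")
  case False
  have "Pot n \<gamma> = (\<lambda>r. Psi n \<gamma> r / \<gamma>)"
    using Pot_eq_Psi[OF False] by blast
  then show ?thesis
    using DERIV_cdivide[OF Psi_has_derivative[OF r, of n \<gamma>], of \<gamma>] False by simp
next
  case True
  obtain U where U: "open U" "convex U" "r \<in> U" "U \<subseteq> {-1<..<1} \<union> {1<..}"
    using regular_interval[OF r] .
  have nz: "chord2 r \<theta> > 0" if "r \<in> U" for r \<theta> by (rule chord2_pos) (use U(4) that in blast)
  have "((\<lambda>r. \<integral>\<theta>. ln (sqrt (chord2 r \<theta>)) \<partial>angle_measure n) has_real_derivative
     (\<integral>\<theta>. (r - cos \<theta>) * chord2 r \<theta> powr (0 / 2 - 1) \<partial>angle_measure n)) (at r)"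
  proof (rule angle_leibniz[OF U(1-3)])
    show "((\<lambda>r. ln (sqrt (chord2 r \<theta>))) has_real_derivative (r - cos \<theta>) * chord2 r \<theta> powr (0 / 2 - 1)) (at r)"
      if "r \<in> U" for r \<theta>
    proof -
      from DERIV_chain2[OF DERIV_ln_divide[OF nz[OF that, of \<theta>]] has_real_derivative_chord2]
      have "((\<lambda>r. ln (chord2 r \<theta>) / 2) has_real_derivative 1 / chord2 r \<theta> * (2 * (r - cos \<theta>)) / 2) (at r)"
        by (rule DERIV_cdivide)
      moreover have "1 / chord2 r \<theta> * (2 * (r - cos \<theta>)) / 2 = (r - cos \<theta>) * chord2 r \<theta> powr (0 / 2 - 1)"
        using nz[OF that, of \<theta>] by (simp add: powr_minus field_simps)
      ultimately have D: "((\<lambda>r. ln (chord2 r \<theta>) / 2) has_real_derivative (r - cos \<theta>) * chord2 r \<theta> powr (0 / 2 - 1)) (at r)"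
        by (rule DERIV_cong)
      show ?thesis
        by (rule has_field_derivative_transform_within_open[OF D U(1) that]) (simp add: ln_sqrt[OF chord2_nonneg])
    qed
    show "continuous_on {0..pi} (\<lambda>\<theta>. ln (sqrt (chord2 r \<theta>)))" if "r \<in> U" for r
    proof (intro continuous_on_ln continuous_on_real_sqrt continuous_on_chord2 ballI)
      show "sqrt (chord2 r \<theta>) \<noteq> 0" for \<theta> using nz[OF that, of \<theta>] by simp
    qed
    show "continuous_on (U \<times> {0..pi}) (\<lambda>(r, \<theta>). (r - cos \<theta>) * chord2 r \<theta> powr (0 / 2 - 1))"
      unfolding case_prod_beta by (intro continuous_intros U(4))
  qed measurable
  then show ?thesis unfolding True Pot_def Slope_def power_potential_def by simp
qed

lemmas continuous_on_angle =
  continuous_on_add continuous_on_mult continuous_on_diff continuous_on_const continuous_on_power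
  continuous_on_cos[OF continuous_on_id] continuous_on_sin[OF continuous_on_id] continuous_on_chord2_powr

lemma integrable_angle:
  assumes "r \<in> {-1<..<1} \<union> {1<..}"
  shows "integrable (angle_measure n) (\<lambda>\<theta>. cos \<theta> * chord2 r \<theta> powr p)"
    and "integrable (angle_measure n) (\<lambda>\<theta>. (sin \<theta>)\<^sup>2 * chord2 r \<theta> powr p)"
proof -
  have 1: "continuous_on {0..pi} (\<lambda>\<theta>. cos \<theta> * chord2 r \<theta> powr p)"
    by (intro continuous_on_angle assms)
  show "integrable (angle_measure n) (\<lambda>\<theta>. cos \<theta> * chord2 r \<theta> powr p)"
    by (rule integrable_angle_measure[OF _ 1]) measurable
  have 2: "continuous_on {0..pi} (\<lambda>\<theta>. (sin \<theta>)\<^sup>2 * chord2 r \<theta> powr p)"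
    by (intro continuous_on_angle assms)
  show "integrable (angle_measure n) (\<lambda>\<theta>. (sin \<theta>)\<^sup>2 * chord2 r \<theta> powr p)"
    by (rule integrable_angle_measure[OF _ 2]) measurable
qed

text \<open>The integral over \<open>[0, \<pi>]\<close> of the derivative of \<open>sin \<theta> ^ (n - 1) * chord2 r \<theta> powr p\<close>.\<close>

lemma sphere_laplacian_by_parts:
  assumes r: "r \<in> {-1<..<1} \<union> {1<..}" and n: "n \<ge> 2"
  shows "(real n - 1) * (\<integral>\<theta>. cos \<theta> * chord2 r \<theta> powr p \<partial>angle_measure n) +
    2 * p * r * (\<integral>\<theta>. (sin \<theta>)\<^sup>2 * chord2 r \<theta> powr (p - 1) \<partial>angle_measure n) = 0"
proof -
  obtain m where m: "n = m + 2" by (rule that[of "n - 2"]) (use n in simp)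
  have i: "integral {0..pi} (\<lambda>\<theta>. g \<theta> * sin \<theta> ^ m) = angle_const n * (\<integral>\<theta>. g \<theta> \<partial>angle_measure n)"
    if "g \<in> borel_measurable borel" "continuous_on {0..pi} g" for g
    using integral_angle_measure[OF that, of n] angle_const_pos[of n] m by (simp add: field_simps)
  have hi: "((\<lambda>\<theta>. g \<theta> * sin \<theta> ^ m) has_integral angle_const n * (\<integral>\<theta>. g \<theta> \<partial>angle_measure n)) {0..pi}"
    if "g \<in> borel_measurable borel" "continuous_on {0..pi} g" for g
    unfolding i[OF that, symmetric]
    by (intro integrable_integral integrable_continuous_interval continuous_intros that)
  let ?g = "\<lambda>\<theta>. (real n - 1) * (cos \<theta> * chord2 r \<theta> powr p) + 2 * p * r * ((sin \<theta>)\<^sup>2 * chord2 r \<theta> powr (p - 1))"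
  have "((\<lambda>\<theta>. ?g \<theta> * sin \<theta> ^ m) has_integral angle_const n * (\<integral>\<theta>. ?g \<theta> \<partial>angle_measure n)) {0..pi}"
    by (rule hi, measurable) (intro continuous_on_angle r)
  moreover have "((\<lambda>\<theta>. ?g \<theta> * sin \<theta> ^ m) has_integral
      sin pi ^ (m+1) * chord2 r pi powr p - sin 0 ^ (m+1) * chord2 r 0 powr p) {0..pi}"
  proof (rule fundamental_theorem_of_calculus)
    fix \<theta> :: real
    have c: "((\<lambda>\<theta>. chord2 r \<theta>) has_real_derivative 2 * r * sin \<theta>) (at \<theta>)"
      unfolding chord2_def by (auto intro!: derivative_eq_intros)
    have "((\<lambda>\<theta>. chord2 r \<theta> powr p) has_real_derivative p * chord2 r \<theta> powr (p - 1) * (2 * r * sin \<theta>)) (at \<theta>)"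
      using has_real_derivative_powr'[OF c DERIV_const[of p]] chord2_pos[OF r, of \<theta>]
      by (simp add: powr_diff field_simps)
    from DERIV_mult[OF DERIV_power_plus1[OF DERIV_sin[of \<theta>], where m=m] this]
    have "((\<lambda>\<theta>. sin \<theta> ^ (m + 1) * chord2 r \<theta> powr p) has_real_derivative ?g \<theta> * sin \<theta> ^ m) (at \<theta>)"
      by (rule DERIV_cong) (simp add: m algebra_simps power2_eq_square)
    then show "((\<lambda>\<theta>. sin \<theta> ^ (m + 1) * chord2 r \<theta> powr p) has_vector_derivative ?g \<theta> * sin \<theta> ^ m) (at \<theta> within {0..pi})"
      by (simp add: has_real_derivative_iff_has_vector_derivative has_vector_derivative_at_within)
  qed simp
  ultimately have "angle_const n * (\<integral>\<theta>. ?g \<theta> \<partial>angle_measure n) =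
      sin pi ^ (m+1) * chord2 r pi powr p - sin 0 ^ (m+1) * chord2 r 0 powr p"
    by (rule has_integral_unique)
  then have "(\<integral>\<theta>. ?g \<theta> \<partial>angle_measure n) = 0" using angle_const_pos[of n] by simp
  moreover have "integrable (angle_measure n) (\<lambda>\<theta>. cos \<theta> * chord2 r \<theta> powr p)"
     "integrable (angle_measure n) (\<lambda>\<theta>. (sin \<theta>)\<^sup>2 * chord2 r \<theta> powr (p - 1))"
    by (rule integrable_chord2_powr[OF r] integrable_angle[OF r])+
  ultimately show ?thesis by simp
qed

text \<open>The radial form of \<open>\<Delta>(\<bar>z\<bar> powr \<gamma> / \<gamma>) = (\<gamma> + n - 2) \<bar>z\<bar> powr (\<gamma> - 2)\<close>, averaged over the sphere. The
tangential part of the Laplacian is what \<open>sphere_laplacian_by_parts\<close> removes.\<close>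

lemma Slope_has_derivative:
  assumes r: "r \<in> {-1<..<1} \<union> {1<..}" and n: "n \<ge> 2"
  shows "((\<lambda>r. r ^ (n - 1) * Slope n \<gamma> r) has_real_derivative
     r ^ (n - 1) * ((\<gamma> + real n - 2) * Psi n (\<gamma> - 2) r)) (at r)"
proof -
  define p where "p = \<gamma> / 2 - 1"
  obtain m where m: "n = m + 2" by (rule that[of "n - 2"]) (use n in simp)
  obtain U where U: "open U" "convex U" "r \<in> U" "U \<subseteq> {-1<..<1} \<union> {1<..}"
    using regular_interval[OF r] .
  define I1 where "I1 = (\<integral>\<theta>. chord2 r \<theta> powr p \<partial>angle_measure n)"
  define Is where "Is = (\<integral>\<theta>. cos \<theta> * chord2 r \<theta> powr p \<partial>angle_measure n)"
  define Iq where "Iq = (\<integral>\<theta>. (sin \<theta>)\<^sup>2 * chord2 r \<theta> powr (p - 1) \<partial>angle_measure n)"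
  have i: "integrable (angle_measure n) (\<lambda>\<theta>. chord2 r \<theta> powr p)"
     "integrable (angle_measure n) (\<lambda>\<theta>. cos \<theta> * chord2 r \<theta> powr p)"
     "integrable (angle_measure n) (\<lambda>\<theta>. (sin \<theta>)\<^sup>2 * chord2 r \<theta> powr (p - 1))"
    by (rule integrable_chord2_powr[OF r] integrable_angle[OF r])+
  have D: "((\<lambda>r. \<integral>\<theta>. (r - cos \<theta>) * chord2 r \<theta> powr p \<partial>angle_measure n) has_real_derivative
     (\<integral>\<theta>. chord2 r \<theta> powr p + 2 * p * ((r - cos \<theta>)\<^sup>2 * chord2 r \<theta> powr (p - 1)) \<partial>angle_measure n)) (at r)"
  proof (rule angle_leibniz[OF U(1-3)])
    show "((\<lambda>r. (r - cos \<theta>) * chord2 r \<theta> powr p) has_real_derivative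
        chord2 r \<theta> powr p + 2 * p * ((r - cos \<theta>)\<^sup>2 * chord2 r \<theta> powr (p - 1))) (at r)" if "r \<in> U" for r \<theta>
    proof -
      have "((\<lambda>r. r - cos \<theta>) has_real_derivative 1) (at r)" by (auto intro!: derivative_eq_intros)
      from DERIV_mult[OF this has_real_derivative_chord2_powr[of r \<theta> p]] that U(4)
      have "((\<lambda>r. (r - cos \<theta>) * chord2 r \<theta> powr p) has_real_derivative
        1 * chord2 r \<theta> powr p + 2 * p * ((r - cos \<theta>) * chord2 r \<theta> powr (p - 1)) * (r - cos \<theta>)) (at r)"
        by blast
      then show ?thesis by (rule DERIV_cong) (simp add: power2_eq_square)
    qed
    show "continuous_on (U \<times> {0..pi}) (\<lambda>(r, \<theta>). chord2 r \<theta> powr p + 2 * p * ((r - cos \<theta>)\<^sup>2 * chord2 r \<theta> powr (p - 1)))"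
      unfolding case_prod_beta by (intro continuous_intros U(4))
    show "continuous_on {0..pi} (\<lambda>\<theta>. (r - cos \<theta>) * chord2 r \<theta> powr p)" if "r \<in> U" for r
      by (intro continuous_on_angle) (use that U(4) in blast)
  qed measurable
  have "(\<integral>\<theta>. chord2 r \<theta> powr p + 2 * p * ((r - cos \<theta>)\<^sup>2 * chord2 r \<theta> powr (p - 1)) \<partial>angle_measure n)
     = (\<integral>\<theta>. (1 + 2 * p) * chord2 r \<theta> powr p - 2 * p * ((sin \<theta>)\<^sup>2 * chord2 r \<theta> powr (p - 1)) \<partial>angle_measure n)"
  proof (rule Bochner_Integration.integral_cong)
    fix \<theta> :: real
    have e1: "(r - cos \<theta>)\<^sup>2 = chord2 r \<theta> - (sin \<theta>)\<^sup>2"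
      unfolding chord2_def by (simp add: sin_squared_eq power2_eq_square algebra_simps)
    have e2: "chord2 r \<theta> powr p = chord2 r \<theta> * chord2 r \<theta> powr (p - 1)"
      using chord2_pos[OF r, of \<theta>] by (simp add: powr_diff)
    show "chord2 r \<theta> powr p + 2 * p * ((r - cos \<theta>)\<^sup>2 * chord2 r \<theta> powr (p - 1)) =
      (1 + 2 * p) * chord2 r \<theta> powr p - 2 * p * ((sin \<theta>)\<^sup>2 * chord2 r \<theta> powr (p - 1))"
    proof -
      have "A + 2 * p * ((c - s) * q) = (1 + 2 * p) * A - 2 * p * (s * q)" if "A = c * q" for A c s q :: real
        unfolding that by (simp add: algebra_simps)
      from this[OF e2] show ?thesis by (simp only: e1)
    qed
  qed simp
  also have "\<dots> = (1 + 2 * p) * I1 - 2 * p * Iq"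
    using i by (simp add: I1_def Iq_def)
  finally have D': "(Slope n \<gamma> has_real_derivative (1 + 2 * p) * I1 - 2 * p * Iq) (at r)"
    using D unfolding Slope_def p_def by simp
  have S: "Slope n \<gamma> r = r * I1 - Is"
    using i unfolding Slope_def p_def[symmetric] I1_def Is_def by (simp add: left_diff_distrib)
  have parts: "(real n - 1) * Is + 2 * p * r * Iq = 0"
    using sphere_laplacian_by_parts[OF r n, of p] unfolding Is_def Iq_def .
  have P: "Psi n (\<gamma> - 2) r = I1" by (simp add: Psi_def I1_def p_def diff_divide_distrib)
  have "((\<lambda>r. r ^ (m + 1) * Slope n \<gamma> r) has_real_derivative
      (real m + 1) * r ^ m * 1 * Slope n \<gamma> r + ((1 + 2 * p) * I1 - 2 * p * Iq) * r ^ (m + 1)) (at r)"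
    by (rule DERIV_mult[OF DERIV_power_plus1[OF DERIV_ident] D'])
  moreover have "(real m + 1) * r ^ m * 1 * Slope n \<gamma> r + ((1 + 2 * p) * I1 - 2 * p * Iq) * r ^ (m + 1) =
      r ^ (m + 1) * ((\<gamma> + real n - 2) * Psi n (\<gamma> - 2) r)"
  proof -
    have "(real m + 1) * r ^ m * 1 * (r * I1 - Is) + ((1 + 2 * p) * I1 - 2 * p * Iq) * r ^ (m + 1) =
        r ^ (m + 1) * ((2 * p + real m + 2) * I1) - r ^ m * ((real n - 1) * Is + 2 * p * r * Iq)"
      by (simp add: m algebra_simps)
    moreover have "2 * p + real m + 2 = \<gamma> + real n - 2" by (simp add: m p_def)
    ultimately show ?thesis by (simp only: S P parts mult_zero_right diff_zero)
  qed
  ultimately show ?thesis by (simp add: m)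
qed

section \<open>Values and continuity at the unit sphere\<close>

text \<open>The average of \<open>\<bar>e - y\<bar> powr \<gamma>\<close> over the unit sphere for a unit vector \<open>e\<close> (see \<open>Psi_1\<close>), written with
the gamma function.\<close>

definition sphere_moment :: "nat \<Rightarrow> real \<Rightarrow> real" where
  "sphere_moment n \<gamma> = 2 powr \<gamma> * Gamma ((\<gamma> + real n - 1) / 2) * Gamma (real n - 1) /
     (Gamma ((real n - 1) / 2) * Gamma ((\<gamma> + 2 * real n - 2) / 2))"

text \<open>With \<open>t = (1 - cos \<theta>) / 2\<close> one has \<open>chord2 1 \<theta> = 4 t\<close> and \<open>(sin \<theta>)\<^sup>2 = 4 t (1 - t)\<close>, so the
integral becomes the Beta integral.\<close>

lemma nn_integral_chord_Beta:
  assumes n: "n \<ge> 2" and \<gamma>: "\<gamma> > 1 - real n"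
  shows "(\<integral>\<^sup>+\<theta>. ennreal (sin \<theta> ^ (n - 2) * chord2 1 \<theta> powr (\<gamma> / 2)) * indicator {0..pi} \<theta> \<partial>lborel) =
    ennreal (2 powr (\<gamma> + real n - 2) * Beta ((\<gamma> + real n - 1) / 2) ((real n - 1) / 2))"
proof -
  define a where "a = (\<gamma> + real n - 1) / 2"
  define b where "b = (real n - 1) / 2"
  have ab: "a > 0" "b > 0" using n \<gamma> by (auto simp: a_def b_def)
  define f where "f t = ennreal (2 * (4 * t) powr (\<gamma> / 2) * (4 * t * (1 - t)) powr ((real n - 3) / 2))" for t
  define g where "g \<theta> = (1 - cos \<theta>) / 2" for \<theta> :: real
  have [measurable]: "f \<in> borel_measurable borel" unfolding f_def by measurable
  have "(\<integral>\<^sup>+t. f t * indicator {g 0..g pi} t \<partial>lborel) =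
      (\<integral>\<^sup>+\<theta>. f (g \<theta>) * ennreal (sin \<theta> / 2) * indicator {0..pi} \<theta> \<partial>lborel)"
  proof (rule nn_integral_substitution_aux)
    show "(g has_real_derivative sin \<theta> / 2) (at \<theta>)" for \<theta>
      unfolding g_def by (auto intro!: derivative_eq_intros)
    show "continuous_on {0..pi} (\<lambda>\<theta>. sin \<theta> / 2)" by (intro continuous_intros) auto
    show "0 \<le> sin \<theta> / 2" if "\<theta> \<in> {0..pi}" for \<theta> using that sin_ge_zero[of \<theta>] by simp
  qed auto
  also have "\<dots> = (\<integral>\<^sup>+\<theta>. ennreal (sin \<theta> ^ (n - 2) * chord2 1 \<theta> powr (\<gamma> / 2)) * indicator {0..pi} \<theta> \<partial>lborel)"
  proof (rule nn_integral_cong_AE)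
    have "AE \<theta> in lborel. (\<theta>::real) \<noteq> 0" "AE \<theta> in lborel. (\<theta>::real) \<noteq> pi"
      by (rule AE_lborel_singleton)+
    then show "AE \<theta> in lborel. f (g \<theta>) * ennreal (sin \<theta> / 2) * indicator {0..pi} \<theta> =
       ennreal (sin \<theta> ^ (n - 2) * chord2 1 \<theta> powr (\<gamma> / 2)) * indicator {0..pi} \<theta>"
    proof eventually_elim
      case (elim \<theta>)
      show ?case
      proof (cases "\<theta> \<in> {0..pi}")
        case True
        then have s: "sin \<theta> > 0" using elim by (intro sin_gt_zero) auto
        have 1: "4 * g \<theta> = chord2 1 \<theta>" by (simp add: g_def chord2_1)
        have 2: "4 * g \<theta> * (1 - g \<theta>) = (sin \<theta>)\<^sup>2"
        proof -
          have "4 * g \<theta> * (1 - g \<theta>) = 1 - (cos \<theta>)\<^sup>2" by (simp add: g_def power2_eq_square field_simps)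
          then show ?thesis by (simp add: sin_squared_eq)
        qed
        have 3: "((sin \<theta>)\<^sup>2) powr ((real n - 3) / 2) = sin \<theta> powr (real n - 3)"
        proof -
          have "(sin \<theta>)\<^sup>2 = sin \<theta> powr 2" "2 * ((real n - 3) / 2) = real n - 3" using s by simp_all
          then show ?thesis by (simp only: powr_powr)
        qed
        have 4: "sin \<theta> powr (real n - 3) * sin \<theta> = sin \<theta> ^ (n - 2)"
        proof -
          have "sin \<theta> powr (real n - 3) * sin \<theta> = sin \<theta> powr (real n - 3) * sin \<theta> powr 1" using s by simp
          also have "\<dots> = sin \<theta> powr (real (n - 2))"
            unfolding powr_add[symmetric] using n by (simp add: of_nat_diff)
          finally show ?thesis using s by (simp add: powr_realpow)
        qed
        have "2 * (4 * g \<theta>) powr (\<gamma> / 2) * (4 * g \<theta> * (1 - g \<theta>)) powr ((real n - 3) / 2) * (sin \<theta> / 2) =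
            (sin \<theta> powr (real n - 3) * sin \<theta>) * chord2 1 \<theta> powr (\<gamma> / 2)"
          unfolding 1 2[unfolded 1] 3 by simp
        then have "f (g \<theta>) * ennreal (sin \<theta> / 2) = ennreal (sin \<theta> ^ (n - 2) * chord2 1 \<theta> powr (\<gamma> / 2))"
          unfolding f_def 4 using s by (subst ennreal_mult[symmetric]) auto
        then show ?thesis by simp
      qed simp
    qed
  qed
  finally have 1: "(\<integral>\<^sup>+t. f t * indicator {0..1} t \<partial>lborel) =
      (\<integral>\<^sup>+\<theta>. ennreal (sin \<theta> ^ (n - 2) * chord2 1 \<theta> powr (\<gamma> / 2)) * indicator {0..pi} \<theta> \<partial>lborel)"
    by (simp add: g_def)
  have "((\<lambda>t. 2 powr (\<gamma> + real n - 2) * (t powr (a - 1) * (1 - t) powr (b - 1))) has_integral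
     2 powr (\<gamma> + real n - 2) * Beta a b) {0..1}"
    by (rule has_integral_mult_right[OF has_integral_Beta_real[OF ab]])
  then have "(\<integral>\<^sup>+t. ennreal (indicator {0..1} t * (2 powr (\<gamma> + real n - 2) * (t powr (a - 1) * (1 - t) powr (b - 1)))) \<partial>lborel) =
     ennreal (2 powr (\<gamma> + real n - 2) * Beta a b)"
    by (intro nn_integral_has_integral_lebesgue) auto
  also have "(\<integral>\<^sup>+t. ennreal (indicator {0..1} t * (2 powr (\<gamma> + real n - 2) * (t powr (a - 1) * (1 - t) powr (b - 1)))) \<partial>lborel) =
     (\<integral>\<^sup>+t. f t * indicator {0..1} t \<partial>lborel)"
  proof (rule nn_integral_cong)
    fix t :: real
    show "ennreal (indicator {0..1} t * (2 powr (\<gamma> + real n - 2) * (t powr (a - 1) * (1 - t) powr (b - 1)))) =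
        f t * indicator {0..1} t"
    proof (cases "t \<in> {0..1}")
      case True
      have four: "(4::real) powr p = 2 powr (2 * p)" for p
      proof -
        have "(4::real) = 2 powr 2" by simp
        then show ?thesis by (simp only: powr_powr)
      qed
      have "2 * (4 * t) powr (\<gamma> / 2) * (4 * t * (1 - t)) powr ((real n - 3) / 2) =
         (2 powr 1 * 4 powr (\<gamma> / 2) * 4 powr ((real n - 3) / 2)) *
          ((t powr (\<gamma> / 2) * t powr ((real n - 3) / 2)) * (1 - t) powr ((real n - 3) / 2))"
        using True by (simp add: powr_mult)
      also have "t powr (\<gamma> / 2) * t powr ((real n - 3) / 2) = t powr (a - 1)"
        unfolding powr_add[symmetric] a_def by (simp add: field_simps)
      also have "2 powr 1 * 4 powr (\<gamma> / 2) * 4 powr ((real n - 3) / 2) = 2 powr (\<gamma> + real n - 2)"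
      proof -
        have "1 + 2 * (\<gamma> / 2) + 2 * ((real n - 3) / 2) = \<gamma> + real n - 2" by (simp add: field_simps)
        then show ?thesis unfolding four powr_add[symmetric] by (simp only:)
      qed
      finally show ?thesis using True by (simp add: f_def b_def diff_divide_distrib)
    qed simp
  qed
  finally show ?thesis unfolding 1 a_def b_def .
qed

lemma angle_const_Beta:
  assumes n: "n \<ge> 2"
  shows "angle_const n = 2 powr (real n - 2) * Beta ((real n - 1) / 2) ((real n - 1) / 2)"
proof -
  have B: "Beta ((real n - 1) / 2) ((real n - 1) / 2) > 0"
    using n unfolding Beta_def by (intro divide_pos_pos mult_pos_pos Gamma_real_pos) auto
  have "((\<lambda>\<theta>. sin \<theta> ^ (n - 2)) has_integral angle_const n) {0..pi}"
    unfolding angle_const_def by (intro integrable_integral integrable_continuous_interval continuous_intros)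
  then have "(\<integral>\<^sup>+\<theta>. ennreal (indicator {0..pi} \<theta> * sin \<theta> ^ (n - 2)) \<partial>lborel) = ennreal (angle_const n)"
    by (intro nn_integral_has_integral_lebesgue) (auto intro!: zero_le_power sin_ge_zero)
  also have "(\<integral>\<^sup>+\<theta>. ennreal (indicator {0..pi} \<theta> * sin \<theta> ^ (n - 2)) \<partial>lborel) =
      (\<integral>\<^sup>+\<theta>. ennreal (sin \<theta> ^ (n - 2) * chord2 1 \<theta> powr (0 / 2)) * indicator {0..pi} \<theta> \<partial>lborel)"
  proof (rule nn_integral_cong_AE)
    have "AE \<theta> in lborel. (\<theta>::real) \<noteq> 0" "AE \<theta> in lborel. (\<theta>::real) \<noteq> pi"
      by (rule AE_lborel_singleton)+
    then show "AE \<theta> in lborel. ennreal (indicator {0..pi} \<theta> * sin \<theta> ^ (n - 2)) =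
       ennreal (sin \<theta> ^ (n - 2) * chord2 1 \<theta> powr (0 / 2)) * indicator {0..pi} \<theta>"
    proof eventually_elim
      case (elim \<theta>)
      then show ?case using chord2_1_pos[of \<theta>] by (cases "\<theta> \<in> {0..pi}") auto
    qed
  qed
  also have "\<dots> = ennreal (2 powr (real n - 2) * Beta ((real n - 1) / 2) ((real n - 1) / 2))"
    using nn_integral_chord_Beta[OF n, of 0] n by simp
  finally show ?thesis
    using B angle_const_pos[of n] by (subst (asm) ennreal_inj) (auto intro: less_imp_le)
qed

lemma sphere_moment_pos: "n \<ge> 2 \<Longrightarrow> \<gamma> > 1 - real n \<Longrightarrow> sphere_moment n \<gamma> > 0"
  unfolding sphere_moment_def by (intro divide_pos_pos mult_pos_pos Gamma_real_pos) auto

lemma nn_integral_chord2_1: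
  assumes n: "n \<ge> 2" and \<gamma>: "\<gamma> > 1 - real n"
  shows "(\<integral>\<^sup>+\<theta>. ennreal (chord2 1 \<theta> powr (\<gamma> / 2)) \<partial>angle_measure n) = ennreal (sphere_moment n \<gamma>)"
proof -
  define b where "b = (real n - 1) / 2"
  define a where "a = (\<gamma> + real n - 1) / 2"
  have G: "Gamma b > 0" "Gamma a > 0" "Gamma (2 * b) > 0" "Gamma (a + b) > 0"
  proof -
    have "a > 0" "b > 0" using n \<gamma> by (auto simp: a_def b_def)
    then show "Gamma b > 0" "Gamma a > 0" "Gamma (2 * b) > 0" "Gamma (a + b) > 0" by (auto intro!: Gamma_real_pos)
  qed
  have "(\<integral>\<^sup>+\<theta>. ennreal (chord2 1 \<theta> powr (\<gamma> / 2)) \<partial>angle_measure n) =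
    (\<integral>\<^sup>+\<theta>. ennreal (1 / angle_const n) * (ennreal (sin \<theta> ^ (n - 2) * chord2 1 \<theta> powr (\<gamma> / 2)) * indicator {0..pi} \<theta>) \<partial>lborel)"
  proof (subst nn_integral_angle_measure, measurable, rule nn_integral_cong)
    fix \<theta> :: real
    show "ennreal (indicator {0..pi} \<theta> * sin \<theta> ^ (n - 2) / angle_const n) * ennreal (chord2 1 \<theta> powr (\<gamma> / 2)) =
      ennreal (1 / angle_const n) * (ennreal (sin \<theta> ^ (n - 2) * chord2 1 \<theta> powr (\<gamma> / 2)) * indicator {0..pi} \<theta>)"
    proof (cases "\<theta> \<in> {0..pi}")
      case True
      then have "sin \<theta> ^ (n - 2) \<ge> 0" by (intro zero_le_power sin_ge_zero) auto
      then show ?thesis using True angle_const_pos[of n] by (simp add: ennreal_mult[symmetric])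
    qed simp
  qed
  also have "\<dots> = ennreal (1 / angle_const n) * ennreal (2 powr (\<gamma> + real n - 2) * Beta a b)"
    unfolding a_def b_def nn_integral_chord_Beta[OF n \<gamma>, symmetric] by (rule nn_integral_cmult) measurable
  also have "\<dots> = ennreal (1 / angle_const n * (2 powr (\<gamma> + real n - 2) * Beta a b))"
    using angle_const_pos[of n] G unfolding Beta_def
    by (intro ennreal_mult[symmetric] mult_nonneg_nonneg divide_nonneg_nonneg) auto
  also have "1 / angle_const n * (2 powr (\<gamma> + real n - 2) * Beta a b) = sphere_moment n \<gamma>"
  proof -
    have e: "2 powr (\<gamma> + real n - 2) = 2 powr \<gamma> * 2 powr (real n - 2)"
      by (simp add: powr_add[symmetric] algebra_simps)
    have s: "sphere_moment n \<gamma> = 2 powr \<gamma> * Gamma a * Gamma (2 * b) / (Gamma b * Gamma (a + b))"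
    proof -
      have h: "(\<gamma> + 2 * real n - 2) / 2 = a + b" "Gamma (real n - 1) = Gamma (2 * b)"
        by (simp_all add: a_def b_def add_divide_distrib diff_divide_distrib)
      show ?thesis unfolding sphere_moment_def h a_def[symmetric] b_def[symmetric] ..
    qed
    have z: "angle_const n = 2 powr (real n - 2) * (Gamma b * Gamma b / Gamma (2 * b))"
      unfolding angle_const_Beta[OF n] b_def[symmetric] Beta_def by simp
    have "1 / (p * (gb * gb / g2)) * (q * p * (ga * gb / gab)) = q * ga * g2 / (gb * gab)"
      if "p > 0" "gb > 0" "g2 > 0" "gab > 0" for p q ga gb g2 gab :: real
      using that by (simp add: field_simps)
    from this[of "2 powr (real n - 2)" "Gamma b" "Gamma (2 * b)" "Gamma (a + b)"] G
    show ?thesis unfolding z s e Beta_def by simp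
  qed
  finally show ?thesis .
qed

lemma integrable_chord2_1:
  assumes n: "n \<ge> 2" and \<gamma>: "\<gamma> > 1 - real n"
  shows "integrable (angle_measure n) (\<lambda>\<theta>. chord2 1 \<theta> powr (\<gamma> / 2))"
  using nn_integral_chord2_1[OF assms] by (simp add: integrable_iff_bounded)

lemma Psi_1:
  assumes n: "n \<ge> 2" and \<gamma>: "\<gamma> > 1 - real n"
  shows "Psi n \<gamma> 1 = sphere_moment n \<gamma>"
proof -
  have "ennreal (Psi n \<gamma> 1) = ennreal (sphere_moment n \<gamma>)"
    unfolding Psi_def nn_integral_chord2_1[OF assms, symmetric]
    by (rule nn_integral_eq_integral[symmetric, OF integrable_chord2_1[OF assms]]) simp
  moreover have "Psi n \<gamma> 1 \<ge> 0" unfolding Psi_def by (intro integral_nonneg_AE) auto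
  ultimately show ?thesis using sphere_moment_pos[OF assms] by simp
qed

text \<open>From \<open>\<Gamma>(x + 1) = x \<Gamma>(x)\<close> in the numerator and in the denominator.\<close>

lemma sphere_moment_rec:
  assumes n: "n \<ge> 2" and \<gamma>: "\<gamma> - 2 > 1 - real n"
  shows "(\<gamma> + 2 * real n - 4) * sphere_moment n \<gamma> = 4 * (\<gamma> + real n - 3) * sphere_moment n (\<gamma> - 2)"
proof -
  define a where "a = (\<gamma> + real n - 3) / 2"
  define c where "c = (\<gamma> + 2 * real n - 4) / 2"
  have ac: "a > 0" "c > 0" using n \<gamma> by (auto simp: a_def c_def)
  have G: "Gamma (a + 1) = a * Gamma a" "Gamma (c + 1) = c * Gamma c"
    using ac by (auto intro!: Gamma_plus1 dest: nonpos_Ints_nonpos)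
  have P: "Gamma c > 0" "Gamma ((real n - 1) / 2) > 0" using ac n by (auto intro!: Gamma_real_pos)
  have 1: "(\<gamma> + real n - 1) / 2 = a + 1" "(\<gamma> + 2 * real n - 2) / 2 = c + 1"
    "(\<gamma> - 2 + real n - 1) / 2 = a" "(\<gamma> - 2 + 2 * real n - 2) / 2 = c"
    "\<gamma> + 2 * real n - 4 = 2 * c" "\<gamma> + real n - 3 = 2 * a"
    by (auto simp: a_def c_def field_simps)
  have 2: "(2::real) powr \<gamma> = 4 * 2 powr (\<gamma> - 2)" by (simp add: powr_diff)
  have "2 * c * (4 * q * (a * ga) * g / (h * (c * gc))) = 4 * (2 * a) * (q * ga * g / (h * gc))"
    if "c > 0" "gc > 0" "h > 0" for q ga g h gc :: real using that by (simp add: field_simps)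
  then show ?thesis unfolding sphere_moment_def 1 2 G using ac P by blast
qed

lemma chord2_pos_interior: "0 < \<theta> \<Longrightarrow> \<theta> < pi \<Longrightarrow> chord2 r \<theta> > 0"
proof -
  assume "0 < \<theta>" "\<theta> < pi"
  then have "sin \<theta> > 0" by (rule sin_gt_zero)
  have "chord2 r \<theta> = (r - cos \<theta>)\<^sup>2 + (sin \<theta>)\<^sup>2"
    unfolding chord2_def by (simp add: sin_squared_eq power2_eq_square algebra_simps)
  moreover have "(sin \<theta>)\<^sup>2 > 0" using \<open>sin \<theta> > 0\<close> by simp
  ultimately show ?thesis using zero_le_power2[of "r - cos \<theta>"] by linarith
qed

lemma chord2_le_9: "r \<in> {1/2..2} \<Longrightarrow> chord2 r \<theta> \<le> 9"
proof -
  assume r: "r \<in> {1/2..2}"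
  have "r * (1 - cos \<theta>) \<le> 2 * 2" using r cos_ge_minus_one[of \<theta>] by (intro mult_mono) (auto simp: cos_le_one)
  moreover have "(1 - r)\<^sup>2 \<le> 1" using r by (simp add: power2_le_iff_abs_le abs_le_iff abs_square_le_1)
  ultimately show ?thesis unfolding chord2_alt by linarith
qed

text \<open>At \<open>r = 1\<close> the integrand may be singular at \<open>\<theta> = 0\<close>. For \<open>r\<close> in \<open>[1/2, 2]\<close> the inequality
\<open>chord2 r \<theta> \<ge> chord2 1 \<theta> / 2\<close> gives a dominating function that does not depend on \<open>r\<close> and is
integrable by \<open>integrable_chord2_1\<close>.\<close>

lemma isCont_angle_integral_1:
  fixes F :: "real \<Rightarrow> real"
  assumes n: "n \<ge> 2" and p: "p \<le> 0" "2 * p > 1 - real n"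
    and F: "continuous_on {0<..} F" and [measurable]: "F \<in> borel_measurable borel"
    and bound: "\<And>x. 0 < x \<Longrightarrow> x \<le> 9 \<Longrightarrow> \<bar>F x\<bar> \<le> C * (1 + x powr p)" and C: "C \<ge> 0"
  shows "isCont (\<lambda>r. \<integral>\<theta>. F (chord2 r \<theta>) \<partial>angle_measure n) 1"
proof -
  interpret prob_space "angle_measure n" by (rule prob_space_angle_measure)
  define w where "w \<theta> = C * (1 + (1/2) powr p * chord2 1 \<theta> powr (2 * p / 2))" for \<theta>
  have w: "integrable (angle_measure n) w"
    unfolding w_def using integrable_chord2_1[OF n p(2)] by (intro integrable_mult_right Bochner_Integration.integrable_add) auto
  have bnd: "norm (F (chord2 r \<theta>)) \<le> w \<theta>" if r: "r \<in> {1/2..2}" and \<theta>: "0 < \<theta>" "\<theta> < pi" for r \<theta>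
  proof -
    have "\<bar>F (chord2 r \<theta>)\<bar> \<le> C * (1 + chord2 r \<theta> powr p)"
      by (rule bound[OF chord2_pos_interior[OF \<theta>] chord2_le_9[OF r]])
    also have "chord2 r \<theta> powr p \<le> (1/2 * chord2 1 \<theta>) powr p"
    proof (rule powr_mono2')
      have "1/2 * chord2 1 \<theta> \<le> r * chord2 1 \<theta>"
        using r chord2_1_pos[OF \<theta>] by (intro mult_right_mono) auto
      also have "\<dots> \<le> chord2 r \<theta>" using chord2_ge[of r \<theta>] r unfolding chord2_1 by simp
      finally show "1/2 * chord2 1 \<theta> \<le> chord2 r \<theta>" .
    qed (use p chord2_1_pos[OF \<theta>] in auto)
    also have "(1/2 * chord2 1 \<theta>) powr p = (1/2) powr p * chord2 1 \<theta> powr (2 * p / 2)"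
      using chord2_1_pos[OF \<theta>] by (simp only: powr_mult) simp
    finally show ?thesis using C by (simp add: w_def mult_left_mono)
  qed
  have "continuous_on {1/2..2} (\<lambda>r. \<integral>\<theta>. F (chord2 r \<theta>) \<partial>angle_measure n)"
    unfolding continuous_on_sequentially o_def
  proof (intro allI impI ballI, elim conjE)
    fix u :: "nat \<Rightarrow> real" and a assume a: "a \<in> {1/2..2}" and u: "\<forall>i. u i \<in> {1/2..2}" and lim: "u \<longlonglongrightarrow> a"
    show "(\<lambda>i. \<integral>\<theta>. F (chord2 (u i) \<theta>) \<partial>angle_measure n) \<longlonglongrightarrow> (\<integral>\<theta>. F (chord2 a \<theta>) \<partial>angle_measure n)"
    proof (rule integral_dominated_convergence[where w=w])
      show "AE \<theta> in angle_measure n. (\<lambda>i. F (chord2 (u i) \<theta>)) \<longlonglongrightarrow> F (chord2 a \<theta>)"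
        using AE_angle_measure
      proof eventually_elim
        case (elim \<theta>)
        then have pos: "chord2 r \<theta> > 0" for r by (auto intro: chord2_pos_interior)
        have "isCont F (chord2 a \<theta>)"
          using F pos[of a] by (simp add: continuous_on_eq_continuous_at)
        moreover have "(\<lambda>i. chord2 (u i) \<theta>) \<longlonglongrightarrow> chord2 a \<theta>"
          unfolding chord2_def by (intro tendsto_intros lim)
        ultimately show ?case by (rule isCont_tendsto_compose)
      qed
      show "AE \<theta> in angle_measure n. norm (F (chord2 (u i) \<theta>)) \<le> w \<theta>" for i
        using AE_angle_measure by eventually_elim (rule bnd, use u in auto)
    qed (use w in measurable)
  qed
  then show ?thesis by (rule continuous_on_interior) (simp add: interior_atLeastAtMost_real)
qed

lemma isCont_Psi:
  assumes n: "n \<ge> 2" and \<gamma>: "\<gamma> > 1 - real n" and r: "r > -1"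
  shows "isCont (Psi n \<gamma>) r"
proof (cases "r = 1")
  case False
  then show ?thesis using r by (intro DERIV_isCont[OF Psi_has_derivative]) auto
next
  case True
  have "isCont (\<lambda>r. \<integral>\<theta>. chord2 r \<theta> powr (\<gamma> / 2) \<partial>angle_measure n) 1"
  proof (cases "\<gamma> \<ge> 0")
    case True
    show ?thesis
    proof (rule isCont_angle_integral_1[OF n, where p=0 and C="9 powr (\<gamma> / 2)"])
      show "continuous_on {0<..} (\<lambda>x::real. x powr (\<gamma> / 2))" by (intro continuous_intros) auto
      fix x :: real assume x: "0 < x" "x \<le> 9"
      then have "x powr (\<gamma> / 2) \<le> 9 powr (\<gamma> / 2)" using True by (intro powr_mono2) auto
      moreover have "0 \<le> (9::real) powr (\<gamma> / 2)" "\<bar>x powr (\<gamma> / 2)\<bar> = x powr (\<gamma> / 2)" by (rule powr_ge_zero) simp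
      moreover have "9 powr (\<gamma> / 2) * (1 + x powr 0) = 9 powr (\<gamma> / 2) + 9 powr (\<gamma> / 2)" using x by simp
      ultimately show "\<bar>x powr (\<gamma> / 2)\<bar> \<le> 9 powr (\<gamma> / 2) * (1 + x powr 0)" by linarith
    qed (use n in auto)
  next
    case False
    show ?thesis
    proof (rule isCont_angle_integral_1[OF n, where p="\<gamma>/2" and C=1])
      show "continuous_on {0<..} (\<lambda>x::real. x powr (\<gamma> / 2))" by (intro continuous_intros) auto
    qed (use False \<gamma> in auto)
  qed
  then show ?thesis unfolding True Psi_def .
qed

lemma abs_ln_bound: "0 < x \<Longrightarrow> x \<le> 9 \<Longrightarrow> \<bar>ln (sqrt x)\<bar> \<le> 5 * (1 + x powr (- 1 / 4))"
proof -
  assume x: "0 < (x::real)" "x \<le> 9"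
  have "ln (x powr (- 1 / 4)) \<le> x powr (- 1 / 4) - 1" by (rule ln_le_minus_one) (use x in simp)
  then have "- ln x \<le> 4 * x powr (- 1 / 4)" using x by (simp add: ln_powr)
  moreover have "ln x \<le> x - 1" by (rule ln_le_minus_one) (use x in simp)
  moreover have "0 \<le> x powr (- 1 / 4)" by simp
  moreover have "ln (sqrt x) = ln x / 2" using x by (simp add: ln_sqrt)
  moreover have "\<bar>l / 2\<bar> \<le> 5 * (1 + y)" if "- l \<le> 4 * y" "l \<le> x - 1" "0 \<le> y" for l y :: real
    using that x by (intro abs_leI) (simp_all add: field_simps)
  ultimately show ?thesis by metis
qed

lemma isCont_Pot:
  assumes n: "n \<ge> 2" and \<gamma>: "\<gamma> > 1 - real n" and r: "r > -1"
  shows "isCont (Pot n \<gamma>) r"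
proof (cases "r = 1")
  case False
  then show ?thesis using r by (intro DERIV_isCont[OF Pot_has_derivative]) auto
next
  case r: True
  show ?thesis
  proof (cases "\<gamma> = 0")
    case False
    then have "Pot n \<gamma> = (\<lambda>r. Psi n \<gamma> r / \<gamma>)" using Pot_eq_Psi by blast
    then show ?thesis using isCont_Psi[OF n \<gamma>, of r] False unfolding r by (auto intro!: continuous_intros)
  next
    case True
    have "isCont (\<lambda>r. \<integral>\<theta>. ln (sqrt (chord2 r \<theta>)) \<partial>angle_measure n) 1"
    proof (rule isCont_angle_integral_1[OF n, where p="-1/4" and C=5])
      show "continuous_on {0<..} (\<lambda>x::real. ln (sqrt x))" by (intro continuous_intros) auto
    qed (use n abs_ln_bound in auto)
    then show ?thesis unfolding r True Pot_def power_potential_def by simp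
  qed
qed

text \<open>Since \<open>2 r (r - cos \<theta>) = chord2 r \<theta> + r\<^sup>2 - 1\<close>. In this form the continuity at \<open>r = 1\<close> and the value
there can be read off.\<close>

lemma Slope_eq:
  assumes r: "r > 0"
  shows "Slope n \<gamma> r = (Psi n \<gamma> r + (r\<^sup>2 - 1) * Psi n (\<gamma> - 2) r) / (2 * r)"
proof -
  have pt: "(r - cos \<theta>) * chord2 r \<theta> powr (\<gamma> / 2 - 1) =
     (chord2 r \<theta> powr (\<gamma> / 2) + (r\<^sup>2 - 1) * chord2 r \<theta> powr ((\<gamma> - 2) / 2)) / (2 * r)" for \<theta>
  proof -
    have "chord2 r \<theta> powr (\<gamma> / 2) = chord2 r \<theta> * chord2 r \<theta> powr (\<gamma> / 2 - 1)"
    proof (cases "chord2 r \<theta> = 0")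
      case False
      then have "chord2 r \<theta> > 0" using chord2_nonneg[of r \<theta>] by simp
      then show ?thesis by (simp add: powr_diff)
    qed simp
    moreover have "r - cos \<theta> = (chord2 r \<theta> + (r\<^sup>2 - 1)) / (2 * r)"
      using r by (simp add: chord2_def power2_eq_square field_simps)
    moreover have "(\<gamma> - 2) / 2 = \<gamma> / 2 - 1" by simp
    ultimately show ?thesis by (simp only: distrib_right times_divide_eq_left)
  qed
  show ?thesis
  proof (cases "r = 1")
    case True
    then show ?thesis unfolding Slope_def pt Psi_def by simp
  next
    case False
    then have "r \<in> {-1<..<1} \<union> {1<..}" using r by auto
    then show ?thesis unfolding Slope_def pt Psi_def by (simp add: integrable_chord2_powr)
  qed
qed

lemma isCont_Slope_1:
  assumes n: "n \<ge> 2" and \<gamma>: "\<gamma> - 2 > 1 - real n"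
  shows "isCont (Slope n \<gamma>) 1"
proof -
  have "isCont (\<lambda>r. (Psi n \<gamma> r + (r\<^sup>2 - 1) * Psi n (\<gamma> - 2) r) / (2 * r)) 1"
    using isCont_Psi[OF n, of \<gamma> 1] isCont_Psi[OF n \<gamma>, of 1] \<gamma> by (auto intro!: continuous_intros)
  moreover have "eventually (\<lambda>r. (Psi n \<gamma> r + (r\<^sup>2 - 1) * Psi n (\<gamma> - 2) r) / (2 * r) = Slope n \<gamma> r) (nhds (1::real))"
    using eventually_nhds_in_open[of "{0<..}" "1::real"] by (auto elim!: eventually_mono simp: Slope_eq)
  ultimately show ?thesis by (simp only: isCont_cong)
qed

lemma Psi_ge_Psi_1:
  assumes n: "n \<ge> 2" and \<gamma>: "\<gamma> \<ge> 0" and r: "r > 1"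
  shows "Psi n \<gamma> 1 \<le> Psi n \<gamma> r"
  unfolding Psi_def
proof (rule integral_mono)
  show "integrable (angle_measure n) (\<lambda>\<theta>. chord2 1 \<theta> powr (\<gamma> / 2))" using n \<gamma> by (intro integrable_chord2_1) auto
  show "integrable (angle_measure n) (\<lambda>\<theta>. chord2 r \<theta> powr (\<gamma> / 2))" using r by (intro integrable_chord2_powr) auto
  fix \<theta> :: real
  have "1 * (2 - 2 * cos \<theta>) \<le> r * (2 - 2 * cos \<theta>)" using r cos_le_one[of \<theta>] by (intro mult_right_mono) auto
  then have "chord2 1 \<theta> \<le> chord2 r \<theta>" using chord2_ge[of r \<theta>] r unfolding chord2_1 by simp
  then show "chord2 1 \<theta> powr (\<gamma> / 2) \<le> chord2 r \<theta> powr (\<gamma> / 2)"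
    using \<gamma> chord2_nonneg by (intro powr_mono2) auto
qed

lemma Psi_le_Psi_1:
  assumes n: "n \<ge> 2" and \<gamma>: "\<gamma> \<le> 0" "\<gamma> > 1 - real n" and r: "r > 1"
  shows "Psi n \<gamma> r \<le> Psi n \<gamma> 1"
  unfolding Psi_def
proof (rule integral_mono_AE)
  show "integrable (angle_measure n) (\<lambda>\<theta>. chord2 1 \<theta> powr (\<gamma> / 2))" using n \<gamma> by (intro integrable_chord2_1) auto
  show "integrable (angle_measure n) (\<lambda>\<theta>. chord2 r \<theta> powr (\<gamma> / 2))" using r by (intro integrable_chord2_powr) auto
  show "AE \<theta> in angle_measure n. chord2 r \<theta> powr (\<gamma> / 2) \<le> chord2 1 \<theta> powr (\<gamma> / 2)"
    using AE_angle_measure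
  proof eventually_elim
    case (elim \<theta>)
    have "1 * (2 - 2 * cos \<theta>) \<le> r * (2 - 2 * cos \<theta>)" using r cos_le_one[of \<theta>] by (intro mult_right_mono) auto
    then have "chord2 1 \<theta> \<le> chord2 r \<theta>" using chord2_ge[of r \<theta>] r unfolding chord2_1 by simp
    then show ?case using \<gamma> chord2_1_pos[of \<theta>] elim by (intro powr_mono2') auto
  qed
qed

section \<open>Log-convexity and sign patterns\<close>

text \<open>Chebyshev's inequality: with respect to the weight \<open>chord2 r \<theta> powr (\<gamma>1 / 2 - 1)\<close>, the functions
\<open>chord2 r\<close> and \<open>chord2 r powr ((\<gamma>2 - \<gamma>1) / 2)\<close> are monotone functions of each other and hence
positively correlated.\<close>

lemma Psi_chebyshev:
  assumes r: "r \<in> {-1<..<1}" and le: "\<gamma>1 \<le> \<gamma>2"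
  shows "Psi n (\<gamma>2 - 2) r * Psi n \<gamma>1 r \<le> Psi n (\<gamma>1 - 2) r * Psi n \<gamma>2 r"
proof -
  define s where "s = (\<gamma>2 - \<gamma>1) / 2"
  define p where "p = \<gamma>1 / 2 - 1"
  \<comment> \<open>The mean of \<open>chord2 r\<close> for the weight. With this centring the terms containing \<open>b powr s\<close> cancel.\<close>
  define b where "b = Psi n \<gamma>1 r / Psi n (\<gamma>1 - 2) r"
  have reg: "r \<in> {-1<..<1} \<union> {1<..}" using r by simp
  have pos: "Psi n \<gamma> r > 0" for \<gamma> by (rule Psi_pos[OF reg])
  have b: "b > 0" unfolding b_def using pos by simp
  have i: "integrable (angle_measure n) (\<lambda>\<theta>. chord2 r \<theta> powr q)" for q
    by (rule integrable_chord2_powr[OF reg])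
  have "0 \<le> (\<integral>\<theta>. (chord2 r \<theta> powr s - b powr s) * (chord2 r \<theta> - b) * chord2 r \<theta> powr p \<partial>angle_measure n)"
  proof (rule integral_nonneg_AE, rule AE_I2)
    fix \<theta> :: real
    have c: "chord2 r \<theta> \<ge> 0" by (rule chord2_nonneg)
    have s: "s \<ge> 0" using le by (simp add: s_def)
    have "0 \<le> (chord2 r \<theta> powr s - b powr s) * (chord2 r \<theta> - b)"
    proof (cases "chord2 r \<theta> \<le> b")
      case True
      then have "chord2 r \<theta> powr s \<le> b powr s" using c s by (intro powr_mono2) auto
      then show ?thesis using True by (intro mult_nonpos_nonpos) auto
    next
      case False
      then have "b powr s \<le> chord2 r \<theta> powr s" using b s by (intro powr_mono2) auto
      then show ?thesis using False by (intro mult_nonneg_nonneg) auto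
    qed
    then show "0 \<le> (chord2 r \<theta> powr s - b powr s) * (chord2 r \<theta> - b) * chord2 r \<theta> powr p"
      by (rule mult_nonneg_nonneg) simp
  qed
  also have "\<dots> = (\<integral>\<theta>. chord2 r \<theta> powr (\<gamma>2 / 2) - b * chord2 r \<theta> powr ((\<gamma>2 - 2) / 2)
      - b powr s * (chord2 r \<theta> powr (\<gamma>1 / 2) - b * chord2 r \<theta> powr ((\<gamma>1 - 2) / 2)) \<partial>angle_measure n)"
  proof (rule Bochner_Integration.integral_cong)
    fix \<theta> :: real
    define X where "X = chord2 r \<theta>"
    have X: "X > 0" unfolding X_def by (rule chord2_pos[OF reg])
    have e: "X powr (\<gamma>2 / 2) = X powr s * (X * X powr p)" "X powr ((\<gamma>2 - 2) / 2) = X powr s * X powr p"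
       "X powr (\<gamma>1 / 2) = X * X powr p" "X powr ((\<gamma>1 - 2) / 2) = X powr p"
    proof -
      have 1: "X = X powr 1" using X by simp
      have "X powr s * (X powr 1 * X powr p) = X powr (\<gamma>2 / 2)"
        unfolding powr_add[symmetric] s_def p_def by (simp add: field_simps)
      then show "X powr (\<gamma>2 / 2) = X powr s * (X * X powr p)" using 1 by simp
      show "X powr ((\<gamma>2 - 2) / 2) = X powr s * X powr p"
        unfolding powr_add[symmetric] s_def p_def by (simp add: field_simps)
      have "X powr 1 * X powr p = X powr (\<gamma>1 / 2)"
        unfolding powr_add[symmetric] p_def by simp
      then show "X powr (\<gamma>1 / 2) = X * X powr p" using 1 by simp
      show "X powr ((\<gamma>1 - 2) / 2) = X powr p" unfolding p_def by (simp add: diff_divide_distrib)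
    qed
    show "(chord2 r \<theta> powr s - b powr s) * (chord2 r \<theta> - b) * chord2 r \<theta> powr p =
      chord2 r \<theta> powr (\<gamma>2 / 2) - b * chord2 r \<theta> powr ((\<gamma>2 - 2) / 2)
      - b powr s * (chord2 r \<theta> powr (\<gamma>1 / 2) - b * chord2 r \<theta> powr ((\<gamma>1 - 2) / 2))"
      unfolding X_def[symmetric] e by (simp only: left_diff_distrib right_diff_distrib mult_ac)
  qed simp
  also have "\<dots> = Psi n \<gamma>2 r - b * Psi n (\<gamma>2 - 2) r - b powr s * (Psi n \<gamma>1 r - b * Psi n (\<gamma>1 - 2) r)"
    using i unfolding Psi_def by simp
  also have "b * Psi n (\<gamma>1 - 2) r = Psi n \<gamma>1 r" using pos[of "\<gamma>1 - 2"] by (simp add: b_def)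
  finally have "b * Psi n (\<gamma>2 - 2) r \<le> Psi n \<gamma>2 r" by simp
  then have "b * Psi n (\<gamma>2 - 2) r * Psi n (\<gamma>1 - 2) r \<le> Psi n \<gamma>2 r * Psi n (\<gamma>1 - 2) r"
    using pos[of "\<gamma>1 - 2"] by (intro mult_right_mono) auto
  then show ?thesis using pos[of "\<gamma>1 - 2"] by (simp add: b_def mult_ac)
qed

text \<open>The hypothesis on \<open>Q\<close> says that \<open>Q\<close> changes sign at most once, from plus to minus. The next
three lemmas carry such a pattern through an integration from \<open>0\<close> (where the flux vanishes), through
an integration from \<open>1\<close> (where the primitive is nonnegative), which reverses it to a change from
minus to plus, and finally to a function that vanishes at both ends and so cannot be positive.
Strict inequality in the premise and weak inequality in the conclusion make the patterns closed under
each step.\<close>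

lemma sign_pattern_flux:
  fixes q Q w :: "real \<Rightarrow> real"
  assumes der: "\<And>x. 0 \<le> x \<Longrightarrow> x < 1 \<Longrightarrow> (q has_real_derivative w x * Q x) (at x)"
    and w: "\<And>x. 0 < x \<Longrightarrow> w x > 0" and q0: "q 0 = 0"
    and Q: "\<And>x y. 0 < x \<Longrightarrow> x < y \<Longrightarrow> y < 1 \<Longrightarrow> Q x < 0 \<Longrightarrow> Q y \<le> 0"
    and xy: "0 < x" "x < y" "y < 1" "q x < 0"
  shows "q y \<le> 0"
proof -
  have "\<exists>z. 0 < z \<and> z < x \<and> q x - q 0 = (x - 0) * (w z * Q z)"
    using xy by (intro MVT2 der) auto
  then obtain z where z: "0 < z" "z < x" "q x = x * (w z * Q z)" using q0 by auto
  then have "Q z < 0" using xy w[of z] by (simp add: mult_less_0_iff zero_less_mult_iff)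
  have "q y \<le> q x"
  proof (rule DERIV_nonpos_imp_nonincreasing[where f=q and a=x and b=y])
    fix t assume t: "x \<le> t" "t \<le> y"
    have "Q t \<le> 0" using Q[OF z(1) _ _ \<open>Q z < 0\<close>, of t] z t xy by simp
    then have "w t * Q t \<le> 0" using w[of t] t xy by (intro mult_nonneg_nonpos) auto
    then show "\<exists>y. DERIV q t :> y \<and> y \<le> 0" using der[of t] t xy by (intro exI conjI) auto
  qed (use xy in simp)
  then show ?thesis using xy by simp
qed

text \<open>If \<open>P\<close> fell from a positive to a negative value, \<open>P'\<close> would have been negative on the way, so \<open>P\<close>
would go on decreasing up to \<open>1\<close>, against \<open>P 1 \<ge> 0\<close>.\<close>

lemma sign_pattern_primitive:
  fixes P P' :: "real \<Rightarrow> real"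
  assumes der: "\<And>x. 0 < x \<Longrightarrow> x < 1 \<Longrightarrow> (P has_real_derivative P' x) (at x)"
    and P': "\<And>x y. 0 < x \<Longrightarrow> x < y \<Longrightarrow> y < 1 \<Longrightarrow> P' x < 0 \<Longrightarrow> P' y \<le> 0"
    and cont: "isCont P 1" and P1: "P 1 \<ge> 0"
    and xy: "0 < x" "x < y" "y < 1" "P x > 0"
  shows "P y \<ge> 0"
proof (rule ccontr)
  assume neg: "\<not> P y \<ge> 0"
  have "\<exists>z. x < z \<and> z < y \<and> P y - P x = (y - x) * P' z"
    using xy by (intro MVT2 der) auto
  then obtain z where z: "x < z" "z < y" "P y - P x = (y - x) * P' z" by blast
  then have "(y - x) * P' z < 0" using neg xy by simp
  then have "P' z < 0" using xy by (simp add: mult_less_0_iff)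
  have "P 1 \<le> P y"
  proof (rule DERIV_nonpos_imp_decreasing_open[where f=P and a=y and b=1])
    fix t assume t: "y < t" "t < 1"
    have "P' t \<le> 0" using P'[OF _ _ _ \<open>P' z < 0\<close>, of t] z t xy by simp
    then show "\<exists>y. DERIV P t :> y \<and> y \<le> 0" using der[of t] t xy by (intro exI conjI) auto
  next
    show "continuous_on {y..1} P"
    proof (rule continuous_at_imp_continuous_on, rule ballI)
      fix t assume "t \<in> {y..1}"
      then show "isCont P t" using cont der[of t] xy by (cases "t = 1") (auto intro: DERIV_isCont)
    qed
  qed (use xy in simp)
  then show False using neg P1 by simp
qed

text \<open>A positive value requires \<open>P\<close> to have been positive before, after which \<open>m\<close> increases and cannot
return to \<open>0\<close> at \<open>1\<close>.\<close>

lemma sign_pattern_boundary: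
  fixes m P w :: "real \<Rightarrow> real"
  assumes der: "\<And>x. 0 \<le> x \<Longrightarrow> x < 1 \<Longrightarrow> (m has_real_derivative w x * P x) (at x)"
    and w: "\<And>x. 0 < x \<Longrightarrow> w x > 0" and m0: "m 0 = 0" and m1: "m 1 = 0" and cont: "isCont m 1"
    and P: "\<And>x y. 0 < x \<Longrightarrow> x < y \<Longrightarrow> y < 1 \<Longrightarrow> P x > 0 \<Longrightarrow> P y \<ge> 0"
    and x: "0 < x" "x < 1"
  shows "m x \<le> 0"
proof (rule ccontr)
  assume pos: "\<not> m x \<le> 0"
  have "\<exists>z. 0 < z \<and> z < x \<and> m x - m 0 = (x - 0) * (w z * P z)"
    using x by (intro MVT2 der) auto
  then obtain z where z: "0 < z" "z < x" "m x = x * (w z * P z)" using m0 by auto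
  then have "P z > 0" using pos x w[of z] by (simp add: not_le zero_less_mult_iff)
  have "m x \<le> m 1"
  proof (rule DERIV_nonneg_imp_increasing_open[where f=m and a=x and b=1])
    fix t assume t: "x < t" "t < 1"
    have "P t \<ge> 0" using P[OF z(1) _ _ \<open>P z > 0\<close>, of t] z t x by simp
    then have "w t * P t \<ge> 0" using w[of t] t x by (intro mult_nonneg_nonneg) auto
    then show "\<exists>y. DERIV m t :> y \<and> y \<ge> 0" using der[of t] t x by (intro exI conjI) auto
  next
    show "continuous_on {x..1} m"
    proof (rule continuous_at_imp_continuous_on, rule ballI)
      fix t assume "t \<in> {x..1}"
      then show "isCont m t" using cont der[of t] x by (cases "t = 1") (auto intro: DERIV_isCont)
    qed
  qed (use x in simp)
  then show False using pos m1 by simp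
qed

text \<open>The quotient \<open>Psi n \<gamma>1 / Psi n \<gamma>2\<close> increases if its Wronskian is nonnegative. Multiplied by
\<open>r ^ (n - 1)\<close> this is the function \<open>S\<close> below, which vanishes at \<open>0\<close> and whose derivative contains no
products of slopes: it is
\<open>r ^ (n - 1) (\<gamma>1 (\<gamma>1 + n - 2) Psi (\<gamma>1 - 2) Psi \<gamma>2 - \<gamma>2 (\<gamma>2 + n - 2) Psi (\<gamma>2 - 2) Psi \<gamma>1)\<close>. By
\<open>Psi_chebyshev\<close> the first product of averages is the larger one, and the conditions on \<open>\<gamma>1\<close> and \<open>\<gamma>2\<close>
make its coefficient nonnegative and the larger one.\<close>

lemma Psi_ratio_increasing:
  assumes n: "n \<ge> 2" and le: "\<gamma>1 \<le> \<gamma>2" "\<gamma>2 \<le> 0" and sub: "\<gamma>1 + real n - 2 \<le> 0"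
    and xy: "0 < x" "x < y" "y < 1"
  shows "Psi n \<gamma>1 x * Psi n \<gamma>2 y \<le> Psi n \<gamma>1 y * Psi n \<gamma>2 x"
proof -
  define S where "S r = r ^ (n - 1) * Slope n \<gamma>1 r * (\<gamma>1 * Psi n \<gamma>2 r) - r ^ (n - 1) * Slope n \<gamma>2 r * (\<gamma>2 * Psi n \<gamma>1 r)" for r
  define S' where "S' r = r ^ (n - 1) * (\<gamma>1 * (\<gamma>1 + real n - 2) * (Psi n (\<gamma>1 - 2) r * Psi n \<gamma>2 r) - \<gamma>2 * (\<gamma>2 + real n - 2) * (Psi n (\<gamma>2 - 2) r * Psi n \<gamma>1 r))" for r
  have S: "(S has_real_derivative S' r) (at r)" if "0 \<le> r" "r < 1" for r
  proof -
    have reg: "r \<in> {-1<..<1} \<union> {1<..}" using that by simp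
    note d1 = DERIV_mult[OF Slope_has_derivative[OF reg n, of \<gamma>1] DERIV_cmult[OF Psi_has_derivative[OF reg, of n \<gamma>2], of \<gamma>1]]
    note d2 = DERIV_mult[OF Slope_has_derivative[OF reg n, of \<gamma>2] DERIV_cmult[OF Psi_has_derivative[OF reg, of n \<gamma>1], of \<gamma>2]]
    show ?thesis
      unfolding S_def[abs_def] S'_def
      by (rule DERIV_cong[OF DERIV_diff[OF d1 d2]]) (simp add: algebra_simps)
  qed
  have S'nn: "S' r \<ge> 0" if r: "0 \<le> r" "r < 1" for r
  proof -
    have reg: "r \<in> {-1<..<1} \<union> {1<..}" and reg': "r \<in> {-1<..<1}" using r by simp_all
    have pos: "Psi n \<gamma> r > 0" for \<gamma> by (rule Psi_pos[OF reg])
    define A where "A = Psi n (\<gamma>1 - 2) r * Psi n \<gamma>2 r"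
    define B where "B = Psi n (\<gamma>2 - 2) r * Psi n \<gamma>1 r"
    have AB: "B \<le> A" "B > 0" "A > 0" unfolding A_def B_def using Psi_chebyshev[OF reg' le(1)] pos by auto
    have c1: "\<gamma>1 * (\<gamma>1 + real n - 2) \<ge> 0" using le sub by (intro mult_nonpos_nonpos) auto
    have "\<gamma>2 * (\<gamma>2 + real n - 2) * B \<le> \<gamma>1 * (\<gamma>1 + real n - 2) * A"
    proof (cases "\<gamma>2 + real n - 2 \<ge> 0")
      case True
      then have "\<gamma>2 * (\<gamma>2 + real n - 2) \<le> 0" using le by (intro mult_nonpos_nonneg) auto
      then have "\<gamma>2 * (\<gamma>2 + real n - 2) * B \<le> 0" by (rule mult_nonpos_nonneg) (use AB in simp)
      moreover have "0 \<le> \<gamma>1 * (\<gamma>1 + real n - 2) * A" by (rule mult_nonneg_nonneg) (use c1 AB in simp_all)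
      ultimately show ?thesis by linarith
    next
      case False
      \<comment> \<open>All four factors are nonnegative and each factor on the right is the larger one.\<close>
      have "(- \<gamma>2) * (- (\<gamma>2 + real n - 2)) \<le> (- \<gamma>1) * (- (\<gamma>1 + real n - 2))"
        using le sub False by (intro mult_mono) auto
      then have "\<gamma>2 * (\<gamma>2 + real n - 2) \<le> \<gamma>1 * (\<gamma>1 + real n - 2)" by (simp only: minus_mult_minus)
      from mult_mono[OF this AB(1) c1] show ?thesis using AB by simp
    qed
    then show ?thesis unfolding S'_def A_def B_def using r by (intro mult_nonneg_nonneg) auto
  qed
  have Snn: "S r \<ge> 0" if r: "0 \<le> r" "r < 1" for r
  proof -
    have "S 0 \<le> S r"
    proof (rule DERIV_nonneg_imp_nondecreasing[where f=S and a=0 and b=r])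
      fix t assume "0 \<le> t" "t \<le> r"
      then show "\<exists>y. DERIV S t :> y \<and> y \<ge> 0" using S[of t] S'nn[of t] r by (intro exI[of _ "S' t"] conjI) auto
    qed (use r in simp)
    moreover have "S 0 = 0" unfolding S_def using n by simp
    ultimately show ?thesis by simp
  qed
  have pos: "Psi n \<gamma> r > 0" if "x \<le> r" "r \<le> y" for \<gamma> r using that xy by (intro Psi_pos) auto
  have "Psi n \<gamma>1 x / Psi n \<gamma>2 x \<le> Psi n \<gamma>1 y / Psi n \<gamma>2 y"
  proof (rule DERIV_nonneg_imp_nondecreasing[where f="\<lambda>r. Psi n \<gamma>1 r / Psi n \<gamma>2 r" and a=x and b=y])
    fix t assume t: "x \<le> t" "t \<le> y"
    then have reg: "t \<in> {-1<..<1} \<union> {1<..}" using xy by simp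
    have "((\<lambda>r. Psi n \<gamma>1 r / Psi n \<gamma>2 r) has_real_derivative
        (\<gamma>1 * Slope n \<gamma>1 t * Psi n \<gamma>2 t - Psi n \<gamma>1 t * (\<gamma>2 * Slope n \<gamma>2 t)) / (Psi n \<gamma>2 t * Psi n \<gamma>2 t)) (at t)"
      using pos[OF t, of \<gamma>2] by (intro DERIV_divide Psi_has_derivative reg) simp
    moreover have "\<gamma>1 * Slope n \<gamma>1 t * Psi n \<gamma>2 t - Psi n \<gamma>1 t * (\<gamma>2 * Slope n \<gamma>2 t) \<ge> 0"
    proof -
      have "S t = t ^ (n - 1) * (\<gamma>1 * Slope n \<gamma>1 t * Psi n \<gamma>2 t - Psi n \<gamma>1 t * (\<gamma>2 * Slope n \<gamma>2 t))"
        unfolding S_def by (simp add: algebra_simps)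
      then show ?thesis using Snn[of t] zero_less_power[of t "n - 1"] t xy by (auto simp: zero_le_mult_iff not_le[symmetric])
    qed
    ultimately show "\<exists>D. DERIV (\<lambda>r. Psi n \<gamma>1 r / Psi n \<gamma>2 r) t :> D \<and> D \<ge> 0"
      using pos[OF t, of \<gamma>2] by (intro exI conjI divide_nonneg_nonneg) auto
  qed (use xy in simp)
  then show ?thesis using pos[of x \<gamma>2] pos[of y \<gamma>2] xy by (simp add: field_simps)
qed

section \<open>The potential of the sphere is minimal on the sphere\<close>

text \<open>The unit sphere in \<open>n\<close>-space, after rescaling. The factor \<open>C\<close> is the value of \<open>R powr (\<alpha> - \<beta>)\<close>, and
\<open>star\<close> is the condition \<open>\<beta>_* \<le> \<beta>\<close> in the variables \<open>\<alpha> + n - 3\<close> and \<open>\<beta> + n - 3\<close> (see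
\<open>beta_star_condition\<close>).\<close>

context
  fixes n :: nat and \<alpha> \<beta> C :: real
  assumes n: "n \<ge> 2" and \<alpha>: "2 \<le> \<alpha>" "\<alpha> \<le> 4" and \<beta>: "\<beta> \<le> 2" "\<beta> < \<alpha>"
    and sub: "\<beta> + real n - 3 > 0"
    and star: "(\<alpha> + real n - 3) * (\<beta> + real n - 3) \<ge> real n - 1"
    and C: "C = sphere_moment n \<beta> / sphere_moment n \<alpha>"
begin

lemma C_pos: "C > 0"
  unfolding C using n \<alpha> sub by (intro divide_pos_pos sphere_moment_pos) auto

definition Laplacian_Pot where
  "Laplacian_Pot r = C * (\<alpha> + real n - 2) * Psi n (\<alpha> - 2) r - (\<beta> + real n - 2) * Psi n (\<beta> - 2) r"

text \<open>With \<open>u = \<alpha> + n - 3\<close>, \<open>v = \<beta> + n - 3\<close> and \<open>d = n - 1\<close>, the recursion of the moments turns the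
value into a positive multiple of \<open>f u - f v\<close> where \<open>f x = (x + 1) (x + d) / x\<close>, and
\<open>f u - f v = (u - v) (u v - d) / (u v)\<close>. This is the only place where \<open>star\<close> enters.\<close>

lemma Laplacian_Pot_1_nonneg: "Laplacian_Pot 1 \<ge> 0"
proof -
  define u where "u = \<alpha> + real n - 3"
  define v where "v = \<beta> + real n - 3"
  define d where "d = real n - 1"
  have d: "d \<ge> 1" using n by (simp add: d_def)
  have uv: "u > v" "v > 0" "u * v \<ge> d" using \<alpha> \<beta> sub star by (auto simp: u_def v_def d_def)
  define a where "a = sphere_moment n \<alpha>"
  define b where "b = sphere_moment n \<beta>"
  define a2 where "a2 = sphere_moment n (\<alpha> - 2)"
  define b2 where "b2 = sphere_moment n (\<beta> - 2)"
  have pos: "a > 0" "b > 0" "a2 > 0" "b2 > 0"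
    unfolding a_def b_def a2_def b2_def using n \<alpha> sub by (auto intro!: sphere_moment_pos)
  have ra: "(u + d) * a = 4 * u * a2"
    using sphere_moment_rec[OF n, of \<alpha>] n \<alpha> sub \<beta> unfolding a_def a2_def u_def d_def by (simp add: algebra_simps)
  have rb: "(v + d) * b = 4 * v * b2"
    using sphere_moment_rec[OF n, of \<beta>] sub unfolding b_def b2_def v_def d_def by (simp add: algebra_simps)
  have a2: "a2 = (u + d) * a / (4 * u)" using ra uv by (simp add: field_simps)
  have b2: "b2 = (v + d) * b / (4 * v)" using rb uv by (simp add: field_simps)
  have key: "(v + 1) * (v + d) / v \<le> (u + 1) * (u + d) / u"
  proof -
    have "(u + 1) * (u + d) / u - (v + 1) * (v + d) / v = (u - v) * (u * v - d) / (u * v)"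
      using uv by (simp add: field_simps)
    also have "\<dots> \<ge> 0" using uv by (intro divide_nonneg_nonneg mult_nonneg_nonneg) auto
    finally show ?thesis by simp
  qed
  have "Laplacian_Pot 1 = C * (u + 1) * a2 - (v + 1) * b2"
    using n \<alpha> sub unfolding Laplacian_Pot_def a2_def b2_def u_def v_def
    by (subst (1 2) Psi_1) (auto simp: algebra_simps)
  also have "\<dots> = b / 4 * ((u + 1) * (u + d) / u - (v + 1) * (v + d) / v)"
    unfolding C a_def[symmetric] b_def[symmetric] a2 b2 using pos uv by (simp add: field_simps)
  also have "\<dots> \<ge> 0" using key pos by (intro mult_nonneg_nonneg) auto
  finally show ?thesis .
qed

text \<open>The radial derivative of \<open>C * Pot n \<alpha> r - Pot n \<beta> r\<close>, multiplied by the area factor \<open>r ^ (n - 1)\<close>.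
Up to a constant it is the flux of the gradient through the sphere of radius \<open>r\<close>, so its derivative is
the Laplacian times \<open>r ^ (n - 1)\<close>.\<close>

definition Flux where
  "Flux r = r ^ (n - 1) * (C * Slope n \<alpha> r - Slope n \<beta> r)"

lemma Flux_has_derivative:
  assumes r: "r \<in> {-1<..<1} \<union> {1<..}"
  shows "(Flux has_real_derivative r ^ (n - 1) * Laplacian_Pot r) (at r)"
proof -
  have "Flux = (\<lambda>r. C * (r ^ (n - 1) * Slope n \<alpha> r) - r ^ (n - 1) * Slope n \<beta> r)"
    by (auto simp: Flux_def algebra_simps)
  moreover have "((\<lambda>r. C * (r ^ (n - 1) * Slope n \<alpha> r) - r ^ (n - 1) * Slope n \<beta> r) has_real_derivative
     C * (r ^ (n - 1) * ((\<alpha> + real n - 2) * Psi n (\<alpha> - 2) r)) - r ^ (n - 1) * ((\<beta> + real n - 2) * Psi n (\<beta> - 2) r)) (at r)"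
    by (intro DERIV_diff DERIV_cmult Slope_has_derivative r n)
  ultimately show ?thesis by (simp add: Laplacian_Pot_def algebra_simps)
qed

text \<open>This determines \<open>C\<close>, and thereby the optimal radius.\<close>

lemma Flux_1: "Flux 1 = 0"
proof -
  have "Flux 1 = C * (Psi n \<alpha> 1 / 2) - Psi n \<beta> 1 / 2" unfolding Flux_def by (simp add: Slope_eq)
  also have "\<dots> = 0"
    using Psi_1[OF n, of \<alpha>] Psi_1[OF n, of \<beta>] sphere_moment_pos[OF n, of \<alpha>] n \<alpha> sub by (simp add: C)
  finally show ?thesis .
qed

lemma isCont_Flux_1: "isCont Flux 1"
  unfolding Flux_def using n \<alpha> sub
  by (intro continuous_intros isCont_Slope_1) auto

text \<open>For \<open>r > 1\<close> the first average in the Laplacian is at least, and the second at most, its value at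
\<open>1\<close>, because \<open>\<alpha> - 2 \<ge> 0 \<ge> \<beta> - 2\<close>. Hence the Laplacian stays above its nonnegative value at \<open>1\<close>.\<close>

lemma Flux_nonneg_outside:
  assumes r: "r > 1"
  shows "Flux r \<ge> 0"
proof -
  have "Flux 1 \<le> Flux r"
  proof (rule DERIV_nonneg_imp_increasing_open[where f=Flux and a=1 and b=r])
    fix t assume t: "1 < t" "t < r"
    have "C * (\<alpha> + real n - 2) * Psi n (\<alpha> - 2) 1 \<le> C * (\<alpha> + real n - 2) * Psi n (\<alpha> - 2) t"
      using Psi_ge_Psi_1[OF n, of "\<alpha> - 2" t] C_pos \<alpha> t by (intro mult_left_mono) auto
    moreover have "(\<beta> + real n - 2) * Psi n (\<beta> - 2) t \<le> (\<beta> + real n - 2) * Psi n (\<beta> - 2) 1"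
      using Psi_le_Psi_1[OF n, of "\<beta> - 2" t] \<beta> sub t by (intro mult_left_mono) auto
    ultimately have "Laplacian_Pot 1 \<le> Laplacian_Pot t" unfolding Laplacian_Pot_def by linarith
    then have "0 \<le> t ^ (n - 1) * Laplacian_Pot t"
      using Laplacian_Pot_1_nonneg t by (intro mult_nonneg_nonneg) auto
    then show "\<exists>y. DERIV Flux t :> y \<and> y \<ge> 0"
      using Flux_has_derivative[of t] t by (intro exI conjI) auto
  next
    show "continuous_on {1..r} Flux"
    proof (rule continuous_at_imp_continuous_on, rule ballI)
      fix t assume "t \<in> {1..r}"
      then show "isCont Flux t"
        using isCont_Flux_1 Flux_has_derivative[of t] by (cases "t = 1") (auto intro: DERIV_isCont)
    qed
  qed (use r in simp)
  then show ?thesis using Flux_1 by simp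
qed

definition Laplacian_slope where
  "Laplacian_slope r = C * (\<alpha> + real n - 2) * ((\<alpha> - 2) * Slope n (\<alpha> - 2) r)
     - (\<beta> + real n - 2) * ((\<beta> - 2) * Slope n (\<beta> - 2) r)"

definition Bilaplacian where
  "Bilaplacian r = C * (\<alpha> + real n - 2) * ((\<alpha> - 2) * (\<alpha> + real n - 4)) * Psi n (\<alpha> - 4) r
     - (\<beta> + real n - 2) * ((\<beta> - 2) * (\<beta> + real n - 4)) * Psi n (\<beta> - 4) r"

lemma Laplacian_slope_flux_has_derivative:
  assumes r: "r \<in> {-1<..<1} \<union> {1<..}"
  shows "((\<lambda>r. r ^ (n - 1) * Laplacian_slope r) has_real_derivative r ^ (n - 1) * Bilaplacian r) (at r)"
proof -
  have "(\<lambda>r. r ^ (n - 1) * Laplacian_slope r) = (\<lambda>r. C * (\<alpha> + real n - 2) * (\<alpha> - 2) * (r ^ (n - 1) * Slope n (\<alpha> - 2) r)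
     - (\<beta> + real n - 2) * (\<beta> - 2) * (r ^ (n - 1) * Slope n (\<beta> - 2) r))"
    by (auto simp: Laplacian_slope_def algebra_simps)
  moreover have "((\<lambda>r. C * (\<alpha> + real n - 2) * (\<alpha> - 2) * (r ^ (n - 1) * Slope n (\<alpha> - 2) r)
     - (\<beta> + real n - 2) * (\<beta> - 2) * (r ^ (n - 1) * Slope n (\<beta> - 2) r)) has_real_derivative
     C * (\<alpha> + real n - 2) * (\<alpha> - 2) * (r ^ (n - 1) * ((\<alpha> - 2 + real n - 2) * Psi n (\<alpha> - 2 - 2) r))
     - (\<beta> + real n - 2) * (\<beta> - 2) * (r ^ (n - 1) * ((\<beta> - 2 + real n - 2) * Psi n (\<beta> - 2 - 2) r))) (at r)"
    by (intro DERIV_diff DERIV_cmult Slope_has_derivative r n)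
  moreover have "C * (\<alpha> + real n - 2) * (\<alpha> - 2) * (r ^ (n - 1) * ((\<alpha> - 2 + real n - 2) * Psi n (\<alpha> - 2 - 2) r))
     - (\<beta> + real n - 2) * (\<beta> - 2) * (r ^ (n - 1) * ((\<beta> - 2 + real n - 2) * Psi n (\<beta> - 2 - 2) r)) = r ^ (n - 1) * Bilaplacian r"
  proof -
    have e: "\<gamma> - 2 + real n - 2 = \<gamma> + real n - 4" "\<gamma> - 2 - 2 = \<gamma> - 4" for \<gamma> by simp_all
    show ?thesis unfolding Bilaplacian_def e by (simp only: right_diff_distrib[of "r ^ (n - 1)"] mult_ac)
  qed
  ultimately show ?thesis by (simp only:)
qed

text \<open>If \<open>\<beta> + n - 4 \<ge> 0\<close> both terms are nonnegative. Otherwise \<open>Psi_ratio_increasing\<close> applies to the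
exponents \<open>\<beta> - 4 < \<alpha> - 4 \<le> 0\<close>: once the negative term outweighs the positive one, it continues to do
so.\<close>

lemma Bilaplacian_pattern:
  assumes xy: "0 < x" "x < y" "y < 1" and neg: "Bilaplacian x < 0"
  shows "Bilaplacian y \<le> 0"
proof -
  define c1 where "c1 = C * (\<alpha> + real n - 2) * ((\<alpha> - 2) * (\<alpha> + real n - 4))"
  define c2 where "c2 = (\<beta> + real n - 2) * ((\<beta> - 2) * (\<beta> + real n - 4))"
  have B: "Bilaplacian r = c1 * Psi n (\<alpha> - 4) r - c2 * Psi n (\<beta> - 4) r" for r
    unfolding Bilaplacian_def c1_def c2_def ..
  have pos: "Psi n \<gamma> r > 0" if "x \<le> r" "r \<le> y" for \<gamma> r using that xy by (intro Psi_pos) auto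
  have c1: "c1 \<ge> 0"
    unfolding c1_def using C_pos n \<alpha> by (intro mult_nonneg_nonneg) auto
  show ?thesis
  proof (cases "\<beta> + real n - 4 \<ge> 0")
    case True
    then have "c2 \<le> 0" unfolding c2_def using \<beta> sub by (intro mult_nonneg_nonpos mult_nonpos_nonneg) auto
    then have "c2 * Psi n (\<beta> - 4) x \<le> 0" using pos[of x "\<beta> - 4"] xy by (intro mult_nonpos_nonneg) auto
    moreover have "0 \<le> c1 * Psi n (\<alpha> - 4) x" using c1 pos[of x "\<alpha> - 4"] xy by (intro mult_nonneg_nonneg) auto
    ultimately show ?thesis using neg unfolding B by simp
  next
    case False
    have ratio: "Psi n (\<beta> - 4) x * Psi n (\<alpha> - 4) y \<le> Psi n (\<beta> - 4) y * Psi n (\<alpha> - 4) x"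
      using n \<alpha> \<beta> False xy by (intro Psi_ratio_increasing) auto
    have px: "Psi n (\<alpha> - 4) x > 0" "Psi n (\<beta> - 4) x > 0" "Psi n (\<alpha> - 4) y > 0" "Psi n (\<beta> - 4) y > 0"
      using pos xy by auto
    have lt: "c1 * Psi n (\<alpha> - 4) x < c2 * Psi n (\<beta> - 4) x" using neg unfolding B by simp
    have "0 \<le> c1 * Psi n (\<alpha> - 4) x" using c1 px by (intro mult_nonneg_nonneg) auto
    then have "c2 * Psi n (\<beta> - 4) x > 0" using lt by linarith
    then have c2: "c2 > 0" using px by (simp add: zero_less_mult_iff)
    have "c1 * Psi n (\<alpha> - 4) y * Psi n (\<alpha> - 4) x = (c1 * Psi n (\<alpha> - 4) x) * Psi n (\<alpha> - 4) y" by simp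
    also have "\<dots> \<le> (c2 * Psi n (\<beta> - 4) x) * Psi n (\<alpha> - 4) y" using lt px by (intro mult_right_mono) auto
    also have "\<dots> = c2 * (Psi n (\<beta> - 4) x * Psi n (\<alpha> - 4) y)" by simp
    also have "\<dots> \<le> c2 * (Psi n (\<beta> - 4) y * Psi n (\<alpha> - 4) x)" using ratio c2 by (intro mult_left_mono) auto
    also have "\<dots> = c2 * Psi n (\<beta> - 4) y * Psi n (\<alpha> - 4) x" by simp
    finally have "c1 * Psi n (\<alpha> - 4) y \<le> c2 * Psi n (\<beta> - 4) y" using px by (simp only: mult_le_cancel_right)
    then show ?thesis unfolding B by simp
  qed
qed

lemma Laplacian_slope_pattern:
  assumes xy: "0 < x" "x < y" "y < 1" and neg: "Laplacian_slope x < 0"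
  shows "Laplacian_slope y \<le> 0"
proof -
  have "y ^ (n - 1) * Laplacian_slope y \<le> 0"
  proof (rule sign_pattern_flux[where q="\<lambda>r. r ^ (n - 1) * Laplacian_slope r" and Q=Bilaplacian and w="\<lambda>r. r ^ (n - 1)"])
    show "((\<lambda>r. r ^ (n - 1) * Laplacian_slope r) has_real_derivative t ^ (n - 1) * Bilaplacian t) (at t)"
      if "0 \<le> t" "t < 1" for t using that by (intro Laplacian_slope_flux_has_derivative) auto
    show "0 ^ (n - 1) * Laplacian_slope 0 = 0" using n by simp
    show "x ^ (n - 1) * Laplacian_slope x < 0" using neg xy by (intro mult_pos_neg) auto
  qed (use xy Bilaplacian_pattern in auto)
  then show ?thesis using zero_less_power[of y "n - 1"] xy by (auto simp: mult_le_0_iff not_le[symmetric])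
qed

lemma Laplacian_Pot_has_derivative:
  assumes r: "r \<in> {-1<..<1} \<union> {1<..}"
  shows "(Laplacian_Pot has_real_derivative Laplacian_slope r) (at r)"
  unfolding Laplacian_Pot_def[abs_def] Laplacian_slope_def
  by (intro DERIV_diff DERIV_cmult Psi_has_derivative r)

lemma Flux_nonpos_inside:
  assumes r: "0 < r" "r < 1"
  shows "Flux r \<le> 0"
proof (rule sign_pattern_boundary[where m=Flux and P=Laplacian_Pot and w="\<lambda>r. r ^ (n - 1)"])
  show "(Flux has_real_derivative t ^ (n - 1) * Laplacian_Pot t) (at t)" if "0 \<le> t" "t < 1" for t
    using that by (intro Flux_has_derivative) auto
  show "Flux 0 = 0" unfolding Flux_def using n by simp
  show "Laplacian_Pot y \<ge> 0" if "0 < x" "x < y" "y < 1" "Laplacian_Pot x > 0" for x y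
  proof (rule sign_pattern_primitive[where P=Laplacian_Pot and P'=Laplacian_slope and x=x])
    show "(Laplacian_Pot has_real_derivative Laplacian_slope t) (at t)" if "0 < t" "t < 1" for t
      using that by (intro Laplacian_Pot_has_derivative) auto
    show "isCont Laplacian_Pot 1"
      unfolding Laplacian_Pot_def using n \<alpha> sub by (intro continuous_intros isCont_Psi) auto
  qed (use that Laplacian_slope_pattern Laplacian_Pot_1_nonneg in auto)
qed (use r Flux_1 isCont_Flux_1 in auto)

theorem sphere_potential_minimal:
  assumes r: "r \<ge> 0"
  shows "C * Pot n \<alpha> 1 - Pot n \<beta> 1 \<le> C * Pot n \<alpha> r - Pot n \<beta> r"
proof -
  define f where "f r = C * Pot n \<alpha> r - Pot n \<beta> r" for r
  have cont: "continuous_on S f" if "S \<subseteq> {0..}" for S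
  proof (rule continuous_at_imp_continuous_on, rule ballI)
    fix t assume "t \<in> S"
    then have "t > -1" using that by force
    then show "isCont f t" unfolding f_def using n \<alpha> sub by (intro continuous_intros isCont_Pot) auto
  qed
  have der: "(f has_real_derivative (C * Slope n \<alpha> t - Slope n \<beta> t)) (at t)" if "t \<in> {-1<..<1} \<union> {1<..}" for t
    unfolding f_def[abs_def] by (intro DERIV_diff DERIV_cmult Pot_has_derivative that)
  have "f 1 \<le> f r"
  proof (cases "r \<le> 1")
    case True
    show ?thesis
    proof (rule DERIV_nonpos_imp_decreasing_open[where f=f and a=r and b=1])
      fix t assume t: "r < t" "t < 1"
      have "C * Slope n \<alpha> t - Slope n \<beta> t \<le> 0"
        using Flux_nonpos_inside[of t] zero_less_power[of t "n - 1"] t r unfolding Flux_def by (auto simp: mult_le_0_iff not_le[symmetric])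
      then show "\<exists>y. DERIV f t :> y \<and> y \<le> 0" using der[of t] t r by (intro exI conjI) auto
    qed (use True r in \<open>auto intro: cont\<close>)
  next
    case False
    show ?thesis
    proof (rule DERIV_nonneg_imp_increasing_open[where f=f and a=1 and b=r])
      fix t assume t: "1 < t" "t < r"
      have "C * Slope n \<alpha> t - Slope n \<beta> t \<ge> 0"
        using Flux_nonneg_outside[of t] zero_less_power[of t "n - 1"] t unfolding Flux_def by (auto simp: zero_le_mult_iff not_le[symmetric])
      then show "\<exists>y. DERIV f t :> y \<and> y \<ge> 0" using der[of t] t by (intro exI conjI) auto
    qed (use False in \<open>auto intro: cont\<close>)
  qed
  then show ?thesis unfolding f_def .
qed

end

section \<open>Positive definiteness of Gaussian kernels\<close>

definition pair_int :: "(real \<Rightarrow> real) \<Rightarrow> 'a::euclidean_space measure \<Rightarrow> 'a measure \<Rightarrow> real" where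
  "pair_int \<psi> M N = (\<integral>z. \<psi> (dist (fst z) (snd z)) \<partial>(M \<Otimes>\<^sub>M N))"

text \<open>The quadratic form of the kernel \<open>\<psi> (dist x y)\<close> on the signed measure \<open>M - N\<close>.\<close>

definition defect :: "(real \<Rightarrow> real) \<Rightarrow> 'a::euclidean_space measure \<Rightarrow> 'a measure \<Rightarrow> real" where
  "defect \<psi> M N = pair_int \<psi> M M + pair_int \<psi> N N - 2 * pair_int \<psi> M N"

abbreviation pair_integrable :: "(real \<Rightarrow> real) \<Rightarrow> 'a::euclidean_space measure \<Rightarrow> 'a measure \<Rightarrow> bool" where
  "pair_integrable \<psi> M N \<equiv> integrable (M \<Otimes>\<^sub>M N) (\<lambda>z. \<psi> (dist (fst z) (snd z)))"

text \<open>The constant \<open>2 * t\<close> makes the product of two such Gaussians, integrated over the centre, a multiple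
of the Gaussian with constant \<open>t\<close> (see \<open>gaussian_product_integral\<close>).\<close>

definition gauss_conv :: "real \<Rightarrow> 'a::euclidean_space measure \<Rightarrow> 'a \<Rightarrow> real" where
  "gauss_conv t M z = (\<integral>x. exp (- (2 * t) * (norm (x - z))\<^sup>2) \<partial>M)"

definition gauss_mass :: "'a::euclidean_space itself \<Rightarrow> real \<Rightarrow> real" where
  "gauss_mass _ t = (\<integral>z. exp (- (4 * t) * (norm z)\<^sup>2) \<partial>(lborel :: 'a measure))"

lemma gauss_mass_pos: "t > 0 \<Longrightarrow> gauss_mass TYPE('a::euclidean_space) t > 0"
  using gaussian_integral_pos[of "4 * t" "0 :: 'a"] by (simp add: gauss_mass_def)

text \<open>Complete the square about the midpoint of \<open>x\<close> and \<open>y\<close>.\<close>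

lemma gaussian_product_integral:
  fixes x y :: "'a::euclidean_space"
  assumes t: "t > 0"
  shows "(\<integral>\<^sup>+z. ennreal (exp (- (2 * t) * (norm (x - z))\<^sup>2)) * ennreal (exp (- (2 * t) * (norm (y - z))\<^sup>2)) \<partial>lborel) =
     ennreal (gauss_mass TYPE('a) t) * ennreal (exp (- t * (dist x y)\<^sup>2))"
proof -
  define m where "m = (1/2) *\<^sub>R (x + y)"
  have pt: "ennreal (exp (- (2 * t) * (norm (x - (m + 1 *\<^sub>R z)))\<^sup>2)) * ennreal (exp (- (2 * t) * (norm (y - (m + 1 *\<^sub>R z)))\<^sup>2)) =
     ennreal (exp (- t * (dist x y)\<^sup>2)) * ennreal (exp (- (4 * t) * (norm (z - 0))\<^sup>2))" for z
  proof -
    have "(norm (x - (m + z)))\<^sup>2 + (norm (y - (m + z)))\<^sup>2 = (norm (x - y))\<^sup>2 / 2 + 2 * (norm z)\<^sup>2"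
      unfolding power2_norm_eq_inner m_def
      by (simp add: inner_diff_left inner_diff_right inner_add_left inner_add_right inner_commute field_simps)
    then have "- (2 * t) * ((norm (x - (m + z)))\<^sup>2 + (norm (y - (m + z)))\<^sup>2) =
        - (2 * t) * ((norm (x - y))\<^sup>2 / 2 + 2 * (norm z)\<^sup>2)"
      by (simp only:)
    then have "- (2 * t) * (norm (x - (m + z)))\<^sup>2 + - (2 * t) * (norm (y - (m + z)))\<^sup>2 =
        - t * (norm (x - y))\<^sup>2 + - (4 * t) * (norm z)\<^sup>2"
      by (simp add: algebra_simps)
    then show ?thesis
      by (simp add: ennreal_mult[symmetric] exp_add[symmetric] dist_norm del: exp_minus_inverse)
  qed
  have "(\<integral>\<^sup>+z. ennreal (exp (- (2 * t) * (norm (x - z))\<^sup>2)) * ennreal (exp (- (2 * t) * (norm (y - z))\<^sup>2)) \<partial>lborel) =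
     (\<integral>\<^sup>+z. ennreal (exp (- t * (dist x y)\<^sup>2)) * ennreal (exp (- (4 * t) * (norm (z - 0))\<^sup>2)) \<partial>(lborel :: 'a measure))"
    unfolding pt[symmetric] by (subst nn_integral_lborel_affine[where c=1 and t=m]) auto
  also have "\<dots> = ennreal (exp (- t * (dist x y)\<^sup>2)) * (\<integral>\<^sup>+z. ennreal (exp (- (4 * t) * (norm (z - 0))\<^sup>2)) \<partial>(lborel :: 'a measure))"
    by (rule nn_integral_cmult) measurable
  also have "(\<integral>\<^sup>+z. ennreal (exp (- (4 * t) * (norm (z - 0))\<^sup>2)) \<partial>(lborel :: 'a measure)) = ennreal (gauss_mass TYPE('a) t)"
    unfolding gauss_mass_def using nn_integral_eq_integral[OF integrable_gaussian[of "4 * t" "0::'a"]] t by simp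
  finally show ?thesis by (simp add: mult.commute)
qed

lemma
  fixes M :: "'a::euclidean_space measure"
  assumes M: "prob_space M" and [measurable_cong]: "sets M = sets borel" and t: "t > 0"
  shows gauss_conv_nonneg: "0 \<le> gauss_conv t M z"
    and gauss_conv_le_1: "gauss_conv t M z \<le> 1"
    and nn_integral_gauss_conv: "(\<integral>\<^sup>+x. ennreal (exp (- (2 * t) * (norm (x - z))\<^sup>2)) \<partial>M) = ennreal (gauss_conv t M z)"
proof -
  interpret prob_space M by fact
  have i: "integrable M (\<lambda>x. exp (- (2 * t) * (norm (x - z))\<^sup>2))"
    by (rule integrable_const_bound[where B=1]) (use t in auto)
  show "0 \<le> gauss_conv t M z" unfolding gauss_conv_def by (intro integral_nonneg_AE) auto
  have "gauss_conv t M z \<le> (\<integral>x. 1 \<partial>M)"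
    unfolding gauss_conv_def by (rule integral_mono[OF i]) (use t in auto)
  then show "gauss_conv t M z \<le> 1" by (simp add: prob_space)
  show "(\<integral>\<^sup>+x. ennreal (exp (- (2 * t) * (norm (x - z))\<^sup>2)) \<partial>M) = ennreal (gauss_conv t M z)"
    unfolding gauss_conv_def by (rule nn_integral_eq_integral[OF i]) auto
qed

lemma gauss_conv_measurable [measurable]:
  assumes "prob_space M" and [measurable_cong]: "sets M = sets borel"
  shows "gauss_conv t M \<in> borel_measurable borel"
proof -
  interpret prob_space M by fact
  show ?thesis unfolding gauss_conv_def by measurable
qed

text \<open>Tonelli, after the Gaussian in \<open>dist x y\<close> is written as a convolution of two Gaussians.\<close>

lemma pair_int_gauss:
  fixes M N :: "'a::euclidean_space measure"
  assumes M: "prob_space M" "sets M = sets borel" and N: "prob_space N" "sets N = sets borel" and t: "t > 0"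
  shows "integrable lborel (\<lambda>z. gauss_conv t M z * gauss_conv t N z)"
    and "pair_integrable (\<lambda>\<rho>. exp (- t * \<rho>\<^sup>2)) M N"
    and "gauss_mass TYPE('a) t * pair_int (\<lambda>\<rho>. exp (- t * \<rho>\<^sup>2)) M N = (\<integral>z. gauss_conv t M z * gauss_conv t N z \<partial>lborel)"
proof -
  interpret M: prob_space M by fact
  interpret N: prob_space N by fact
  interpret MN: pair_prob_space M N ..
  interpret Mlb: pair_sigma_finite M "lborel :: 'a measure" ..
  interpret Nlb: pair_sigma_finite N "lborel :: 'a measure" ..
  note [measurable_cong] = M(2) N(2)
  note [measurable] = gauss_conv_measurable[OF M] gauss_conv_measurable[OF N]
  let ?G = "\<lambda>x z :: 'a. ennreal (exp (- (2 * t) * (norm (x - z))\<^sup>2))"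
  have "ennreal (gauss_mass TYPE('a) t) * (\<integral>\<^sup>+z. ennreal (exp (- t * (dist (fst z) (snd z))\<^sup>2)) \<partial>(M \<Otimes>\<^sub>M N)) =
      (\<integral>\<^sup>+x. (\<integral>\<^sup>+y. ennreal (gauss_mass TYPE('a) t) * ennreal (exp (- t * (dist x y)\<^sup>2)) \<partial>N) \<partial>M)"
    by (simp add: N.nn_integral_fst[symmetric] nn_integral_cmult)
  also have "\<dots> = (\<integral>\<^sup>+x. (\<integral>\<^sup>+y. (\<integral>\<^sup>+z. ?G x z * ?G y z \<partial>lborel) \<partial>N) \<partial>M)"
    by (simp only: gaussian_product_integral[OF t])
  also have "\<dots> = (\<integral>\<^sup>+x. (\<integral>\<^sup>+z. (\<integral>\<^sup>+y. ?G x z * ?G y z \<partial>N) \<partial>lborel) \<partial>M)"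
    by (intro nn_integral_cong Nlb.Fubini'[symmetric]) measurable
  also have "\<dots> = (\<integral>\<^sup>+x. (\<integral>\<^sup>+z. ?G x z * ennreal (gauss_conv t N z) \<partial>lborel) \<partial>M)"
    by (simp only: nn_integral_gauss_conv[OF N t, symmetric]) (simp add: nn_integral_cmult)
  also have "\<dots> = (\<integral>\<^sup>+z. (\<integral>\<^sup>+x. ?G x z * ennreal (gauss_conv t N z) \<partial>M) \<partial>lborel)"
    by (intro Mlb.Fubini'[symmetric]) measurable
  also have "\<dots> = (\<integral>\<^sup>+z. (\<integral>\<^sup>+x. ?G x z \<partial>M) * ennreal (gauss_conv t N z) \<partial>lborel)"
    by (simp add: nn_integral_multc)
  also have "\<dots> = (\<integral>\<^sup>+z. ennreal (gauss_conv t M z * gauss_conv t N z) \<partial>lborel)"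
    by (simp only: nn_integral_gauss_conv[OF M t] ennreal_mult[OF gauss_conv_nonneg[OF M t] gauss_conv_nonneg[OF N t]])
  finally have eq: "ennreal (gauss_mass TYPE('a) t) * (\<integral>\<^sup>+z. ennreal (exp (- t * (dist (fst z) (snd z))\<^sup>2)) \<partial>(M \<Otimes>\<^sub>M N)) =
     (\<integral>\<^sup>+z. ennreal (gauss_conv t M z * gauss_conv t N z) \<partial>lborel)" .
  show i: "pair_integrable (\<lambda>\<rho>. exp (- t * \<rho>\<^sup>2)) M N"
    by (rule MN.P.integrable_const_bound[where B=1]) (use t in auto)
  have nn: "(\<integral>\<^sup>+z. ennreal (exp (- t * (dist (fst z) (snd z))\<^sup>2)) \<partial>(M \<Otimes>\<^sub>M N)) = ennreal (pair_int (\<lambda>\<rho>. exp (- t * \<rho>\<^sup>2)) M N)"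
    unfolding pair_int_def by (rule nn_integral_eq_integral[OF i]) auto
  have p: "0 \<le> pair_int (\<lambda>\<rho>. exp (- t * \<rho>\<^sup>2)) M N"
    unfolding pair_int_def by (intro integral_nonneg_AE) auto
  have eq': "(\<integral>\<^sup>+z. ennreal (gauss_conv t M z * gauss_conv t N z) \<partial>lborel) =
      ennreal (gauss_mass TYPE('a) t * pair_int (\<lambda>\<rho>. exp (- t * \<rho>\<^sup>2)) M N)"
    unfolding eq[symmetric] nn using gauss_mass_pos[OF t, where 'a='a] p by (intro ennreal_mult[symmetric]) auto
  have gg: "0 \<le> gauss_conv t M z * gauss_conv t N z" for z
    using gauss_conv_nonneg[OF M t] gauss_conv_nonneg[OF N t] by (intro mult_nonneg_nonneg) auto
  show int: "integrable lborel (\<lambda>z. gauss_conv t M z * gauss_conv t N z)"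
    by (rule integrableI_nonneg) (use gg eq' in auto)
  have "ennreal (gauss_mass TYPE('a) t * pair_int (\<lambda>\<rho>. exp (- t * \<rho>\<^sup>2)) M N) = ennreal (\<integral>z. gauss_conv t M z * gauss_conv t N z \<partial>lborel)"
    unfolding eq'[symmetric] by (rule nn_integral_eq_integral[OF int]) (use gg in auto)
  then show "gauss_mass TYPE('a) t * pair_int (\<lambda>\<rho>. exp (- t * \<rho>\<^sup>2)) M N = (\<integral>z. gauss_conv t M z * gauss_conv t N z \<partial>lborel)"
    using p gauss_mass_pos[OF t, where 'a='a] gg by (subst (asm) ennreal_inj) (auto intro!: integral_nonneg_AE mult_nonneg_nonneg)
qed

lemma defect_gauss:
  fixes M N :: "'a::euclidean_space measure"
  assumes M: "prob_space M" "sets M = sets borel" and N: "prob_space N" "sets N = sets borel" and t: "t > 0"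
  shows "gauss_mass TYPE('a) t * defect (\<lambda>\<rho>. exp (- t * \<rho>\<^sup>2)) M N = (\<integral>z. (gauss_conv t M z - gauss_conv t N z)\<^sup>2 \<partial>lborel)"
    and "integrable lborel (\<lambda>z. (gauss_conv t M z - gauss_conv t N z)\<^sup>2)"
proof -
  note i = pair_int_gauss(1)[OF M M t] pair_int_gauss(1)[OF N N t] pair_int_gauss(1)[OF M N t]
  have sq: "(\<lambda>z. (gauss_conv t M z - gauss_conv t N z)\<^sup>2) = (\<lambda>z. gauss_conv t M z * gauss_conv t M z + gauss_conv t N z * gauss_conv t N z
     - 2 * (gauss_conv t M z * gauss_conv t N z))"
    by (auto simp: power2_eq_square algebra_simps)
  show "integrable lborel (\<lambda>z. (gauss_conv t M z - gauss_conv t N z)\<^sup>2)"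
    unfolding sq using i by (intro Bochner_Integration.integrable_diff Bochner_Integration.integrable_add integrable_mult_right) auto
  show "gauss_mass TYPE('a) t * defect (\<lambda>\<rho>. exp (- t * \<rho>\<^sup>2)) M N = (\<integral>z. (gauss_conv t M z - gauss_conv t N z)\<^sup>2 \<partial>lborel)"
    unfolding sq defect_def using i pair_int_gauss(3)[OF M M t] pair_int_gauss(3)[OF N N t] pair_int_gauss(3)[OF M N t]
    by (simp add: distrib_left right_diff_distrib)
qed

lemma defect_gauss_nonneg:
  fixes M N :: "'a::euclidean_space measure"
  assumes M: "prob_space M" "sets M = sets borel" and N: "prob_space N" "sets N = sets borel" and t: "t > 0"
  shows "defect (\<lambda>\<rho>. exp (- t * \<rho>\<^sup>2)) M N \<ge> 0"
proof -
  have "gauss_mass TYPE('a) t * defect (\<lambda>\<rho>. exp (- t * \<rho>\<^sup>2)) M N \<ge> 0"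
    unfolding defect_gauss(1)[OF assms] by (intro integral_nonneg_AE) auto
  then show ?thesis using gauss_mass_pos[OF t, where 'a='a] by (simp add: zero_le_mult_iff)
qed

lemma gauss_conv_eq_AE:
  fixes M N :: "'a::euclidean_space measure"
  assumes M: "prob_space M" "sets M = sets borel" and N: "prob_space N" "sets N = sets borel" and t: "t > 0"
    and z: "defect (\<lambda>\<rho>. exp (- t * \<rho>\<^sup>2)) M N = 0"
  shows "AE z in lborel. gauss_conv t M z = gauss_conv t N z"
proof -
  have "(\<integral>z. (gauss_conv t M z - gauss_conv t N z)\<^sup>2 \<partial>lborel) = 0"
    using defect_gauss(1)[OF M N t] z by simp
  then have "AE z in lborel. (gauss_conv t M z - gauss_conv t N z)\<^sup>2 = 0"
    by (subst (asm) integral_nonneg_eq_0_iff_AE[OF defect_gauss(2)[OF M N t]]) auto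
  then show ?thesis by eventually_elim simp
qed

text \<open>The dual of \<open>gauss_conv\<close>: smoothing the test function \<open>f\<close> instead of the measure, without the
normalisation. The width \<open>c\<close> corresponds to \<open>t = 1 / c\<^sup>2\<close>.\<close>

definition gauss_smooth :: "('a::euclidean_space \<Rightarrow> real) \<Rightarrow> real \<Rightarrow> 'a \<Rightarrow> real" where
  "gauss_smooth f c x = (\<integral>w. f (x + c *\<^sub>R w) * exp (- 2 * (norm w)\<^sup>2) \<partial>lborel)"

lemma
  fixes f :: "'a::euclidean_space \<Rightarrow> real"
  assumes f: "continuous_on UNIV f" and bd: "\<And>x. 0 \<le> f x \<and> f x \<le> 1"
  shows gauss_smooth_integrable: "integrable lborel (\<lambda>w. f (x + c *\<^sub>R w) * exp (- 2 * (norm w)\<^sup>2))"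
    and gauss_smooth_nonneg: "0 \<le> gauss_smooth f c x"
    and gauss_smooth_bound: "gauss_smooth f c x \<le> (\<integral>w. exp (- 2 * (norm w)\<^sup>2) \<partial>(lborel :: 'a measure))"
    and gauss_smooth_measurable: "gauss_smooth f c \<in> borel_measurable borel"
proof -
  have [measurable]: "f \<in> borel_measurable borel" using f by (rule borel_measurable_continuous_onI)
  have g: "integrable (lborel :: 'a measure) (\<lambda>w. exp (- 2 * (norm w)\<^sup>2))"
    using integrable_gaussian[of 2 "0::'a"] by simp
  show i: "integrable lborel (\<lambda>w. f (x + c *\<^sub>R w) * exp (- 2 * (norm w)\<^sup>2))"
  proof (rule Bochner_Integration.integrable_bound[OF g])
    show "AE w in lborel. norm (f (x + c *\<^sub>R w) * exp (- 2 * (norm w)\<^sup>2)) \<le> norm (exp (- 2 * (norm w)\<^sup>2))"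
      using bd by (intro AE_I2) (simp add: abs_mult mult_left_le_one_le)
  qed measurable
  show "0 \<le> gauss_smooth f c x" unfolding gauss_smooth_def using bd by (intro integral_nonneg_AE AE_I2 mult_nonneg_nonneg) auto
  show "gauss_smooth f c x \<le> (\<integral>w. exp (- 2 * (norm w)\<^sup>2) \<partial>(lborel :: 'a measure))"
    unfolding gauss_smooth_def using bd by (intro integral_mono i g) (simp add: mult_left_le_one_le)
  show "gauss_smooth f c \<in> borel_measurable borel" unfolding gauss_smooth_def by measurable
qed

lemma gauss_smooth_tendsto:
  fixes f :: "'a::euclidean_space \<Rightarrow> real"
  assumes f: "continuous_on UNIV f" and bd: "\<And>x. 0 \<le> f x \<and> f x \<le> 1" and c: "c \<longlonglongrightarrow> 0"
  shows "(\<lambda>n. gauss_smooth f (c n) x) \<longlonglongrightarrow> f x * (\<integral>w. exp (- 2 * (norm w)\<^sup>2) \<partial>(lborel :: 'a measure))"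
proof -
  have [measurable]: "f \<in> borel_measurable borel" using f by (rule borel_measurable_continuous_onI)
  have g: "integrable (lborel :: 'a measure) (\<lambda>w. exp (- 2 * (norm w)\<^sup>2))"
    using integrable_gaussian[of 2 "0::'a"] by simp
  have "(\<lambda>n. \<integral>w. f (x + c n *\<^sub>R w) * exp (- 2 * (norm w)\<^sup>2) \<partial>lborel) \<longlonglongrightarrow> (\<integral>w. f x * exp (- 2 * (norm w)\<^sup>2) \<partial>(lborel :: 'a measure))"
  proof (rule integral_dominated_convergence[where w="\<lambda>w. exp (- 2 * (norm w)\<^sup>2)"])
    show "integrable (lborel :: 'a measure) (\<lambda>w. exp (- 2 * (norm w)\<^sup>2))" by (rule g)
    show "AE w in lborel. (\<lambda>n. f (x + c n *\<^sub>R w) * exp (- 2 * (norm w)\<^sup>2)) \<longlonglongrightarrow> f x * exp (- 2 * (norm w)\<^sup>2)"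
    proof (rule AE_I2)
      fix w :: 'a
      have "(\<lambda>n. x + c n *\<^sub>R w) \<longlonglongrightarrow> x + 0 *\<^sub>R w" by (intro tendsto_intros c)
      then have "(\<lambda>n. f (x + c n *\<^sub>R w)) \<longlonglongrightarrow> f x"
        using f by (intro isCont_tendsto_compose[of _ f]) (auto simp: continuous_on_eq_continuous_at)
      then show "(\<lambda>n. f (x + c n *\<^sub>R w) * exp (- 2 * (norm w)\<^sup>2)) \<longlonglongrightarrow> f x * exp (- 2 * (norm w)\<^sup>2)"
        by (intro tendsto_intros)
    qed
    show "AE w in lborel. norm (f (x + c n *\<^sub>R w) * exp (- 2 * (norm w)\<^sup>2)) \<le> exp (- 2 * (norm w)\<^sup>2)" for n
      using bd by (intro AE_I2) (simp add: abs_mult mult_left_le_one_le)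
  qed measurable
  then show ?thesis unfolding gauss_smooth_def by simp
qed

lemma nn_integral_gauss_conv_smooth:
  fixes M :: "'a::euclidean_space measure"
  assumes M: "prob_space M" "sets M = sets borel" and c: "c > 0" and t: "t = 1 / c\<^sup>2"
    and f: "continuous_on UNIV f" and bd: "\<And>x. 0 \<le> f x \<and> f x \<le> 1"
  shows "(\<integral>\<^sup>+z. ennreal (f z) * ennreal (gauss_conv t M z) \<partial>lborel) =
    ennreal (c ^ DIM('a)) * ennreal (\<integral>x. gauss_smooth f c x \<partial>M)"
proof -
  interpret M: prob_space M by fact
  interpret Mlb: pair_sigma_finite M "lborel :: 'a measure" ..
  note [measurable_cong] = M(2)
  have [measurable]: "f \<in> borel_measurable borel" using f by (rule borel_measurable_continuous_onI)
  note [measurable] = gauss_smooth_measurable[OF f bd]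
  have t0: "t > 0" using c t by simp
  have "(\<integral>\<^sup>+z. ennreal (f z) * ennreal (gauss_conv t M z) \<partial>lborel) =
     (\<integral>\<^sup>+z. (\<integral>\<^sup>+x. ennreal (f z) * ennreal (exp (- (2 * t) * (norm (x - z))\<^sup>2)) \<partial>M) \<partial>lborel)"
    by (simp only: nn_integral_gauss_conv[OF M t0, symmetric]) (simp add: nn_integral_cmult)
  also have "\<dots> = (\<integral>\<^sup>+x. (\<integral>\<^sup>+z. ennreal (f z) * ennreal (exp (- (2 * t) * (norm (x - z))\<^sup>2)) \<partial>lborel) \<partial>M)"
    by (intro Mlb.Fubini') measurable
  also have "\<dots> = (\<integral>\<^sup>+x. ennreal (c ^ DIM('a)) * ennreal (gauss_smooth f c x) \<partial>M)"
  proof (rule nn_integral_cong)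
    fix x :: 'a
    have "(\<integral>\<^sup>+z. ennreal (f z) * ennreal (exp (- (2 * t) * (norm (x - z))\<^sup>2)) \<partial>lborel) =
       ennreal (\<bar>c\<bar> ^ DIM('a)) * (\<integral>\<^sup>+w. ennreal (f (x + c *\<^sub>R w)) * ennreal (exp (- (2 * t) * (norm (x - (x + c *\<^sub>R w)))\<^sup>2)) \<partial>lborel)"
      using c by (intro nn_integral_lborel_affine) auto
    also have "(\<integral>\<^sup>+w. ennreal (f (x + c *\<^sub>R w)) * ennreal (exp (- (2 * t) * (norm (x - (x + c *\<^sub>R w)))\<^sup>2)) \<partial>lborel) =
        (\<integral>\<^sup>+w. ennreal (f (x + c *\<^sub>R w) * exp (- 2 * (norm w)\<^sup>2)) \<partial>lborel)"
    proof (rule nn_integral_cong)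
      fix w :: 'a
      have "- (2 * t) * (norm (x - (x + c *\<^sub>R w)))\<^sup>2 = - 2 * (norm w)\<^sup>2"
        using c by (simp add: t power_mult_distrib)
      then show "ennreal (f (x + c *\<^sub>R w)) * ennreal (exp (- (2 * t) * (norm (x - (x + c *\<^sub>R w)))\<^sup>2)) =
          ennreal (f (x + c *\<^sub>R w) * exp (- 2 * (norm w)\<^sup>2))"
        using bd by (simp only: ennreal_mult exp_ge_zero)
    qed
    also have "\<dots> = ennreal (gauss_smooth f c x)"
      unfolding gauss_smooth_def using bd
      by (intro nn_integral_eq_integral gauss_smooth_integrable f bd) auto
    finally show "(\<integral>\<^sup>+z. ennreal (f z) * ennreal (exp (- (2 * t) * (norm (x - z))\<^sup>2)) \<partial>lborel) =
       ennreal (c ^ DIM('a)) * ennreal (gauss_smooth f c x)" using c by simp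
  qed
  also have "\<dots> = ennreal (c ^ DIM('a)) * (\<integral>\<^sup>+x. ennreal (gauss_smooth f c x) \<partial>M)"
    by (rule nn_integral_cmult) measurable
  also have "(\<integral>\<^sup>+x. ennreal (gauss_smooth f c x) \<partial>M) = ennreal (\<integral>x. gauss_smooth f c x \<partial>M)"
  proof (rule nn_integral_eq_integral)
    show "integrable M (gauss_smooth f c)"
      by (rule M.integrable_const_bound[where B="\<integral>w. exp (- 2 * (norm w)\<^sup>2) \<partial>(lborel :: 'a measure)"])
         (use gauss_smooth_nonneg[OF f bd] gauss_smooth_bound[OF f bd] in auto)
  qed (use gauss_smooth_nonneg[OF f bd] in auto)
  finally show ?thesis .
qed

text \<open>The smoothed measures agree for widths tending to \<open>0\<close>. Tested against a continuous function, the
smoothing can be moved to the test function, which converges to a multiple of itself.\<close>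

lemma measure_eq_if_defect_gauss_zero:
  fixes M N :: "'a::euclidean_space measure"
  assumes M: "prob_space M" "sets M = sets borel" and N: "prob_space N" "sets N = sets borel"
    and t: "\<And>n. t n > real n" and z: "\<And>n::nat. defect (\<lambda>\<rho>. exp (- t n * \<rho>\<^sup>2)) M N = 0"
  shows "M = N"
proof (rule finite_measure_eqI_continuous)
  interpret M: prob_space M by fact
  interpret N: prob_space N by fact
  note [measurable_cong] = M(2) N(2)
  fix f :: "'a \<Rightarrow> real" assume f: "continuous_on UNIV f" and bd: "\<And>x. 0 \<le> f x \<and> f x \<le> 1"
  define K where "K = (\<integral>w. exp (- 2 * (norm w)\<^sup>2) \<partial>(lborel :: 'a measure))"
  have K: "K > 0" unfolding K_def using gaussian_integral_pos[of 2 "0::'a"] by simp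
  have t0: "t n > 0" for n using t[of n] of_nat_0_le_iff[of n] by (rule le_less_trans[rotated])
  define c where "c n = 1 / sqrt (t n)" for n
  have c: "c n > 0" "t n = 1 / (c n)\<^sup>2" for n using t0[of n] by (auto simp: c_def power_divide)
  have "filterlim t at_top sequentially"
    by (rule filterlim_at_top_mono[OF filterlim_real_sequentially]) (intro always_eventually allI less_imp_le t)
  then have c0: "c \<longlonglongrightarrow> 0"
    unfolding c_def by (intro tendsto_divide_0[OF tendsto_const] filterlim_at_top_imp_at_infinity filterlim_compose[OF sqrt_at_top])
  have eq: "(\<integral>x. gauss_smooth f (c n) x \<partial>M) = (\<integral>x. gauss_smooth f (c n) x \<partial>N)" for n
  proof -
    have "ennreal (c n ^ DIM('a)) * ennreal (\<integral>x. gauss_smooth f (c n) x \<partial>M) =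
        ennreal (c n ^ DIM('a)) * ennreal (\<integral>x. gauss_smooth f (c n) x \<partial>N)"
      unfolding nn_integral_gauss_conv_smooth[OF M c f bd, symmetric] nn_integral_gauss_conv_smooth[OF N c f bd, symmetric]
    proof (rule nn_integral_cong_AE)
      show "AE x in lborel. ennreal (f x) * ennreal (gauss_conv (t n) M x) = ennreal (f x) * ennreal (gauss_conv (t n) N x)"
        using gauss_conv_eq_AE[OF M N t0[of n] z[of n]] by eventually_elim simp
    qed
    then show ?thesis
      using c(1)[of n] gauss_smooth_nonneg[OF f bd]
      by (auto simp: ennreal_mult_cancel_left intro!: integral_nonneg_AE)
  qed
  have lim: "(\<lambda>n. \<integral>x. gauss_smooth f (c n) x \<partial>L) \<longlonglongrightarrow> (\<integral>x. f x * K \<partial>L)"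
    if L: "prob_space L" "sets L = sets borel" for L :: "'a measure"
  proof -
    interpret L: prob_space L by fact
    note [measurable_cong] = L(2)
    have [measurable]: "f \<in> borel_measurable borel" using f by (rule borel_measurable_continuous_onI)
    note [measurable] = gauss_smooth_measurable[OF f bd]
    show ?thesis
    proof (rule integral_dominated_convergence[where w="\<lambda>_. K"])
      show "AE x in L. (\<lambda>n. gauss_smooth f (c n) x) \<longlonglongrightarrow> f x * K"
        unfolding K_def using gauss_smooth_tendsto[OF f bd c0] by auto
      show "AE x in L. norm (gauss_smooth f (c n) x) \<le> K" for n
        unfolding K_def using gauss_smooth_nonneg[OF f bd] gauss_smooth_bound[OF f bd] by auto
    qed auto
  qed
  have "(\<integral>x. f x * K \<partial>M) = (\<integral>x. f x * K \<partial>N)"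
    using LIMSEQ_unique[OF lim[OF M, unfolded eq] lim[OF N]] .
  then show "(\<integral>x. f x \<partial>M) = (\<integral>x. f x \<partial>N)" using K by simp
qed (use M N in \<open>auto simp: prob_space_def\<close>)

text \<open>The kernel values \<open>k t \<rho>\<close>, mixed with weight \<open>w\<close>, give \<open>\<psi> \<rho>\<close>. The last condition says that the
integrand does not change sign; with it, integrability of \<open>\<psi>\<close> alone justifies Fubini's theorem for
the mixture.\<close>

definition mixes_to :: "(real \<Rightarrow> real) \<Rightarrow> (real \<Rightarrow> real \<Rightarrow> real) \<Rightarrow> (real \<Rightarrow> real) \<Rightarrow> real \<Rightarrow> bool" where
  "mixes_to w k \<psi> \<rho> \<longleftrightarrow> integrable lborel (\<lambda>t. w t * k t \<rho>) \<and> (\<integral>t. w t * k t \<rho> \<partial>lborel) = \<psi> \<rho> \<and>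
     (\<integral>t. norm (w t * k t \<rho>) \<partial>lborel) = \<bar>\<psi> \<rho>\<bar>"

text \<open>The terms \<open>p t\<close> and \<open>q t * \<rho>\<^sup>2\<close> are needed to make the mixture converge at \<open>t = 0\<close>.\<close>

lemma pair_int_mixture:
  fixes M N :: "'a::euclidean_space measure"
  assumes M: "prob_space M" "sets M = sets borel" and N: "prob_space N" "sets N = sets borel"
    and [measurable]: "w \<in> borel_measurable borel" "p \<in> borel_measurable borel" "q \<in> borel_measurable borel" "\<psi> \<in> borel_measurable borel"
    and w0: "\<And>t. t \<le> 0 \<Longrightarrow> w t = 0"
    and mix: "AE z in M \<Otimes>\<^sub>M N. mixes_to w (\<lambda>t \<rho>. exp (- t * \<rho>\<^sup>2) - p t - q t * \<rho>\<^sup>2) \<psi> (dist (fst z) (snd z))"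
    and \<psi>: "pair_integrable \<psi> M N" and sq: "pair_integrable (\<lambda>\<rho>. \<rho>\<^sup>2) M N"
  shows "integrable lborel (\<lambda>t. w t * (pair_int (\<lambda>\<rho>. exp (- t * \<rho>\<^sup>2)) M N - p t - q t * pair_int (\<lambda>\<rho>. \<rho>\<^sup>2) M N))"
    and "pair_int \<psi> M N = (\<integral>t. w t * (pair_int (\<lambda>\<rho>. exp (- t * \<rho>\<^sup>2)) M N - p t - q t * pair_int (\<lambda>\<rho>. \<rho>\<^sup>2) M N) \<partial>lborel)"
proof -
  interpret M: prob_space M by fact
  interpret N: prob_space N by fact
  interpret MN: pair_prob_space M N ..
  note [measurable_cong] = M(2) N(2)
  interpret L: pair_sigma_finite "M \<Otimes>\<^sub>M N" "lborel :: real measure" ..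
  let ?d = "\<lambda>z::'a \<times> 'a. dist (fst z) (snd z)"
  let ?k = "\<lambda>t \<rho>. exp (- t * \<rho>\<^sup>2) - p t - q t * \<rho>\<^sup>2"
  define f where "f = (\<lambda>(z, t). w t * ?k t (?d z))"
  have int: "integrable ((M \<Otimes>\<^sub>M N) \<Otimes>\<^sub>M lborel) f"
  proof (rule L.Fubini_integrable)
    show "f \<in> borel_measurable ((M \<Otimes>\<^sub>M N) \<Otimes>\<^sub>M lborel)" unfolding f_def by measurable
    have "integrable (M \<Otimes>\<^sub>M N) (\<lambda>z. \<bar>\<psi> (?d z)\<bar>)" using \<psi> by (rule integrable_abs)
    then show "integrable (M \<Otimes>\<^sub>M N) (\<lambda>z. \<integral>t. norm (f (z, t)) \<partial>lborel)"
    proof (rule integrable_cong_AE_imp)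
      show "(\<lambda>z. \<integral>t. norm (f (z, t)) \<partial>lborel) \<in> borel_measurable (M \<Otimes>\<^sub>M N)" unfolding f_def by measurable
      show "AE z in M \<Otimes>\<^sub>M N. \<bar>\<psi> (?d z)\<bar> = (\<integral>t. norm (f (z, t)) \<partial>lborel)"
        using mix by eventually_elim (simp add: mixes_to_def f_def)
    qed
    show "AE z in M \<Otimes>\<^sub>M N. integrable lborel (\<lambda>t. f (z, t))"
      using mix by eventually_elim (simp add: mixes_to_def f_def)
  qed
  have inner: "(\<integral>z. f (z, t) \<partial>(M \<Otimes>\<^sub>M N)) = w t * (pair_int (\<lambda>\<rho>. exp (- t * \<rho>\<^sup>2)) M N - p t - q t * pair_int (\<lambda>\<rho>. \<rho>\<^sup>2) M N)" for t
  proof (cases "t > 0")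
    case False
    then show ?thesis by (simp add: f_def w0)
  next
    case True
    have "(\<integral>z. exp (- t * (?d z)\<^sup>2) - p t - q t * (?d z)\<^sup>2 \<partial>(M \<Otimes>\<^sub>M N)) =
        (\<integral>z. exp (- t * (?d z)\<^sup>2) \<partial>(M \<Otimes>\<^sub>M N)) - p t - q t * (\<integral>z. (?d z)\<^sup>2 \<partial>(M \<Otimes>\<^sub>M N))"
      using pair_int_gauss(2)[OF M N True] sq
      by (simp add: MN.P.prob_space[unfolded space_pair_measure] space_pair_measure)
    then show ?thesis unfolding f_def pair_int_def by simp
  qed
  have "integrable lborel (\<lambda>t. \<integral>z. f (z, t) \<partial>(M \<Otimes>\<^sub>M N))"
    using L.integrable_snd[of "\<lambda>z t. f (z, t)"] int by (simp add: case_prod_beta)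
  then show "integrable lborel (\<lambda>t. w t * (pair_int (\<lambda>\<rho>. exp (- t * \<rho>\<^sup>2)) M N - p t - q t * pair_int (\<lambda>\<rho>. \<rho>\<^sup>2) M N))"
    unfolding inner .
  have "pair_int \<psi> M N = (\<integral>z. (\<integral>t. f (z, t) \<partial>lborel) \<partial>(M \<Otimes>\<^sub>M N))"
    unfolding pair_int_def
  proof (rule integral_cong_AE)
    show "AE z in M \<Otimes>\<^sub>M N. \<psi> (?d z) = (\<integral>t. f (z, t) \<partial>lborel)"
      using mix by eventually_elim (simp add: mixes_to_def f_def)
    show "(\<lambda>z. \<integral>t. f (z, t) \<partial>lborel) \<in> borel_measurable (M \<Otimes>\<^sub>M N)" unfolding f_def by measurable
  qed measurable
  also have "\<dots> = (\<integral>t. (\<integral>z. f (z, t) \<partial>(M \<Otimes>\<^sub>M N)) \<partial>lborel)"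
    by (rule L.Fubini_integral[symmetric]) (use int in \<open>simp add: case_prod_beta\<close>)
  finally show "pair_int \<psi> M N = (\<integral>t. w t * (pair_int (\<lambda>\<rho>. exp (- t * \<rho>\<^sup>2)) M N - p t - q t * pair_int (\<lambda>\<rho>. \<rho>\<^sup>2) M N) \<partial>lborel)"
    unfolding inner .
qed

text \<open>For probability measures with second moments, \<open>defect\<close> of the squared distance is \<open>-2\<close> times the
squared distance between the means; thus \<open>defect_sq\<close> says that the means agree.\<close>

locale same_mean =
  fixes M N :: "'a::euclidean_space measure"
  assumes M: "prob_space M" "sets M = sets borel" and N: "prob_space N" "sets N = sets borel"
    and sq: "pair_integrable (\<lambda>\<rho>. \<rho>\<^sup>2) M M" "pair_integrable (\<lambda>\<rho>. \<rho>\<^sup>2) N N" "pair_integrable (\<lambda>\<rho>. \<rho>\<^sup>2) M N"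
    and defect_sq: "defect (\<lambda>\<rho>. \<rho>\<^sup>2) M N = 0"
begin

definition all_integrable where
  "all_integrable \<psi> \<longleftrightarrow> pair_integrable \<psi> M M \<and> pair_integrable \<psi> N N \<and> pair_integrable \<psi> M N"

text \<open>The renormalising terms \<open>p\<close> and \<open>q\<close> cancel in the combination that defines \<open>defect\<close>, so that \<open>defect\<close> of
the mixture is the mixture of the nonnegative Gaussian defects. If it vanishes, almost all Gaussian defects
vanish, in particular those for some sequence \<open>t\<close> tending to \<open>\<infinity>\<close>.\<close>

lemma defect_mixture:
  assumes meas: "w \<in> borel_measurable borel" "p \<in> borel_measurable borel" "q \<in> borel_measurable borel" "\<psi> \<in> borel_measurable borel"
    and w0: "\<And>t. t \<le> 0 \<Longrightarrow> w t = 0" and w: "\<And>t. t > 0 \<Longrightarrow> w t > 0"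
    and mix: "\<And>A B. (A, B) \<in> {(M, M), (N, N), (M, N)} \<Longrightarrow>
      AE z in A \<Otimes>\<^sub>M B. mixes_to w (\<lambda>t \<rho>. exp (- t * \<rho>\<^sup>2) - p t - q t * \<rho>\<^sup>2) \<psi> (dist (fst z) (snd z))"
    and \<psi>: "all_integrable \<psi>"
  shows "defect \<psi> M N \<ge> 0" and "defect \<psi> M N = 0 \<Longrightarrow> M = N"
proof -
  let ?g = "\<lambda>t A B. pair_int (\<lambda>\<rho>. exp (- t * \<rho>\<^sup>2)) A B"
  let ?s = "\<lambda>A B. pair_int (\<lambda>\<rho>. \<rho>\<^sup>2) A B"
  let ?h = "\<lambda>A B t. w t * (?g t A B - p t - q t * ?s A B)"
  let ?D = "\<lambda>t. w t * defect (\<lambda>\<rho>. exp (- t * \<rho>\<^sup>2)) M N"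
  have \<psi>': "pair_integrable \<psi> M M" "pair_integrable \<psi> N N" "pair_integrable \<psi> M N"
    using \<psi> by (auto simp: all_integrable_def)
  note 1 = pair_int_mixture[OF M M meas w0 mix \<psi>'(1) sq(1), simplified]
  note 2 = pair_int_mixture[OF N N meas w0 mix \<psi>'(2) sq(2), simplified]
  note 3 = pair_int_mixture[OF M N meas w0 mix \<psi>'(3) sq(3), simplified]
  have D: "?D t = ?h M M t + ?h N N t - 2 * ?h M N t" for t
  proof -
    have e: "a * (x + y - 2 * z) = a * (x - b - c * u) + a * (y - b - c * v) - 2 * (a * (z - b - c * s))"
      if "u + v - 2 * s = 0" for a b c x y z u v s :: real
    proof -
      have u: "u = 2 * s - v" using that by simp
      show ?thesis unfolding u by (simp add: algebra_simps)
    qed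
    show ?thesis using defect_sq unfolding defect_def by (rule e)
  qed
  have i: "integrable lborel ?D"
    unfolding D using 1(1) 2(1) 3(1)
    by (intro Bochner_Integration.integrable_diff Bochner_Integration.integrable_add integrable_mult_right) auto
  have "(\<integral>t. ?D t \<partial>lborel) = (\<integral>t. ?h M M t + ?h N N t - 2 * ?h M N t \<partial>lborel)"
    by (simp only: D)
  also have "\<dots> = defect \<psi> M N"
    unfolding defect_def 1(2) 2(2) 3(2) using 1(1) 2(1) 3(1) by simp
  finally have eq: "(\<integral>t. ?D t \<partial>lborel) = defect \<psi> M N" .
  have nn: "?D t \<ge> 0" for t
  proof (cases "t > 0")
    case True
    then show ?thesis using w[OF True] defect_gauss_nonneg[OF M N True] by simp
  qed (simp add: w0)
  show "defect \<psi> M N \<ge> 0" unfolding eq[symmetric] using nn by (intro integral_nonneg_AE) auto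
  assume "defect \<psi> M N = 0"
  then have "AE t in lborel. ?D t = 0"
    using eq nn by (subst integral_nonneg_eq_0_iff_AE[OF i, symmetric]) auto
  then have ae: "AE t in lborel. t > 0 \<longrightarrow> defect (\<lambda>\<rho>. exp (- t * \<rho>\<^sup>2)) M N = 0"
  proof eventually_elim
    case (elim t)
    then show ?case using w[of t] by auto
  qed
  have "\<exists>t > real n. defect (\<lambda>\<rho>. exp (- t * \<rho>\<^sup>2)) M N = 0" for n :: nat
  proof (rule ccontr)
    assume no: "\<not> ?thesis"
    have "AE t in lborel. t \<notin> {real n<..<real n + 1}"
      using ae
    proof eventually_elim
      case (elim t)
      then show ?case using no by auto
    qed
    then have "{real n<..<real n + 1} \<in> null_sets lborel"
      by (subst AE_iff_null_sets) auto
    then show False by (simp add: null_sets_def)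
  qed
  then obtain t where "\<And>n::nat. t n > real n \<and> defect (\<lambda>\<rho>. exp (- t n * \<rho>\<^sup>2)) M N = 0" by metis
  then show "M = N" using measure_eq_if_defect_gauss_zero[OF M N, of t] by blast
qed

end

section \<open>Power kernels as mixtures of Gaussians\<close>

lemma mixes_toI_nn:
  assumes [measurable]: "(\<lambda>t. w t * k t \<rho>) \<in> borel_measurable borel" and s: "s \<in> {1, -1}"
    and nn: "\<And>t. 0 \<le> s * (w t * k t \<rho>)" and psi: "0 \<le> s * \<psi> \<rho>"
    and eq: "(\<integral>\<^sup>+t. ennreal (s * (w t * k t \<rho>)) \<partial>lborel) = ennreal (s * \<psi> \<rho>)"
  shows "mixes_to w k \<psi> \<rho>"
proof -
  have i: "integrable lborel (\<lambda>t. s * (w t * k t \<rho>))"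
    by (rule integrableI_nonneg) (use nn eq in auto)
  have "ennreal (\<integral>t. s * (w t * k t \<rho>) \<partial>lborel) = ennreal (s * \<psi> \<rho>)"
    using nn_integral_eq_integral[OF i AE_I2[OF nn]] eq by simp
  moreover have "0 \<le> (\<integral>t. s * (w t * k t \<rho>) \<partial>lborel)" by (intro integral_nonneg_AE AE_I2 nn)
  ultimately have v: "(\<integral>t. s * (w t * k t \<rho>) \<partial>lborel) = s * \<psi> \<rho>"
    using psi by (simp only: ennreal_inj)
  have ss: "s * s = 1" "s \<noteq> 0" using s by auto
  have "integrable lborel (\<lambda>t. s * (s * (w t * k t \<rho>)))" by (rule integrable_mult_right[OF i])
  then have i': "integrable lborel (\<lambda>t. w t * k t \<rho>)" by (simp only: mult.assoc[symmetric] ss mult_1)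
  have n: "norm (w t * k t \<rho>) = s * (w t * k t \<rho>)" for t using nn[of t] s by auto
  have "(\<integral>t. norm (w t * k t \<rho>) \<partial>lborel) = s * \<psi> \<rho>" unfolding n v ..
  moreover have "s * \<psi> \<rho> = \<bar>\<psi> \<rho>\<bar>" using psi s by auto
  moreover have "(\<integral>t. w t * k t \<rho> \<partial>lborel) = \<psi> \<rho>" using v ss by simp
  ultimately show ?thesis unfolding mixes_to_def using i' by simp
qed

definition pow_weight :: "real \<Rightarrow> real \<Rightarrow> real" where
  "pow_weight \<gamma> t = (if t > 0 then t powr (- 1 - \<gamma> / 2) else 0)"

lemma pow_weight_measurable [measurable]: "pow_weight \<gamma> \<in> borel_measurable borel"
  unfolding pow_weight_def[abs_def] by measurable

lemma exp_remainder_bounds: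
  fixes t :: real
  assumes "t > 0"
  shows "0 < exp (- t) - 1 + t" "exp (- t) - 1 + t \<le> t" "exp (- t) - 1 + t \<le> t\<^sup>2"
proof -
  show "0 < exp (- t) - 1 + t" using exp_minus_greater[of t] assms by simp
  show "exp (- t) - 1 + t \<le> t" using assms by simp
  have "exp (- t) = 1 / exp t" by (simp add: exp_minus divide_inverse)
  also have "\<dots> \<le> 1 / (1 + t)" using assms by (intro divide_left_mono) auto
  finally have "exp (- t) - 1 + t \<le> 1 / (1 + t) - 1 + t" by simp
  also have "\<dots> = t * t / (1 + t)" using assms by (simp add: field_simps)
  also have "\<dots> \<le> t * t" using assms mult_left_mono[of 1 "1 + t" "t * t"] by (simp add: divide_le_eq)
  finally show "exp (- t) - 1 + t \<le> t\<^sup>2" by (simp add: power2_eq_square)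
qed

lemma ennreal_mult3:
  assumes "0 \<le> a" "0 \<le> b" "0 \<le> c"
  shows "ennreal \<bar>a\<bar> * (ennreal b * ennreal c) = ennreal (a * (b * c))"
proof -
  have "ennreal (a * (b * c)) = ennreal a * ennreal (b * c)"
    by (rule ennreal_mult) (use assms in \<open>auto intro: mult_nonneg_nonneg\<close>)
  also have "ennreal (b * c) = ennreal b * ennreal c" by (rule ennreal_mult) (use assms in auto)
  finally show ?thesis using assms by simp
qed

lemma powr_scale:
  fixes r t q :: real
  assumes r: "r > 0" and t: "t > 0"
  shows "(1 / r\<^sup>2 * t) powr q = r powr (- 2 * q) * t powr q"
proof -
  have "1 / r\<^sup>2 = r powr (- 2)" using r by (simp add: powr_minus divide_inverse)
  then have "(1 / r\<^sup>2 * t) powr q = (r powr (- 2) * t) powr q" by (simp only:)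
  also have "\<dots> = (r powr (- 2)) powr q * t powr q" by (rule powr_mult)
  finally show ?thesis unfolding powr_powr .
qed

text \<open>For \<open>2 < \<alpha> < 4\<close> the Taylor remainder \<open>exp (- t) - 1 + t\<close> is integrable against
\<open>t powr (- 1 - \<alpha> / 2)\<close>: it is of order \<open>t\<^sup>2\<close> at \<open>0\<close> and of order \<open>t\<close> at \<open>\<infinity>\<close>. The substitution
\<open>t \<mapsto> t / \<rho>\<^sup>2\<close> shows that the integral is proportional to \<open>\<rho> powr \<alpha>\<close>. Positivity of the constant of proportionality is all that enters later.\<close>

lemma power_mixture_high:
  assumes \<alpha>: "2 < \<alpha>" "\<alpha> < 4"
  shows "\<exists>c>0. \<forall>\<rho>\<ge>0. mixes_to (pow_weight \<alpha>) (\<lambda>t \<rho>. exp (- t * \<rho>\<^sup>2) - 1 - (- t) * \<rho>\<^sup>2) (\<lambda>\<rho>. c * \<rho> powr \<alpha>) \<rho>"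
proof -
  let ?w = "pow_weight \<alpha>"
  let ?k = "\<lambda>t \<rho> :: real. exp (- t * \<rho>\<^sup>2) - 1 - (- t) * \<rho>\<^sup>2"
  define J where "J \<rho> = (\<integral>\<^sup>+t. ennreal (?w t * ?k t \<rho>) \<partial>lborel)" for \<rho>
  have nn: "0 \<le> ?w t * ?k t \<rho>" for t \<rho>
  proof -
    have "?k t \<rho> \<ge> 0" using exp_ge_add_one_self[of "- t * \<rho>\<^sup>2"] by simp
    then show ?thesis by (simp add: pow_weight_def)
  qed
  have "J 1 < \<infinity>"
  proof -
    have "J 1 \<le> (\<integral>\<^sup>+t. ennreal (t powr (1 - \<alpha> / 2)) * indicator {0..1} t + ennreal (t powr (- \<alpha> / 2)) * indicator {1..} t \<partial>lborel)"
      unfolding J_def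
    proof (rule nn_integral_mono)
      fix t :: real
      show "ennreal (?w t * ?k t 1) \<le> ennreal (t powr (1 - \<alpha> / 2)) * indicator {0..1} t + ennreal (t powr (- \<alpha> / 2)) * indicator {1..} t"
      proof (cases "t > 0")
        case True
        note b = exp_remainder_bounds[OF True]
        show ?thesis
        proof (cases "t \<le> 1")
          case le: True
          have "?w t * ?k t 1 \<le> t powr (- 1 - \<alpha> / 2) * t powr 2"
            using b True by (auto simp: pow_weight_def intro!: mult_left_mono)
          also have "\<dots> = t powr (1 - \<alpha> / 2)" unfolding powr_add[symmetric] by simp
          finally have "ennreal (?w t * ?k t 1) \<le> ennreal (t powr (1 - \<alpha> / 2))" by (rule ennreal_leI)
          also have "\<dots> \<le> ennreal (t powr (1 - \<alpha> / 2)) * indicator {0..1} t + ennreal (t powr (- \<alpha> / 2)) * indicator {1..} t"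
            using True le by simp
          finally show ?thesis .
        next
          case gt: False
          have "?w t * ?k t 1 \<le> t powr (- 1 - \<alpha> / 2) * t powr 1"
            using b True by (auto simp: pow_weight_def intro!: mult_left_mono)
          also have "\<dots> = t powr (- \<alpha> / 2)" unfolding powr_add[symmetric] by simp
          finally have "ennreal (?w t * ?k t 1) \<le> ennreal (t powr (- \<alpha> / 2))" by (rule ennreal_leI)
          then show ?thesis using gt by simp
        qed
      qed (simp add: pow_weight_def)
    qed
    also have "\<dots> = (\<integral>\<^sup>+t. ennreal (t powr (1 - \<alpha> / 2)) * indicator {0..1} t \<partial>lborel) + (\<integral>\<^sup>+t. ennreal (t powr (- \<alpha> / 2)) * indicator {1..} t \<partial>lborel)"
      by (rule nn_integral_add) measurable
    also have "(\<integral>\<^sup>+t. ennreal (t powr (1 - \<alpha> / 2)) * indicator {0..1} t \<partial>lborel) = ennreal (1 powr (1 - \<alpha> / 2 + 1) / (1 - \<alpha> / 2 + 1))"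
      using \<alpha> by (intro nn_integral_has_integral_lebesgue' has_integral_powr_from_0) auto
    also have "(\<integral>\<^sup>+t. ennreal (t powr (- \<alpha> / 2)) * indicator {1..} t \<partial>lborel) = ennreal (0 - 1 powr (1 - \<alpha> / 2) / (1 - \<alpha> / 2))"
    proof (rule nn_integral_FTC_atLeast[where F="\<lambda>t. t powr (1 - \<alpha> / 2) / (1 - \<alpha> / 2)" and T=0])
      fix t :: real assume t: "1 \<le> t"
      have "((\<lambda>t. t powr (1 - \<alpha> / 2)) has_real_derivative (1 - \<alpha> / 2) * t powr (1 - \<alpha> / 2 - 1)) (at t)"
        using t by (intro has_real_derivative_powr) auto
      from DERIV_cdivide[OF this, of "1 - \<alpha> / 2"]
      show "((\<lambda>t. t powr (1 - \<alpha> / 2) / (1 - \<alpha> / 2)) has_real_derivative t powr (- \<alpha> / 2)) (at t)"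
        using \<alpha> by simp
    next
      have "((\<lambda>t::real. t powr (1 - \<alpha> / 2)) \<longlongrightarrow> 0) at_top"
        using \<alpha> by (intro tendsto_neg_powr filterlim_ident) auto
      then show "((\<lambda>t. t powr (1 - \<alpha> / 2) / (1 - \<alpha> / 2)) \<longlongrightarrow> 0) at_top"
        by (rule tendsto_divide_zero)
    qed auto
    finally show ?thesis by (rule le_less_trans) simp
  qed
  then obtain c where c: "J 1 = ennreal c" "c \<ge> 0" by (cases "J 1") auto
  have "c \<noteq> 0"
  proof
    assume "c = 0"
    then have "J 1 = 0" using c by simp
    then have "AE t in lborel. ennreal (?w t * ?k t 1) = 0"
      unfolding J_def by (subst (asm) nn_integral_0_iff_AE) auto
    then have "AE t in lborel. t \<notin> {0<..<1::real}"
    proof eventually_elim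
      case (elim t)
      show ?case
      proof
        assume t: "t \<in> {0<..<1}"
        then have "?w t * ?k t 1 > 0" using exp_remainder_bounds(1)[of t] by (simp add: pow_weight_def)
        then show False using elim by (simp only: ennreal_eq_0_iff not_le[symmetric])
      qed
    qed
    then have "{0<..<1::real} \<in> null_sets lborel" by (subst AE_iff_null_sets) auto
    then show False by (simp add: null_sets_def)
  qed
  then have cpos: "c > 0" using c by simp
  have "mixes_to ?w ?k (\<lambda>\<rho>. c * \<rho> powr \<alpha>) \<rho>" if \<rho>: "\<rho> \<ge> 0" for \<rho>
  proof (rule mixes_toI_nn[where s=1])
    have "J \<rho> = ennreal (c * \<rho> powr \<alpha>)"
    proof (cases "\<rho> = 0")
      case True
      then show ?thesis by (simp add: J_def)
    next
      case False
      then have \<rho>: "\<rho> > 0" using \<rho> by simp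
      have "J \<rho> = \<bar>1 / \<rho>\<^sup>2\<bar> * (\<integral>\<^sup>+t. ennreal (?w (0 + 1 / \<rho>\<^sup>2 * t) * ?k (0 + 1 / \<rho>\<^sup>2 * t) \<rho>) \<partial>lborel)"
        unfolding J_def using \<rho> by (intro nn_integral_real_affine) auto
      also have "(\<integral>\<^sup>+t. ennreal (?w (0 + 1 / \<rho>\<^sup>2 * t) * ?k (0 + 1 / \<rho>\<^sup>2 * t) \<rho>) \<partial>lborel) =
         (\<integral>\<^sup>+t. ennreal (\<rho> powr (2 + \<alpha>)) * ennreal (?w t * ?k t 1) \<partial>lborel)"
      proof (rule nn_integral_cong)
        fix t :: real
        have "?w (1 / \<rho>\<^sup>2 * t) = \<rho> powr (2 + \<alpha>) * ?w t"
        proof (cases "t > 0")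
          case True
          have "(1 / \<rho>\<^sup>2 * t) powr (- 1 - \<alpha> / 2) = \<rho> powr (- 2 * (- 1 - \<alpha> / 2)) * t powr (- 1 - \<alpha> / 2)"
            by (rule powr_scale[OF \<rho> True])
          also have "- 2 * (- 1 - \<alpha> / 2) = 2 + \<alpha>" by simp
          finally show ?thesis using True \<rho> by (simp add: pow_weight_def)
        next
          case False
          then show ?thesis using \<rho> by (simp add: pow_weight_def zero_less_divide_iff)
        qed
        moreover have "?k (1 / \<rho>\<^sup>2 * t) \<rho> = ?k t 1" using \<rho> by simp
        ultimately have "?w (0 + 1 / \<rho>\<^sup>2 * t) * ?k (0 + 1 / \<rho>\<^sup>2 * t) \<rho> = \<rho> powr (2 + \<alpha>) * (?w t * ?k t 1)"
          by (simp only: add_0 mult.assoc)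
        then show "ennreal (?w (0 + 1 / \<rho>\<^sup>2 * t) * ?k (0 + 1 / \<rho>\<^sup>2 * t) \<rho>) = ennreal (\<rho> powr (2 + \<alpha>)) * ennreal (?w t * ?k t 1)"
          using nn[of t 1] by (simp only: ennreal_mult powr_ge_zero)
      qed
      also have "\<dots> = ennreal (\<rho> powr (2 + \<alpha>)) * J 1"
        unfolding J_def by (rule nn_integral_cmult) measurable
      also have "\<bar>1 / \<rho>\<^sup>2\<bar> * (ennreal (\<rho> powr (2 + \<alpha>)) * J 1) = ennreal (1 / \<rho>\<^sup>2 * (\<rho> powr (2 + \<alpha>) * c))"
      proof -
        have "0 \<le> 1 / \<rho>\<^sup>2" by simp
        from ennreal_mult3[OF this powr_ge_zero c(2)] show ?thesis unfolding c(1) .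
      qed
      also have "1 / \<rho>\<^sup>2 * (\<rho> powr (2 + \<alpha>) * c) = c * \<rho> powr \<alpha>"
        using \<rho> by (simp add: powr_add)
      finally show ?thesis .
    qed
    then show "(\<integral>\<^sup>+t. ennreal (1 * (?w t * ?k t \<rho>)) \<partial>lborel) = ennreal (1 * (c * \<rho> powr \<alpha>))"
      by (simp add: J_def)
    show "0 \<le> 1 * (?w t * ?k t \<rho>)" for t using nn[of t \<rho>] by simp
    show "0 \<le> 1 * (c * \<rho> powr \<alpha>)" using c(2) by simp
  qed measurable
  then show ?thesis using cpos by blast
qed

lemma DERIV_power_potential:
  "a > 0 \<Longrightarrow> (power_potential \<beta> has_real_derivative a powr (\<beta> - 1)) (at a)"
proof (cases "\<beta> = 0")
  case True
  assume a: "a > 0"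
  have "power_potential 0 = ln" by (auto simp: power_potential_def)
  then show ?thesis using DERIV_ln_divide[OF a] a True by (simp add: powr_minus divide_inverse)
next
  case False
  assume a: "a > 0"
  have "power_potential \<beta> = (\<lambda>r. r powr \<beta> / \<beta>)" using False by (auto simp: power_potential_def)
  then show ?thesis using DERIV_cdivide[OF has_real_derivative_powr[OF a, of \<beta>], of \<beta>] False by simp
qed

lemma nn_integral_powr_Icc:
  assumes xy: "0 \<le> x" "x \<le> y" and x: "x > 0 \<or> \<beta> > 0"
  shows "(\<integral>\<^sup>+a. ennreal (a powr (\<beta> - 1)) * indicator {x..y} a \<partial>lborel) = ennreal (power_potential \<beta> y - power_potential \<beta> x)"
proof (cases "x > 0")
  case True
  show ?thesis
    by (rule nn_integral_FTC_Icc) (use True xy in \<open>auto intro: DERIV_power_potential\<close>)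
next
  case False
  then have x0: "x = 0" "\<beta> > 0" using x xy by auto
  have "((\<lambda>a. a powr (\<beta> - 1)) has_integral (y powr (\<beta> - 1 + 1) / (\<beta> - 1 + 1))) {0..y}"
    using x0 xy by (intro has_integral_powr_from_0) auto
  then have "(\<integral>\<^sup>+a. ennreal (a powr (\<beta> - 1)) * indicator {0..y} a \<partial>lborel) = ennreal (y powr (\<beta> - 1 + 1) / (\<beta> - 1 + 1))"
    by (intro nn_integral_has_integral_lebesgue') auto
  then show ?thesis using x0 by (simp add: power_potential_def)
qed

lemma power_potential_mono:
  assumes xy: "0 \<le> x" "x \<le> y" and x: "x > 0 \<or> \<beta> > 0"
  shows "power_potential \<beta> x \<le> power_potential \<beta> y"
proof (cases "\<beta> > 0")
  case True
  then show ?thesis using xy unfolding power_potential_def by (auto intro!: divide_right_mono powr_mono2)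
next
  case False
  then have x0: "x > 0" using x by simp
  show ?thesis
  proof (rule DERIV_nonneg_imp_nondecreasing[where f="power_potential \<beta>" and a=x and b=y])
    fix t assume "x \<le> t" "t \<le> y"
    then show "\<exists>D. DERIV (power_potential \<beta>) t :> D \<and> D \<ge> 0"
      using DERIV_power_potential[of t \<beta>] x0 by (intro exI[of _ "t powr (\<beta> - 1)"]) auto
  qed (rule xy)
qed

text \<open>Both sides are integrals over \<open>a\<close> from \<open>x\<close> to \<open>y\<close>: on the left the difference of exponentials is the
integral of \<open>2 t a exp (- t a\<^sup>2)\<close>, and the integral over \<open>t\<close> is then a gamma integral, equal to a
multiple of \<open>a powr (\<beta> - 1)\<close>, the derivative of \<open>power_potential \<beta>\<close>. This form covers positive,
zero and negative \<open>\<beta>\<close> at once.\<close>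

lemma gaussian_difference_integral:
  assumes \<beta>: "\<beta> < 2" and xy: "0 \<le> x" "x \<le> y" and x: "x > 0 \<or> \<beta> > 0"
  shows "(\<integral>\<^sup>+t. ennreal (pow_weight \<beta> t * (exp (- t * x\<^sup>2) - exp (- t * y\<^sup>2))) \<partial>lborel) =
    ennreal (2 * Gamma (1 - \<beta> / 2) * (power_potential \<beta> y - power_potential \<beta> x))"
proof -
  define c where "c = 2 * Gamma (1 - \<beta> / 2)"
  have c: "c > 0" unfolding c_def using \<beta> by (intro mult_pos_pos Gamma_real_pos) auto
  have inner: "(\<integral>\<^sup>+t. ennreal (pow_weight \<beta> t * (2 * t * a * exp (- t * a\<^sup>2))) \<partial>lborel) = ennreal (c * a powr (\<beta> - 1))"
    if a: "a > 0" for a :: real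
  proof -
    have "(\<integral>\<^sup>+t. ennreal (pow_weight \<beta> t * (2 * t * a * exp (- t * a\<^sup>2))) \<partial>lborel) =
       \<bar>1 / a\<^sup>2\<bar> * (\<integral>\<^sup>+t. ennreal (pow_weight \<beta> (0 + 1 / a\<^sup>2 * t) * (2 * (0 + 1 / a\<^sup>2 * t) * a * exp (- (0 + 1 / a\<^sup>2 * t) * a\<^sup>2))) \<partial>lborel)"
      using a by (intro nn_integral_real_affine) auto
    also have "(\<integral>\<^sup>+t. ennreal (pow_weight \<beta> (0 + 1 / a\<^sup>2 * t) * (2 * (0 + 1 / a\<^sup>2 * t) * a * exp (- (0 + 1 / a\<^sup>2 * t) * a\<^sup>2))) \<partial>lborel) =
       (\<integral>\<^sup>+t. ennreal (2 * a powr (\<beta> + 1)) * ennreal (indicator {0..} t * t powr (1 - \<beta> / 2 - 1) / exp t) \<partial>lborel)"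
    proof (rule nn_integral_cong)
      fix t :: real
      have "pow_weight \<beta> (1 / a\<^sup>2 * t) * (2 * (1 / a\<^sup>2 * t) * a * exp (- (1 / a\<^sup>2 * t) * a\<^sup>2)) =
          2 * a powr (\<beta> + 1) * (indicator {0..} t * t powr (1 - \<beta> / 2 - 1) / exp t)"
      proof (cases "t > 0")
        case True
        have "(1 / a\<^sup>2 * t) powr (- 1 - \<beta> / 2) * (1 / a\<^sup>2 * t) = (1 / a\<^sup>2 * t) powr (- 1 - \<beta> / 2) * (1 / a\<^sup>2 * t) powr 1"
          using True a by simp
        also have "\<dots> = (1 / a\<^sup>2 * t) powr (- \<beta> / 2)" unfolding powr_add[symmetric] by simp
        also have "\<dots> = a powr (- 2 * (- \<beta> / 2)) * t powr (- \<beta> / 2)" by (rule powr_scale[OF a True])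
        also have "- 2 * (- \<beta> / 2) = \<beta>" by simp
        finally have 1: "(1 / a\<^sup>2 * t) powr (- 1 - \<beta> / 2) * (1 / a\<^sup>2 * t) = a powr \<beta> * t powr (- \<beta> / 2)" .
        have 2: "exp (- (1 / a\<^sup>2 * t) * a\<^sup>2) = 1 / exp t" using a by (simp add: exp_minus divide_inverse)
        have 3: "pow_weight \<beta> (1 / a\<^sup>2 * t) = (1 / a\<^sup>2 * t) powr (- 1 - \<beta> / 2)" using a True by (simp add: pow_weight_def)
        have "a powr 1 = a" using a by simp
        then have 4: "a powr (\<beta> + 1) = a powr \<beta> * a" by (simp only: powr_add)
        have "pow_weight \<beta> (1 / a\<^sup>2 * t) * (2 * (1 / a\<^sup>2 * t) * a * exp (- (1 / a\<^sup>2 * t) * a\<^sup>2)) =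
           ((1 / a\<^sup>2 * t) powr (- 1 - \<beta> / 2) * (1 / a\<^sup>2 * t)) * 2 * a * (1 / exp t)"
          unfolding 2 3 by (simp only: mult_ac)
        also have "\<dots> = 2 * a powr (\<beta> + 1) * (indicator {0..} t * t powr (1 - \<beta> / 2 - 1) / exp t)"
        proof -
          have 5: "1 - \<beta> / 2 - 1 = - \<beta> / 2" "indicator {0..} t = (1::real)" using True by simp_all
          have "P * T * 2 * a * (1 / e) = 2 * (P * a) * (1 * T / e)" for P T e :: real by simp
          then show ?thesis unfolding 1 4 5 .
        qed
        finally show ?thesis .
      next
        case False
        then show ?thesis using a by (cases "t = 0") (auto simp: pow_weight_def zero_less_divide_iff)
      qed
      then show "ennreal (pow_weight \<beta> (0 + 1 / a\<^sup>2 * t) * (2 * (0 + 1 / a\<^sup>2 * t) * a * exp (- (0 + 1 / a\<^sup>2 * t) * a\<^sup>2))) =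
        ennreal (2 * a powr (\<beta> + 1)) * ennreal (indicator {0..} t * t powr (1 - \<beta> / 2 - 1) / exp t)"
        by (simp only: add_0) (subst ennreal_mult[symmetric], auto)
    qed
    also have "\<dots> = ennreal (2 * a powr (\<beta> + 1)) * ennreal (Gamma (1 - \<beta> / 2))"
      using Gamma_conv_nn_integral_real[of "1 - \<beta> / 2"] \<beta> by (subst nn_integral_cmult) auto
    also have "\<bar>1 / a\<^sup>2\<bar> * (ennreal (2 * a powr (\<beta> + 1)) * ennreal (Gamma (1 - \<beta> / 2))) =
        ennreal (1 / a\<^sup>2 * (2 * a powr (\<beta> + 1) * Gamma (1 - \<beta> / 2)))"
      by (rule ennreal_mult3) (use c in \<open>auto simp: c_def\<close>)
    also have "1 / a\<^sup>2 * (2 * a powr (\<beta> + 1) * Gamma (1 - \<beta> / 2)) = c * a powr (\<beta> - 1)"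
    proof -
      have "a powr (\<beta> + 1) = a powr (\<beta> - 1) * a\<^sup>2"
      proof -
        have "a powr (\<beta> - 1) * a powr 2 = a powr (\<beta> + 1)" unfolding powr_add[symmetric] by (simp add: add.commute)
        then show ?thesis using a by simp
      qed
      then show ?thesis using a by (simp add: c_def)
    qed
    finally show ?thesis .
  qed
  have "(\<integral>\<^sup>+t. ennreal (pow_weight \<beta> t * (exp (- t * x\<^sup>2) - exp (- t * y\<^sup>2))) \<partial>lborel) =
     (\<integral>\<^sup>+t. (\<integral>\<^sup>+a. ennreal (pow_weight \<beta> t * (2 * t * a * exp (- t * a\<^sup>2))) * indicator {x..y} a \<partial>lborel) \<partial>lborel)"
  proof (rule nn_integral_cong)
    fix t :: real
    show "ennreal (pow_weight \<beta> t * (exp (- t * x\<^sup>2) - exp (- t * y\<^sup>2))) =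
      (\<integral>\<^sup>+a. ennreal (pow_weight \<beta> t * (2 * t * a * exp (- t * a\<^sup>2))) * indicator {x..y} a \<partial>lborel)"
    proof (cases "t > 0")
      case True
      have "(\<integral>\<^sup>+a. ennreal (pow_weight \<beta> t * (2 * t * a * exp (- t * a\<^sup>2))) * indicator {x..y} a \<partial>lborel) =
        ennreal (- pow_weight \<beta> t * exp (- t * y\<^sup>2) - (- pow_weight \<beta> t * exp (- t * x\<^sup>2)))"
      proof (rule nn_integral_FTC_Icc[where F="\<lambda>a. - pow_weight \<beta> t * exp (- t * a\<^sup>2)"])
        fix a assume "a \<in> {x..y}"
        then show "0 \<le> pow_weight \<beta> t * (2 * t * a * exp (- t * a\<^sup>2))"
          using True xy by (auto simp: pow_weight_def)
        show "((\<lambda>a. - pow_weight \<beta> t * exp (- t * a\<^sup>2)) has_real_derivative pow_weight \<beta> t * (2 * t * a * exp (- t * a\<^sup>2))) (at a)"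
          by (auto intro!: derivative_eq_intros)
      qed (use xy in auto)
      then show ?thesis by (simp add: algebra_simps)
    qed (simp add: pow_weight_def)
  qed
  also have "\<dots> = (\<integral>\<^sup>+a. (\<integral>\<^sup>+t. ennreal (pow_weight \<beta> t * (2 * t * a * exp (- t * a\<^sup>2))) * indicator {x..y} a \<partial>lborel) \<partial>lborel)"
    by (rule lborel_pair.Fubini') measurable
  also have "\<dots> = (\<integral>\<^sup>+a. ennreal c * (ennreal (a powr (\<beta> - 1)) * indicator {x..y} a) \<partial>lborel)"
  proof (rule nn_integral_cong_AE)
    show "AE a in lborel. (\<integral>\<^sup>+t. ennreal (pow_weight \<beta> t * (2 * t * a * exp (- t * a\<^sup>2))) * indicator {x..y} a \<partial>lborel) =
      ennreal c * (ennreal (a powr (\<beta> - 1)) * indicator {x..y} a)"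
      using AE_lborel_singleton[of "0::real"]
    proof eventually_elim
      case (elim a)
      show ?case
      proof (cases "a \<in> {x..y}")
        case True
        then have "a > 0" using elim xy by auto
        from inner[OF this] True c show ?thesis by (simp add: ennreal_mult[symmetric])
      qed simp
    qed
  qed
  also have "\<dots> = ennreal c * (\<integral>\<^sup>+a. ennreal (a powr (\<beta> - 1)) * indicator {x..y} a \<partial>lborel)"
    by (rule nn_integral_cmult) measurable
  also have "\<dots> = ennreal (c * (power_potential \<beta> y - power_potential \<beta> x))"
    unfolding nn_integral_powr_Icc[OF xy x] using c power_potential_mono[OF xy x] by (intro ennreal_mult[symmetric]) auto
  finally show ?thesis unfolding c_def .
qed

text \<open>The difference \<open>power_potential \<beta> 1 - power_potential \<beta> \<rho>\<close> has one sign on each side of \<open>\<rho> = 1\<close>, and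
so has the integrand.\<close>

lemma power_mixture_low:
  assumes \<beta>: "\<beta> < 2" and \<rho>: "\<rho> \<ge> 0" "\<rho> > 0 \<or> \<beta> > 0"
  shows "mixes_to (pow_weight \<beta>) (\<lambda>t \<rho>. exp (- t * \<rho>\<^sup>2) - exp (- t) - 0 * \<rho>\<^sup>2)
     (\<lambda>\<rho>. 2 * Gamma (1 - \<beta> / 2) * (power_potential \<beta> 1 - power_potential \<beta> \<rho>)) \<rho>"
proof -
  have g: "Gamma (1 - \<beta> / 2) > 0" using \<beta> by (intro Gamma_real_pos) auto
  show ?thesis
  proof (cases "\<rho> \<le> 1")
    case True
    show ?thesis
    proof (rule mixes_toI_nn[where s=1])
      show "0 \<le> 1 * (pow_weight \<beta> t * (exp (- t * \<rho>\<^sup>2) - exp (- t) - 0 * \<rho>\<^sup>2))" for t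
      proof (cases "t > 0")
        case t: True
        have "\<rho>\<^sup>2 \<le> 1" using True \<rho> by (simp add: power_le_one)
        then have "t * \<rho>\<^sup>2 \<le> t * 1" using t by (intro mult_left_mono) auto
        then show ?thesis by (simp add: pow_weight_def)
      qed (simp add: pow_weight_def)
      show "0 \<le> 1 * (2 * Gamma (1 - \<beta> / 2) * (power_potential \<beta> 1 - power_potential \<beta> \<rho>))"
        using g power_potential_mono[OF \<rho>(1) True \<rho>(2)] by simp
      show "(\<integral>\<^sup>+t. ennreal (1 * (pow_weight \<beta> t * (exp (- t * \<rho>\<^sup>2) - exp (- t) - 0 * \<rho>\<^sup>2))) \<partial>lborel) =
         ennreal (1 * (2 * Gamma (1 - \<beta> / 2) * (power_potential \<beta> 1 - power_potential \<beta> \<rho>)))"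
        using gaussian_difference_integral[OF \<beta> \<rho>(1) True \<rho>(2)] by simp
    qed auto
  next
    case False
    show ?thesis
    proof (rule mixes_toI_nn[where s="-1"])
      show "0 \<le> -1 * (pow_weight \<beta> t * (exp (- t * \<rho>\<^sup>2) - exp (- t) - 0 * \<rho>\<^sup>2))" for t
      proof (cases "t > 0")
        case t: True
        have "1 \<le> \<rho>\<^sup>2" using False by (simp add: one_le_power)
        then have "t * 1 \<le> t * \<rho>\<^sup>2" using t by (intro mult_left_mono) auto
        then have "exp (- t * \<rho>\<^sup>2) - exp (- t) \<le> 0" by simp
        then have "pow_weight \<beta> t * (exp (- t * \<rho>\<^sup>2) - exp (- t)) \<le> 0"
          by (intro mult_nonneg_nonpos) (simp_all add: pow_weight_def)
        then show ?thesis by simp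
      qed (simp add: pow_weight_def)
      have le: "1 \<le> \<rho>" using False by simp
      show "0 \<le> -1 * (2 * Gamma (1 - \<beta> / 2) * (power_potential \<beta> 1 - power_potential \<beta> \<rho>))"
        using g power_potential_mono[OF _ le, of \<beta>] by (simp add: mult_nonneg_nonpos)
      have E1: "(\<lambda>t. ennreal (-1 * (pow_weight \<beta> t * (exp (- t * \<rho>\<^sup>2) - exp (- t) - 0 * \<rho>\<^sup>2)))) =
          (\<lambda>t. ennreal (pow_weight \<beta> t * (exp (- t * 1\<^sup>2) - exp (- t * \<rho>\<^sup>2))))"
        by (auto simp: algebra_simps)
      have E2: "-1 * (2 * Gamma (1 - \<beta> / 2) * (power_potential \<beta> 1 - power_potential \<beta> \<rho>)) =
          2 * Gamma (1 - \<beta> / 2) * (power_potential \<beta> \<rho> - power_potential \<beta> 1)"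
      proof -
        have "-1 * (A * (p - q)) = A * (q - p)" for A p q :: real by (simp add: algebra_simps)
        then show ?thesis .
      qed
      show "(\<integral>\<^sup>+t. ennreal (-1 * (pow_weight \<beta> t * (exp (- t * \<rho>\<^sup>2) - exp (- t) - 0 * \<rho>\<^sup>2))) \<partial>lborel) =
         ennreal (-1 * (2 * Gamma (1 - \<beta> / 2) * (power_potential \<beta> 1 - power_potential \<beta> \<rho>)))"
        unfolding E1 E2 by (rule gaussian_difference_integral[OF \<beta> _ le]) simp_all
    qed auto
  qed
qed

lemma pair_int_cong: "(\<And>\<rho>. \<rho> \<ge> 0 \<Longrightarrow> \<psi> \<rho> = \<phi> \<rho>) \<Longrightarrow> pair_int \<psi> M N = pair_int \<phi> M N"
  unfolding pair_int_def by simp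

lemma defect_cong: "(\<And>\<rho>. \<rho> \<ge> 0 \<Longrightarrow> \<psi> \<rho> = \<phi> \<rho>) \<Longrightarrow> defect \<psi> M N = defect \<phi> M N"
  unfolding defect_def by (simp add: pair_int_cong[of \<psi> \<phi>])

context same_mean
begin

lemma all_integrable_const: "all_integrable (\<lambda>_. c)"
proof -
  interpret M: prob_space M by (rule M)
  interpret N: prob_space N by (rule N)
  interpret MM: pair_prob_space M M ..
  interpret NN: pair_prob_space N N ..
  interpret MN: pair_prob_space M N ..
  show ?thesis unfolding all_integrable_def by simp
qed

lemma all_integrable_cmult: "all_integrable \<psi> \<Longrightarrow> all_integrable (\<lambda>\<rho>. c * \<psi> \<rho>)"
  unfolding all_integrable_def by simp

lemma all_integrable_diff: "all_integrable \<psi> \<Longrightarrow> all_integrable \<phi> \<Longrightarrow> all_integrable (\<lambda>\<rho>. \<psi> \<rho> - \<phi> \<rho>)"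
  unfolding all_integrable_def by simp

lemma all_integrable_add: "all_integrable \<psi> \<Longrightarrow> all_integrable \<phi> \<Longrightarrow> all_integrable (\<lambda>\<rho>. \<psi> \<rho> + \<phi> \<rho>)"
  unfolding all_integrable_def by simp

lemma all_integrable_bound:
  assumes "all_integrable \<phi>" and [measurable]: "\<psi> \<in> borel_measurable borel"
    and b: "\<And>\<rho>. \<rho> \<ge> 0 \<Longrightarrow> \<bar>\<psi> \<rho>\<bar> \<le> \<phi> \<rho>"
  shows "all_integrable \<psi>"
proof -
  have "pair_integrable \<psi> A B" if "pair_integrable \<phi> A B" "sets A = sets borel" "sets B = sets borel" for A B :: "'a measure"
  proof (rule Bochner_Integration.integrable_bound[OF that(1)])
    note [measurable_cong] = that(2,3)
    show "(\<lambda>z. \<psi> (dist (fst z) (snd z))) \<in> borel_measurable (A \<Otimes>\<^sub>M B)" by measurable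
    show "AE z in A \<Otimes>\<^sub>M B. norm (\<psi> (dist (fst z) (snd z))) \<le> norm (\<phi> (dist (fst z) (snd z)))"
    proof (rule AE_I2)
      fix z :: "'a \<times> 'a"
      show "norm (\<psi> (dist (fst z) (snd z))) \<le> norm (\<phi> (dist (fst z) (snd z)))"
        using b[of "dist (fst z) (snd z)"] by simp
    qed
  qed
  then show ?thesis using assms(1) M N unfolding all_integrable_def by blast
qed

lemma defect_cmult: "defect (\<lambda>\<rho>. c * \<psi> \<rho>) M N = c * defect \<psi> M N"
  unfolding defect_def pair_int_def by (simp add: algebra_simps)

lemma defect_diff:
  "all_integrable \<psi> \<Longrightarrow> all_integrable \<phi> \<Longrightarrow> defect (\<lambda>\<rho>. \<psi> \<rho> - \<phi> \<rho>) M N = defect \<psi> M N - defect \<phi> M N"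
  unfolding defect_def pair_int_def all_integrable_def by simp

lemma defect_const: "defect (\<lambda>_. c) M N = 0"
proof -
  interpret M: prob_space M by (rule M)
  interpret N: prob_space N by (rule N)
  interpret MM: pair_prob_space M M ..
  interpret NN: pair_prob_space N N ..
  interpret MN: pair_prob_space M N ..
  show ?thesis unfolding defect_def pair_int_def
    using MM.P.prob_space NN.P.prob_space MN.P.prob_space by simp
qed

lemma defect_powr_between:
  assumes \<alpha>: "2 < \<alpha>" "\<alpha> < 4" and int: "all_integrable (\<lambda>\<rho>. \<rho> powr \<alpha>)"
  shows "defect (\<lambda>\<rho>. \<rho> powr \<alpha>) M N \<ge> 0" and "defect (\<lambda>\<rho>. \<rho> powr \<alpha>) M N = 0 \<Longrightarrow> M = N"
proof -
  obtain c where c: "c > 0" and mix: "\<And>\<rho>. \<rho> \<ge> 0 \<Longrightarrow>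
     mixes_to (pow_weight \<alpha>) (\<lambda>t \<rho>. exp (- t * \<rho>\<^sup>2) - 1 - (- t) * \<rho>\<^sup>2) (\<lambda>\<rho>. c * \<rho> powr \<alpha>) \<rho>"
    using power_mixture_high[OF \<alpha>] by blast
  note D = defect_mixture[where w="pow_weight \<alpha>" and p="\<lambda>_. 1" and q="\<lambda>t. - t" and \<psi>="\<lambda>\<rho>. c * \<rho> powr \<alpha>",
      OF pow_weight_measurable _ _ _ _ _ _ all_integrable_cmult[OF int]]
  have "defect (\<lambda>\<rho>. c * \<rho> powr \<alpha>) M N \<ge> 0"
  proof (rule D(1))
    show "AE z in A \<Otimes>\<^sub>M B. mixes_to (pow_weight \<alpha>) (\<lambda>t \<rho>. exp (- t * \<rho>\<^sup>2) - 1 - (- t) * \<rho>\<^sup>2) (\<lambda>\<rho>. c * \<rho> powr \<alpha>) (dist (fst z) (snd z))"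
      for A B :: "'a measure" by (rule AE_I2, rule mix, rule zero_le_dist)
  qed (simp_all add: pow_weight_def)
  then show "defect (\<lambda>\<rho>. \<rho> powr \<alpha>) M N \<ge> 0" unfolding defect_cmult using c by (simp add: zero_le_mult_iff)
  assume 0: "defect (\<lambda>\<rho>. \<rho> powr \<alpha>) M N = 0"
  show "M = N"
  proof (rule D(2))
    show "AE z in A \<Otimes>\<^sub>M B. mixes_to (pow_weight \<alpha>) (\<lambda>t \<rho>. exp (- t * \<rho>\<^sup>2) - 1 - (- t) * \<rho>\<^sup>2) (\<lambda>\<rho>. c * \<rho> powr \<alpha>) (dist (fst z) (snd z))"
      for A B :: "'a measure" by (rule AE_I2, rule mix, rule zero_le_dist)
    show "defect (\<lambda>\<rho>. c * \<rho> powr \<alpha>) M N = 0" unfolding defect_cmult 0 by simp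
  qed (simp_all add: pow_weight_def)
qed

text \<open>The exponents \<open>a n\<close> increase to \<open>4\<close>, so dominated convergence applies. Strictness is lost in
the limit, and indeed the form of \<open>\<rho> powr 4\<close> is degenerate.\<close>

lemma defect_powr_4:
  assumes int: "all_integrable (\<lambda>\<rho>. \<rho> powr 4)"
  shows "defect (\<lambda>\<rho>. \<rho> powr 4) M N \<ge> 0"
proof -
  define a where "a n = 4 - 1 / (real n + 1)" for n :: nat
  have a: "2 < a n" "a n < 4" for n
  proof -
    have "1 / (real n + 1) \<le> 1" by simp
    then show "2 < a n" unfolding a_def by linarith
    show "a n < 4" unfolding a_def by simp
  qed
  have alim: "a \<longlonglongrightarrow> 4"
  proof -
    show ?thesis unfolding a_def by real_asymp
  qed
  have b: "\<bar>\<rho> powr a n\<bar> \<le> 1 + \<rho> powr 4" if "\<rho> \<ge> 0" for \<rho> n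
  proof (cases "\<rho> \<le> 1")
    case True
    then have "\<rho> powr a n \<le> 1" using that a[of n] by (intro powr_le1) auto
    moreover have "\<bar>\<rho> powr a n\<bar> = \<rho> powr a n" by simp
    ultimately show ?thesis using powr_ge_zero[of \<rho> 4] by linarith
  next
    case False
    then have "\<rho> powr a n \<le> \<rho> powr 4" using a[of n] by (intro powr_mono) auto
    then show ?thesis by simp
  qed
  have int1: "all_integrable (\<lambda>\<rho>. 1 + \<rho> powr 4)" by (rule all_integrable_add[OF all_integrable_const int])
  have lim: "(\<lambda>n. pair_int (\<lambda>\<rho>. \<rho> powr a n) A B) \<longlonglongrightarrow> pair_int (\<lambda>\<rho>. \<rho> powr 4) A B"
    if i: "pair_integrable (\<lambda>\<rho>. 1 + \<rho> powr 4) A B" and AB: "sets A = sets borel" "sets B = sets borel" for A B :: "'a measure"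
    unfolding pair_int_def
  proof (rule integral_dominated_convergence[where w="\<lambda>z. 1 + dist (fst z) (snd z) powr 4"])
    note [measurable_cong] = AB
    show "integrable (A \<Otimes>\<^sub>M B) (\<lambda>z. 1 + dist (fst z) (snd z) powr 4)" by (rule i)
    show "(\<lambda>z. dist (fst z) (snd z) powr 4) \<in> borel_measurable (A \<Otimes>\<^sub>M B)" by measurable
    show "(\<lambda>z. dist (fst z) (snd z) powr a n) \<in> borel_measurable (A \<Otimes>\<^sub>M B)" for n by measurable
    show "AE z in A \<Otimes>\<^sub>M B. (\<lambda>n. dist (fst z) (snd z) powr a n) \<longlonglongrightarrow> dist (fst z) (snd z) powr 4"
    proof (rule AE_I2)
      fix z :: "'a \<times> 'a"
      show "(\<lambda>n. dist (fst z) (snd z) powr a n) \<longlonglongrightarrow> dist (fst z) (snd z) powr 4"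
      proof (cases "dist (fst z) (snd z) = 0")
        case False
        then show ?thesis by (intro tendsto_powr tendsto_const alim)
      qed simp
    qed
    show "AE z in A \<Otimes>\<^sub>M B. norm (dist (fst z) (snd z) powr a n) \<le> 1 + dist (fst z) (snd z) powr 4" for n
      by (rule AE_I2) (simp only: real_norm_def b zero_le_dist)
  qed
  have "(\<lambda>n. defect (\<lambda>\<rho>. \<rho> powr a n) M N) \<longlonglongrightarrow> defect (\<lambda>\<rho>. \<rho> powr 4) M N"
    unfolding defect_def using int1 M N
    by (intro tendsto_diff tendsto_add tendsto_mult tendsto_const lim) (auto simp: all_integrable_def)
  moreover have "defect (\<lambda>\<rho>. \<rho> powr a n) M N \<ge> 0" for n
    by (rule defect_powr_between(1)[OF a]) (rule all_integrable_bound[OF int1], measurable, rule b)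
  ultimately show ?thesis by (intro LIMSEQ_le_const) auto
qed

lemma defect_powr_2: "defect (\<lambda>\<rho>. \<rho> powr 2) M N = 0"
  unfolding defect_sq[symmetric] by (rule defect_cong) simp

lemma defect_power_potential_low:
  assumes \<beta>: "\<beta> < 2" and int: "all_integrable (power_potential \<beta>)"
    and diag: "\<And>A B. (A, B) \<in> {(M, M), (N, N), (M, N)} \<Longrightarrow> \<beta> \<le> 0 \<Longrightarrow> AE z in A \<Otimes>\<^sub>M B. fst z \<noteq> snd z"
  shows "defect (power_potential \<beta>) M N \<le> 0" and "defect (power_potential \<beta>) M N = 0 \<Longrightarrow> M = N"
proof -
  define c where "c = 2 * Gamma (1 - \<beta> / 2)"
  have c: "c > 0" unfolding c_def using \<beta> by (intro mult_pos_pos Gamma_real_pos) auto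
  let ?\<psi> = "\<lambda>\<rho>. c * (power_potential \<beta> 1 - power_potential \<beta> \<rho>)"
  have [measurable]: "power_potential \<beta> \<in> borel_measurable borel"
    unfolding power_potential_def[abs_def] by measurable
  have m1: "(\<lambda>t::real. exp (- t)) \<in> borel_measurable borel" "(\<lambda>t::real. 0::real) \<in> borel_measurable borel"
     "?\<psi> \<in> borel_measurable borel" by measurable
  have mix: "AE z in A \<Otimes>\<^sub>M B. mixes_to (pow_weight \<beta>) (\<lambda>t \<rho>. exp (- t * \<rho>\<^sup>2) - exp (- t) - 0 * \<rho>\<^sup>2) ?\<psi> (dist (fst z) (snd z))"
    if AB: "(A, B) \<in> {(M, M), (N, N), (M, N)}" for A B
  proof (cases "\<beta> > 0")
    case True
    then show ?thesis unfolding c_def by (intro AE_I2 power_mixture_low \<beta>) auto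
  next
    case False
    then have "AE z in A \<Otimes>\<^sub>M B. fst z \<noteq> snd z" using diag[OF AB] by simp
    then show ?thesis
    proof eventually_elim
      case (elim z)
      then show ?case unfolding c_def by (intro power_mixture_low \<beta>) auto
    qed
  qed
  have int': "all_integrable ?\<psi>"
    by (intro all_integrable_cmult all_integrable_diff all_integrable_const int)
  have w: "\<And>t. t \<le> 0 \<Longrightarrow> pow_weight \<beta> t = 0" "\<And>t. t > 0 \<Longrightarrow> pow_weight \<beta> t > 0"
    by (simp_all add: pow_weight_def)
  note D = defect_mixture[OF pow_weight_measurable m1 w mix int']
  have eq: "defect ?\<psi> M N = - c * defect (power_potential \<beta>) M N"
    unfolding defect_cmult defect_diff[OF all_integrable_const int] defect_const by simp
  show "defect (power_potential \<beta>) M N \<le> 0"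
    using D(1) c unfolding eq by (simp add: mult_le_0_iff)
  show "M = N" if "defect (power_potential \<beta>) M N = 0"
    using D(2) that unfolding eq by simp
qed

text \<open>A vanishing defect forces both powers to have vanishing defect. Unless \<open>(\<alpha>, \<beta>) = (4, 2)\<close>, one
of \<open>\<beta> < 2\<close> and \<open>2 < \<alpha> < 4\<close> holds, and the strict statement for that power applies.\<close>

theorem defect_kernel:
  assumes \<alpha>: "2 \<le> \<alpha>" "\<alpha> \<le> 4" and \<beta>: "\<beta> \<le> 2" "\<beta> < \<alpha>"
    and int: "all_integrable (power_potential \<alpha>)" "all_integrable (power_potential \<beta>)"
    and diag: "\<And>A B. (A, B) \<in> {(M, M), (N, N), (M, N)} \<Longrightarrow> \<beta> \<le> 0 \<Longrightarrow> AE z in A \<Otimes>\<^sub>M B. fst z \<noteq> snd z"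
  shows "defect (\<lambda>\<rho>. power_potential \<alpha> \<rho> - power_potential \<beta> \<rho>) M N \<ge> 0"
    and "(\<alpha>, \<beta>) \<noteq> (4, 2) \<Longrightarrow> defect (\<lambda>\<rho>. power_potential \<alpha> \<rho> - power_potential \<beta> \<rho>) M N = 0 \<Longrightarrow> M = N"
proof -
  have pa: "power_potential \<alpha> = (\<lambda>\<rho>. (1 / \<alpha>) * \<rho> powr \<alpha>)" using \<alpha> by (auto simp: power_potential_def)
  have "all_integrable (\<lambda>\<rho>. \<alpha> * power_potential \<alpha> \<rho>)" by (rule all_integrable_cmult[OF int(1)])
  then have inta: "all_integrable (\<lambda>\<rho>. \<rho> powr \<alpha>)" unfolding pa using \<alpha> by simp
  have da: "defect (power_potential \<alpha>) M N = (1 / \<alpha>) * defect (\<lambda>\<rho>. \<rho> powr \<alpha>) M N"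
    unfolding pa by (rule defect_cmult)
  have high: "defect (\<lambda>\<rho>. \<rho> powr \<alpha>) M N \<ge> 0"
  proof -
    consider "\<alpha> = 2" | "\<alpha> = 4" | "2 < \<alpha>" "\<alpha> < 4" using \<alpha> by linarith
    then show ?thesis using defect_powr_2 defect_powr_4 defect_powr_between(1) inta by cases simp_all
  qed
  then have a0: "defect (power_potential \<alpha>) M N \<ge> 0" unfolding da using \<alpha> by simp
  have b2: "defect (power_potential \<beta>) M N = 0" if "\<beta> = 2"
  proof -
    have "power_potential \<beta> = (\<lambda>\<rho>. (1 / 2) * \<rho> powr 2)" unfolding that by (auto simp: power_potential_def)
    then show ?thesis by (simp only: defect_cmult defect_powr_2 mult_zero_right)
  qed
  have b0: "defect (power_potential \<beta>) M N \<le> 0"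
    using b2 defect_power_potential_low(1)[OF _ int(2) diag] \<beta> by (cases "\<beta> = 2") simp_all
  have eq: "defect (\<lambda>\<rho>. power_potential \<alpha> \<rho> - power_potential \<beta> \<rho>) M N =
      defect (power_potential \<alpha>) M N - defect (power_potential \<beta>) M N"
    by (rule defect_diff[OF int])
  show "defect (\<lambda>\<rho>. power_potential \<alpha> \<rho> - power_potential \<beta> \<rho>) M N \<ge> 0"
    unfolding eq using a0 b0 by simp
  assume ne: "(\<alpha>, \<beta>) \<noteq> (4, 2)" and z: "defect (\<lambda>\<rho>. power_potential \<alpha> \<rho> - power_potential \<beta> \<rho>) M N = 0"
  have za: "defect (power_potential \<alpha>) M N = 0" and zb: "defect (power_potential \<beta>) M N = 0"
    using z a0 b0 unfolding eq by simp_all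
  show "M = N"
  proof (cases "\<beta> < 2")
    case True
    show ?thesis by (rule defect_power_potential_low(2)[OF True int(2) diag zb])
  next
    case False
    then have "2 < \<alpha>" "\<alpha> < 4" using \<alpha> \<beta> ne by auto
    moreover have "defect (\<lambda>\<rho>. \<rho> powr \<alpha>) M N = 0" using za \<alpha> unfolding da by simp
    ultimately show ?thesis using defect_powr_between(2) inta by blast
  qed
qed

end

section \<open>The potential of the uniform sphere\<close>

lemma dist_uniform_sphere_law:
  fixes x a :: "'a::euclidean_space"
  assumes d: "DIM('a) \<ge> 2" and R: "R > 0"
  shows "distr (uniform_sphere a R) borel (dist x) =
    distr (angle_measure DIM('a)) borel (\<lambda>\<theta>. R * sqrt (chord2 (dist x a / R) \<theta>))"
proof (rule measure_eqI)
  fix A assume "A \<in> sets (distr (uniform_sphere a R) borel (dist x))"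
  then have [measurable]: "A \<in> sets borel" by simp
  have e: "sqrt ((dist x a)\<^sup>2 + R\<^sup>2 - 2 * dist x a * R * cos \<theta>) = R * sqrt (chord2 (dist x a / R) \<theta>)" for \<theta>
  proof -
    have "(dist x a)\<^sup>2 + R\<^sup>2 - 2 * dist x a * R * cos \<theta> = R\<^sup>2 * chord2 (dist x a / R) \<theta>"
      using R unfolding chord2_def by (simp add: field_simps power2_eq_square)
    then show ?thesis using R by (simp add: real_sqrt_mult)
  qed
  have "emeasure (distr (uniform_sphere a R) borel (dist x)) A = (\<integral>\<^sup>+y. indicator A (dist x y) \<partial>uniform_sphere a R)"
    by (simp add: nn_integral_distr flip: nn_integral_indicator)
  also have "\<dots> = (\<integral>\<^sup>+\<theta>. indicator A (R * sqrt (chord2 (dist x a / R) \<theta>)) \<partial>angle_measure DIM('a))"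
    using nn_integral_uniform_sphere_dist[OF d R, where x=x and a=a and h="indicator A"] unfolding e by simp
  also have "\<dots> = emeasure (distr (angle_measure DIM('a)) borel (\<lambda>\<theta>. R * sqrt (chord2 (dist x a / R) \<theta>))) A"
    by (simp add: nn_integral_distr flip: nn_integral_indicator)
  finally show "emeasure (distr (uniform_sphere a R) borel (dist x)) A =
    emeasure (distr (angle_measure DIM('a)) borel (\<lambda>\<theta>. R * sqrt (chord2 (dist x a / R) \<theta>))) A" .
qed simp

lemma
  fixes x a :: "'a::euclidean_space" and h :: "real \<Rightarrow> real"
  assumes d: "DIM('a) \<ge> 2" and R: "R > 0" and [measurable]: "h \<in> borel_measurable borel"
  shows integral_uniform_sphere_dist:
      "(\<integral>y. h (dist x y) \<partial>uniform_sphere a R) = (\<integral>\<theta>. h (R * sqrt (chord2 (dist x a / R) \<theta>)) \<partial>angle_measure DIM('a))"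
    and integrable_uniform_sphere_dist:
      "integrable (uniform_sphere a R) (\<lambda>y. h (dist x y)) \<longleftrightarrow>
       integrable (angle_measure DIM('a)) (\<lambda>\<theta>. h (R * sqrt (chord2 (dist x a / R) \<theta>)))"
proof -
  note law = dist_uniform_sphere_law[OF d R, of a x]
  have "(\<integral>y. h (dist x y) \<partial>uniform_sphere a R) = (\<integral>s. h s \<partial>distr (uniform_sphere a R) borel (dist x))"
    by (rule integral_distr[symmetric]) measurable
  also have "\<dots> = (\<integral>\<theta>. h (R * sqrt (chord2 (dist x a / R) \<theta>)) \<partial>angle_measure DIM('a))"
    unfolding law by (rule integral_distr) measurable
  finally show "(\<integral>y. h (dist x y) \<partial>uniform_sphere a R) = (\<integral>\<theta>. h (R * sqrt (chord2 (dist x a / R) \<theta>)) \<partial>angle_measure DIM('a))" .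
  have "integrable (uniform_sphere a R) (\<lambda>y. h (dist x y)) \<longleftrightarrow> integrable (distr (uniform_sphere a R) borel (dist x)) h"
    by (rule integrable_distr_eq[symmetric]) measurable
  also have "\<dots> \<longleftrightarrow> integrable (angle_measure DIM('a)) (\<lambda>\<theta>. h (R * sqrt (chord2 (dist x a / R) \<theta>)))"
    unfolding law by (rule integrable_distr_eq) measurable
  finally show "integrable (uniform_sphere a R) (\<lambda>y. h (dist x y)) \<longleftrightarrow>
       integrable (angle_measure DIM('a)) (\<lambda>\<theta>. h (R * sqrt (chord2 (dist x a / R) \<theta>)))" .
qed

lemma power_potential_measurable [measurable]: "power_potential \<gamma> \<in> borel_measurable borel"
  unfolding power_potential_def[abs_def] by measurable

text \<open>The logarithm is the one potential that is homogeneous only up to an additive constant.\<close>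

lemma power_potential_scale:
  assumes "R > 0" "s > 0"
  shows "power_potential \<gamma> (R * s) = R powr \<gamma> * power_potential \<gamma> s + (if \<gamma> = 0 then ln R else 0)"
  using assms by (simp add: power_potential_def ln_mult powr_mult)

text \<open>Away from \<open>r = 1\<close> the integrand is bounded. At \<open>r = 1\<close> powers are integrable for \<open>\<gamma> > 1 - n\<close>, and the
logarithm is dominated by a power.\<close>

lemma integrable_power_potential_chord:
  assumes n: "n \<ge> 2" and \<gamma>: "\<gamma> > 1 - real n" and r: "r \<ge> 0"
  shows "integrable (angle_measure n) (\<lambda>\<theta>. power_potential \<gamma> (sqrt (chord2 r \<theta>)))"
proof (cases "\<gamma> = 0")
  case False
  have "integrable (angle_measure n) (\<lambda>\<theta>. chord2 r \<theta> powr (\<gamma> / 2) / \<gamma>)"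
  proof (cases "r = 1")
    case True
    then show ?thesis using integrable_chord2_1[OF n \<gamma>] by simp
  next
    case False
    then show ?thesis using r by (intro integrable_divide integrable_chord2_powr) auto
  qed
  then show ?thesis using False by (simp add: power_potential_def sqrt_powr[OF chord2_nonneg])
next
  case True
  interpret prob_space "angle_measure n" by (rule prob_space_angle_measure)
  show ?thesis
  proof (cases "r = 1")
    case False
    then have reg: "r \<in> {-1<..<1} \<union> {1<..}" using r by auto
    have "continuous_on {0..pi} (\<lambda>\<theta>. ln (sqrt (chord2 r \<theta>)))"
    proof (intro continuous_on_ln continuous_on_real_sqrt continuous_on_chord2 ballI)
      show "sqrt (chord2 r \<theta>) \<noteq> 0" for \<theta> using chord2_pos[OF reg, of \<theta>] by simp
    qed
    then have "integrable (angle_measure n) (\<lambda>\<theta>. ln (sqrt (chord2 r \<theta>)))"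
      by (rule integrable_angle_measure[rotated]) measurable
    then show ?thesis using True by (simp add: power_potential_def)
  next
    case r: True
    have "integrable (angle_measure n) (\<lambda>\<theta>. 5 * (1 + chord2 1 \<theta> powr (- (1 / 2) / 2)))"
      using n by (intro integrable_mult_right Bochner_Integration.integrable_add integrable_chord2_1) auto
    then have "integrable (angle_measure n) (\<lambda>\<theta>. ln (sqrt (chord2 1 \<theta>)))"
    proof (rule Bochner_Integration.integrable_bound)
      show "AE \<theta> in angle_measure n. norm (ln (sqrt (chord2 1 \<theta>))) \<le> norm (5 * (1 + chord2 1 \<theta> powr (- (1 / 2) / 2)))"
        using AE_angle_measure
      proof eventually_elim
        case (elim \<theta>)
        have "chord2 1 \<theta> \<le> 9" by (rule chord2_le_9) simp
        with abs_ln_bound[of "chord2 1 \<theta>"] chord2_1_pos[of \<theta>] elim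
        have "\<bar>ln (sqrt (chord2 1 \<theta>))\<bar> \<le> 5 * (1 + chord2 1 \<theta> powr (- 1 / 4))" by blast
        also have "(- 1 / 4 :: real) = - (1 / 2) / 2" by simp
        finally show ?case by simp
      qed
    qed measurable
    then show ?thesis using True r by (simp add: power_potential_def)
  qed
qed

lemma chord2_pos_AE: "AE \<theta> in angle_measure n. 0 < chord2 r \<theta>"
  using AE_angle_measure by eventually_elim (simp add: chord2_pos_interior)

lemma
  fixes x a :: "'a::euclidean_space"
  assumes d: "DIM('a) \<ge> 2" and R: "R > 0" and \<gamma>: "\<gamma> > 1 - real DIM('a)"
  shows integrable_power_potential_sphere: "integrable (uniform_sphere a R) (\<lambda>y. power_potential \<gamma> (dist x y))"
    and integral_power_potential_sphere: "(\<integral>y. power_potential \<gamma> (dist x y) \<partial>uniform_sphere a R) =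
      R powr \<gamma> * Pot DIM('a) \<gamma> (dist x a / R) + (if \<gamma> = 0 then ln R else 0)"
proof -
  interpret prob_space "angle_measure DIM('a)" by (rule prob_space_angle_measure)
  define r where "r = dist x a / R"
  have r: "r \<ge> 0" using R by (simp add: r_def)
  let ?g = "\<lambda>\<theta>. R powr \<gamma> * power_potential \<gamma> (sqrt (chord2 r \<theta>)) + (if \<gamma> = 0 then ln R else 0)"
  have eq: "AE \<theta> in angle_measure DIM('a). power_potential \<gamma> (R * sqrt (chord2 r \<theta>)) = ?g \<theta>"
    using chord2_pos_AE[where r=r] by eventually_elim (simp add: power_potential_scale[OF R])
  have i: "integrable (angle_measure DIM('a)) (\<lambda>\<theta>. power_potential \<gamma> (sqrt (chord2 r \<theta>)))"
    by (rule integrable_power_potential_chord[OF d \<gamma> r])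
  have ig: "integrable (angle_measure DIM('a)) ?g"
    by (intro Bochner_Integration.integrable_add integrable_mult_right i) simp
  have "integrable (angle_measure DIM('a)) (\<lambda>\<theta>. power_potential \<gamma> (R * sqrt (chord2 r \<theta>))) \<longleftrightarrow> integrable (angle_measure DIM('a)) ?g"
    by (rule integrable_cong_AE[OF _ _ eq]) measurable
  then show "integrable (uniform_sphere a R) (\<lambda>y. power_potential \<gamma> (dist x y))"
    using ig integrable_uniform_sphere_dist[OF d R power_potential_measurable, of a \<gamma> x] unfolding r_def by blast
  have "(\<integral>y. power_potential \<gamma> (dist x y) \<partial>uniform_sphere a R) = (\<integral>\<theta>. power_potential \<gamma> (R * sqrt (chord2 r \<theta>)) \<partial>angle_measure DIM('a))"
    unfolding r_def by (rule integral_uniform_sphere_dist[OF d R power_potential_measurable])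
  also have "\<dots> = (\<integral>\<theta>. ?g \<theta> \<partial>angle_measure DIM('a))"
    by (rule integral_cong_AE[OF _ _ eq]) measurable
  also have "\<dots> = R powr \<gamma> * Pot DIM('a) \<gamma> r + (if \<gamma> = 0 then ln R else 0)"
    using i prob_space by (simp add: Pot_def)
  finally show "(\<integral>y. power_potential \<gamma> (dist x y) \<partial>uniform_sphere a R) =
      R powr \<gamma> * Pot DIM('a) \<gamma> (dist x a / R) + (if \<gamma> = 0 then ln R else 0)" unfolding r_def .
qed

lemma AE_uniform_sphere_neq:
  fixes x a :: "'a::euclidean_space"
  assumes d: "DIM('a) \<ge> 2" and R: "R > 0"
  shows "AE y in uniform_sphere a R. x \<noteq> y"
proof -
  have "AE s in distr (angle_measure DIM('a)) borel (\<lambda>\<theta>. R * sqrt (chord2 (dist x a / R) \<theta>)). s \<noteq> 0"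
    by (subst AE_distr_iff) (use chord2_pos_AE[where n="DIM('a)" and r="dist x a / R"] R in \<open>auto elim!: eventually_mono\<close>)
  then have "AE s in distr (uniform_sphere a R) borel (dist x). s \<noteq> 0"
    unfolding dist_uniform_sphere_law[OF d R] .
  then have "AE y in uniform_sphere a R. dist x y \<noteq> 0" by (subst (asm) AE_distr_iff) auto
  then show ?thesis by eventually_elim auto
qed

lemma AE_uniform_sphere_dist_center:
  fixes a :: "'a::euclidean_space"
  assumes R: "R > 0"
  shows "AE y in uniform_sphere a R. dist y a = R"
proof -
  have "(\<integral>\<^sup>+y. indicator {y. dist y a \<noteq> R} y \<partial>uniform_sphere a R) = (\<integral>\<^sup>+y. indicator {y. dist y a \<noteq> R} (a + R *\<^sub>R y) \<partial>usphere)"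
    using R by (intro nn_integral_uniform_sphere) auto
  also have "\<dots> = (\<integral>\<^sup>+y. 0 \<partial>(usphere :: 'a measure))"
  proof (rule nn_integral_cong_AE)
    show "AE y in (usphere :: 'a measure). indicator {y. dist y a \<noteq> R} (a + R *\<^sub>R y) = (0::ennreal)"
      using AE_usphere_norm by eventually_elim (use R in \<open>simp add: dist_norm\<close>)
  qed
  finally have "emeasure (uniform_sphere a R) {y. dist y a \<noteq> R} = 0" by simp
  then show ?thesis by (subst AE_iff_null) (auto simp: null_sets_def)
qed

lemma uniform_sphere_mean:
  fixes a :: "'a::euclidean_space"
  assumes R: "R > 0"
  shows "(\<integral>y. y - a \<partial>uniform_sphere a R) = 0"
proof -
  have "distr (uniform_sphere a R) borel (\<lambda>y. 2 *\<^sub>R a - y) = uniform_sphere a R"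
  proof (rule measure_eqI)
    fix A assume "A \<in> sets (distr (uniform_sphere a R) borel (\<lambda>y. 2 *\<^sub>R a - y))"
    then have [measurable]: "A \<in> sets borel" by simp
    have "emeasure (distr (uniform_sphere a R) borel (\<lambda>y. 2 *\<^sub>R a - y)) A = (\<integral>\<^sup>+y. indicator A (2 *\<^sub>R a - y) \<partial>uniform_sphere a R)"
      by (simp add: nn_integral_distr flip: nn_integral_indicator)
    also have "\<dots> = (\<integral>\<^sup>+y. indicator A (2 *\<^sub>R a - (a + R *\<^sub>R y)) \<partial>usphere)"
      using R by (intro nn_integral_uniform_sphere) auto
    also have "\<dots> = (\<integral>\<^sup>+y. indicator A (a + R *\<^sub>R (- y)) \<partial>usphere)"
      by (intro nn_integral_cong) (simp add: scaleR_2)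
    also have "\<dots> = (\<integral>\<^sup>+y. indicator A (a + R *\<^sub>R y) \<partial>usphere)"
      by (rule nn_integral_usphere_uminus[of "\<lambda>y. indicator A (a + R *\<^sub>R y)"]) measurable
    also have "\<dots> = (\<integral>\<^sup>+y. indicator A y \<partial>uniform_sphere a R)"
      using R by (intro nn_integral_uniform_sphere[symmetric]) auto
    finally show "emeasure (distr (uniform_sphere a R) borel (\<lambda>y. 2 *\<^sub>R a - y)) A = emeasure (uniform_sphere a R) A" by simp
  qed simp
  then have "(\<integral>y. y - a \<partial>uniform_sphere a R) = (\<integral>y. y - a \<partial>distr (uniform_sphere a R) borel (\<lambda>y. 2 *\<^sub>R a - y))" by simp
  also have "\<dots> = (\<integral>y. (2 *\<^sub>R a - y) - a \<partial>uniform_sphere a R)" by (rule integral_distr) measurable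
  also have "\<dots> = (\<integral>y. - (y - a) \<partial>uniform_sphere a R)" by (simp add: scaleR_2 algebra_simps)
  also have "\<dots> = - (\<integral>y. y - a \<partial>uniform_sphere a R)" by (rule Bochner_Integration.integral_minus)
  finally have "2 *\<^sub>R (\<integral>y. y - a \<partial>uniform_sphere a R) = 0" by (simp add: scaleR_2 eq_neg_iff_add_eq_0)
  then show ?thesis by simp
qed

section \<open>The optimal radius and the values of the moments\<close>

lemma sphere_radius_pos:
  assumes "n \<ge> 2" "\<alpha> > 1 - real n" "\<beta> > 1 - real n"
  shows "sphere_radius n \<alpha> \<beta> > 0"
proof -
  have "Gamma ((real n + \<beta> - 1) / 2) > 0" "Gamma ((2 * real n + \<alpha> - 2) / 2) > 0"
    "Gamma ((real n + \<alpha> - 1) / 2) > 0" "Gamma ((2 * real n + \<beta> - 2) / 2) > 0"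
    using assms by (auto intro!: Gamma_real_pos)
  then show ?thesis unfolding sphere_radius_def by simp
qed

text \<open>The radius is the one at which the potential of the sphere has a vanishing radial derivative on
the sphere.\<close>

lemma sphere_radius_powr:
  assumes n: "n \<ge> 2" and g: "\<alpha> > 1 - real n" "\<beta> > 1 - real n" and "\<alpha> \<noteq> \<beta>"
  shows "sphere_radius n \<alpha> \<beta> powr (\<alpha> - \<beta>) = sphere_moment n \<beta> / sphere_moment n \<alpha>"
proof -
  define A where "A = Gamma ((real n + \<alpha> - 1) / 2)"
  define B where "B = Gamma ((real n + \<beta> - 1) / 2)"
  define A' where "A' = Gamma ((2 * real n + \<alpha> - 2) / 2)"
  define B' where "B' = Gamma ((2 * real n + \<beta> - 2) / 2)"
  define N where "N = Gamma (real n - 1)"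
  define N' where "N' = Gamma ((real n - 1) / 2)"
  have pos: "A > 0" "B > 0" "A' > 0" "B' > 0" "N > 0" "N' > 0"
    unfolding A_def B_def A'_def B'_def N_def N'_def using n g by (auto intro!: Gamma_real_pos)
  define Q where "Q = B * A' / (A * B')"
  have Q: "Q > 0" unfolding Q_def using pos by simp
  have "sphere_radius n \<alpha> \<beta> powr (\<alpha> - \<beta>) = (1 / 2) powr (\<alpha> - \<beta>) * (Q powr (1 / (\<alpha> - \<beta>))) powr (\<alpha> - \<beta>)"
    unfolding sphere_radius_def A_def[symmetric] B_def[symmetric] A'_def[symmetric] B'_def[symmetric] Q_def[symmetric]
    by (rule powr_mult)
  also have "(Q powr (1 / (\<alpha> - \<beta>))) powr (\<alpha> - \<beta>) = Q" using Q \<open>\<alpha> \<noteq> \<beta>\<close> by (simp add: powr_powr)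
  also have "(1 / 2) powr (\<alpha> - \<beta>) = 2 powr \<beta> / 2 powr \<alpha>" by (simp add: powr_divide powr_diff)
  finally have 1: "sphere_radius n \<alpha> \<beta> powr (\<alpha> - \<beta>) = 2 powr \<beta> / 2 powr \<alpha> * Q" .
  have e: "\<alpha> + real n - 1 = real n + \<alpha> - 1" "\<beta> + real n - 1 = real n + \<beta> - 1"
    "\<alpha> + 2 * real n - 2 = 2 * real n + \<alpha> - 2" "\<beta> + 2 * real n - 2 = 2 * real n + \<beta> - 2" by simp_all
  have "sphere_moment n \<beta> / sphere_moment n \<alpha> = (2 powr \<beta> * B * N / (N' * B')) / (2 powr \<alpha> * A * N / (N' * A'))"
    unfolding sphere_moment_def e A_def B_def A'_def B'_def N_def N'_def ..
  also have "\<dots> = 2 powr \<beta> / 2 powr \<alpha> * Q" unfolding Q_def using pos by (simp add: field_simps)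
  finally show ?thesis unfolding 1 ..
qed

text \<open>Legendre's duplication formula at \<open>(n - 1) / 2\<close> replaces \<open>\<Gamma>(n - 1) / \<Gamma>((n - 1) / 2)\<close> by a multiple of
\<open>\<Gamma>(n / 2)\<close>.\<close>

lemma sphere_moment_duplication:
  assumes n: "n \<ge> 2"
  shows "sphere_moment n \<alpha> / 2 = pi powr (- 1 / 2) * 2 powr (real n + \<alpha> - 3) *
     (Gamma (real n / 2) * Gamma ((real n + \<alpha> - 1) / 2) / Gamma ((2 * real n + \<alpha> - 2) / 2))"
proof -
  define z where "z = (real n - 1) / 2"
  have z: "z > 0" using n by (simp add: z_def)
  have half: "z + 1 / 2 = real n / 2" "2 * z = real n - 1" by (simp_all add: z_def field_simps)
  have cz: "complex_of_real z \<notin> \<int>\<^sub>\<le>\<^sub>0" "complex_of_real z + 1 / 2 \<notin> \<int>\<^sub>\<le>\<^sub>0"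
  proof -
    have r: "complex_of_real x \<notin> \<int>\<^sub>\<le>\<^sub>0" if "x > 0" for x
      using that by (auto simp: of_real_in_nonpos_Ints_iff dest: nonpos_Ints_nonpos)
    show "complex_of_real z \<notin> \<int>\<^sub>\<le>\<^sub>0" by (rule r[OF z])
    have "complex_of_real (z + 1 / 2) \<notin> \<int>\<^sub>\<le>\<^sub>0" by (rule r) (use z in simp)
    then show "complex_of_real z + 1 / 2 \<notin> \<int>\<^sub>\<le>\<^sub>0" by simp
  qed
  have "Gamma (complex_of_real z) * Gamma (complex_of_real z + 1 / 2) =
     exp ((1 - 2 * complex_of_real z) * of_real (ln 2)) * of_real (sqrt pi) * Gamma (2 * complex_of_real z)"
    by (rule Gamma_legendre_duplication[OF cz])
  also have "\<dots> = complex_of_real (exp ((1 - 2 * z) * ln 2) * sqrt pi * Gamma (2 * z))"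
    by (simp add: Gamma_complex_of_real[symmetric] exp_of_real[symmetric])
  also have "Gamma (complex_of_real z) * Gamma (complex_of_real z + 1 / 2) = complex_of_real (Gamma z * Gamma (z + 1 / 2))"
    by (simp add: Gamma_complex_of_real[symmetric])
  finally have "Gamma z * Gamma (z + 1 / 2) = exp ((1 - 2 * z) * ln 2) * sqrt pi * Gamma (2 * z)"
    by (simp only: of_real_eq_iff)
  then have dup: "Gamma z * Gamma (real n / 2) = 2 powr (2 - real n) * sqrt pi * Gamma (real n - 1)"
    unfolding half by (simp add: powr_def algebra_simps)
  define G where "G = Gamma ((2 * real n + \<alpha> - 2) / 2)"
  define A where "A = Gamma ((real n + \<alpha> - 1) / 2)"
  have gz: "Gamma z > 0" using z by (rule Gamma_real_pos)
  have e: "(\<alpha> + real n - 1) / 2 = (real n + \<alpha> - 1) / 2" "(\<alpha> + 2 * real n - 2) / 2 = (2 * real n + \<alpha> - 2) / 2" by simp_all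
  have N: "Gamma (real n - 1) / Gamma z = 2 powr (real n - 2) * Gamma (real n / 2) / sqrt pi"
  proof -
    have "2 powr (real n - 2) * (Gamma z * Gamma (real n / 2)) = (2 powr (real n - 2) * 2 powr (2 - real n)) * sqrt pi * Gamma (real n - 1)"
      unfolding dup by simp
    also have "2 powr (real n - 2) * 2 powr (2 - real n) = (1::real)" unfolding powr_add[symmetric] by simp
    finally have h: "2 powr (real n - 2) * (Gamma z * Gamma (real n / 2)) = 1 * sqrt pi * Gamma (real n - 1)" .
    have "g1 / gz = p * gh / s" if "p * (gz * gh) = 1 * s * g1" "gz > 0" "s > 0" for g1 gz p gh s :: real
      using that by (simp add: field_simps)
    from this[OF h gz] show ?thesis by simp
  qed
  have "sphere_moment n \<alpha> / 2 = 2 powr \<alpha> * A * (Gamma (real n - 1) / Gamma z) / G / 2"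
  proof -
    have "t * A * g1 / (gz * G) / 2 = t * A * (g1 / gz) / G / 2" for t g1 gz :: real by simp
    then show ?thesis unfolding sphere_moment_def e A_def[symmetric] G_def[symmetric] z_def[symmetric] .
  qed
  also have "\<dots> = (1 / sqrt pi) * (2 powr \<alpha> * 2 powr (real n - 2) / 2) * (Gamma (real n / 2) * A / G)"
  proof -
    have "t * A * (p * g / s) / G / 2 = (1 / s) * (t * p / 2) * (g * A / G)" for t p g s :: real
      by (simp add: ac_simps)
    then show ?thesis unfolding N .
  qed
  also have "2 powr \<alpha> * 2 powr (real n - 2) / 2 = 2 powr (real n + \<alpha> - 3)"
  proof -
    have e: "\<alpha> + (real n - 2) - 1 = real n + \<alpha> - 3" by simp
    have "2 powr \<alpha> * 2 powr (real n - 2) / 2 powr 1 = 2 powr (real n + \<alpha> - 3)"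
      unfolding powr_add[symmetric] powr_diff[symmetric] e ..
    moreover have "(2::real) powr 1 = 2" by simp
    ultimately show ?thesis by (simp only:)
  qed
  also have "1 / sqrt pi = pi powr (- 1 / 2)"
  proof -
    have h: "- 1 / 2 = - (1 / 2 :: real)" by simp
    have "pi powr (1 / 2) = sqrt pi" by (rule powr_half_sqrt) simp
    then show ?thesis unfolding h powr_minus by (simp only: inverse_eq_divide)
  qed
  finally show ?thesis unfolding A_def G_def .
qed

text \<open>The logarithmic moment \<open>L\<close> is the derivative of \<open>sphere_moment n\<close> at \<open>0\<close>. Instead of differentiating the
singular integral, average \<open>1 + \<gamma> ln s \<le> s powr \<gamma>\<close>: it says that \<open>sphere_moment n \<gamma> - \<gamma> L\<close> has a
minimum at \<open>\<gamma> = 0\<close>, and the derivative of the gamma quotient is known.\<close>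

lemma sphere_log_moment:
  assumes n: "n \<ge> 2"
  shows "Pot n 0 1 = ln 2 + (Digamma ((real n - 1) / 2) - Digamma (real n - 1)) / 2"
proof -
  interpret prob_space "angle_measure n" by (rule prob_space_angle_measure)
  define L where "L = Pot n 0 1"
  define g where "g \<gamma> = sphere_moment n \<gamma> - \<gamma> * L" for \<gamma>
  have npos: "(real n - 1) / 2 \<notin> \<int>\<^sub>\<le>\<^sub>0" "real n - 1 \<notin> \<int>\<^sub>\<le>\<^sub>0" using n by (auto dest: nonpos_Ints_nonpos)
  have G: "Gamma ((real n - 1) / 2) > 0" "Gamma (real n - 1) > 0" using n by (auto intro!: Gamma_real_pos)
  define D where "D = ln 2 + (Digamma ((real n - 1) / 2) - Digamma (real n - 1)) / 2"
  have "(sphere_moment n has_real_derivative D) (at 0)"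
  proof -
    define K where "K = Gamma (real n - 1) / Gamma ((real n - 1) / 2)"
    have eq: "sphere_moment n = (\<lambda>\<gamma>. K * (2 powr \<gamma> * (Gamma ((\<gamma> + real n - 1) / 2) / Gamma ((\<gamma> + 2 * real n - 2) / 2))))"
      by (auto simp: sphere_moment_def K_def)
    have d1: "((\<lambda>\<gamma>. Gamma ((\<gamma> + real n - 1) / 2)) has_real_derivative
        Gamma ((real n - 1) / 2) * Digamma ((real n - 1) / 2) * (1 / 2)) (at 0)"
    proof -
      have l: "((\<lambda>\<gamma>. (\<gamma> + real n - 1) / 2) has_real_derivative 1 / 2) (at 0)"
        by (auto intro!: derivative_eq_intros)
      have "(Gamma has_real_derivative Gamma ((0 + real n - 1) / 2) * Digamma ((0 + real n - 1) / 2)) (at ((0 + real n - 1) / 2))"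
        using npos by (intro has_field_derivative_Gamma) simp
      from DERIV_chain2[OF this l] show ?thesis by simp
    qed
    have d2: "((\<lambda>\<gamma>. Gamma ((\<gamma> + 2 * real n - 2) / 2)) has_real_derivative
        Gamma (real n - 1) * Digamma (real n - 1) * (1 / 2)) (at 0)"
    proof -
      have l: "((\<lambda>\<gamma>. (\<gamma> + 2 * real n - 2) / 2) has_real_derivative 1 / 2) (at 0)"
        by (auto intro!: derivative_eq_intros)
      have h: "(0 + 2 * real n - 2) / 2 = real n - 1" by simp
      have "(Gamma has_real_derivative Gamma (real n - 1) * Digamma (real n - 1)) (at ((0 + 2 * real n - 2) / 2))"
        unfolding h using npos by (intro has_field_derivative_Gamma) simp
      from DERIV_chain2[OF this l] show ?thesis .
    qed
    have d3: "((\<lambda>\<gamma>. 2 powr \<gamma>) has_real_derivative ln 2) (at (0::real))"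
      by (auto intro!: derivative_eq_intros)
    have h: "(0 + 2 * real n - 2) / 2 = real n - 1" "(0 + real n - 1) / 2 = (real n - 1) / 2" by simp_all
    have nz: "Gamma ((0 + 2 * real n - 2) / 2) \<noteq> 0" unfolding h using G by simp
    note dd = DERIV_cmult[OF DERIV_mult[OF d3 DERIV_divide[OF d1 d2 nz]], of K]
    show ?thesis
      unfolding eq
    proof (rule DERIV_cong[OF dd], unfold h)
      have "K * (l * (x / y) + (x * dx * (1 / 2) * y - x * (y * dy * (1 / 2))) / (y * y) * 1) = l + (dx - dy) / 2"
        if "K = y / x" "x > 0" "y > 0" for l x y dx dy :: real
        using that(2,3) unfolding that(1) by (simp add: field_simps)
      from this[OF K_def G] show "K * (ln 2 * (Gamma ((real n - 1) / 2) / Gamma (real n - 1)) +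
          (Gamma ((real n - 1) / 2) * Digamma ((real n - 1) / 2) * (1 / 2) * Gamma (real n - 1) -
           Gamma ((real n - 1) / 2) * (Gamma (real n - 1) * Digamma (real n - 1) * (1 / 2))) /
          (Gamma (real n - 1) * Gamma (real n - 1)) * 2 powr 0) = D" by (simp add: D_def)
    qed
  qed
  then have der: "(g has_real_derivative D - L) (at 0)"
    unfolding g_def[abs_def] by (auto intro!: derivative_eq_intros)
  have min: "g 0 \<le> g \<gamma>" if \<gamma>: "\<bar>\<gamma>\<bar> < 1" for \<gamma>
  proof -
    have g1: "\<gamma> > 1 - real n" using \<gamma> n by linarith
    have g0: "(0::real) > 1 - real n" using n by simp
    have iL: "integrable (angle_measure n) (\<lambda>\<theta>. ln (sqrt (chord2 1 \<theta>)))"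
      using integrable_power_potential_chord[OF n g0, of 1] by (simp add: power_potential_def)
    have "1 + \<gamma> * L = (\<integral>\<theta>. 1 + \<gamma> * ln (sqrt (chord2 1 \<theta>)) \<partial>angle_measure n)"
      using iL prob_space by (simp add: L_def Pot_def power_potential_def)
    also have "\<dots> \<le> (\<integral>\<theta>. chord2 1 \<theta> powr (\<gamma> / 2) \<partial>angle_measure n)"
    proof (rule integral_mono_AE)
      show "integrable (angle_measure n) (\<lambda>\<theta>. 1 + \<gamma> * ln (sqrt (chord2 1 \<theta>)))" using iL by simp
      show "integrable (angle_measure n) (\<lambda>\<theta>. chord2 1 \<theta> powr (\<gamma> / 2))" by (rule integrable_chord2_1[OF n g1])
      show "AE \<theta> in angle_measure n. 1 + \<gamma> * ln (sqrt (chord2 1 \<theta>)) \<le> chord2 1 \<theta> powr (\<gamma> / 2)"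
        using chord2_pos_AE[where n=n and r=1]
      proof eventually_elim
        case (elim \<theta>)
        have "1 + \<gamma> / 2 * ln (chord2 1 \<theta>) \<le> exp (\<gamma> / 2 * ln (chord2 1 \<theta>))" by (rule exp_ge_add_one_self)
        then show ?case using elim by (simp add: powr_def ln_sqrt)
      qed
    qed
    also have "\<dots> = sphere_moment n \<gamma>" using Psi_1[OF n g1] by (simp add: Psi_def)
    finally have "1 \<le> g \<gamma>" by (simp add: g_def)
    moreover have "g 0 = 1"
    proof -
      have e: "(0 + real n - 1) / 2 = (real n - 1) / 2" "(0 + 2 * real n - 2) / 2 = real n - 1" by simp_all
      show ?thesis using G unfolding g_def sphere_moment_def e by simp
    qed
    ultimately show ?thesis by simp
  qed
  have "D - L = 0"
    by (rule DERIV_local_min[OF der, of 1]) (use min in auto)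
  then show ?thesis by (simp add: D_def L_def)
qed

section \<open>Measures of finite energy\<close>

abbreviation kernel_profile :: "real \<Rightarrow> real \<Rightarrow> real \<Rightarrow> real" where
  "kernel_profile \<alpha> \<beta> \<equiv> (\<lambda>\<rho>. power_potential \<alpha> \<rho> - power_potential \<beta> \<rho>)"

lemma power_potential_0 [simp]: "power_potential \<gamma> 0 = 0"
  by (simp add: power_potential_def)

lemma power_potential_nonneg: "\<gamma> > 0 \<Longrightarrow> power_potential \<gamma> \<rho> \<ge> 0"
  by (simp add: power_potential_def)

text \<open>Half of the attractive term is kept, so that finite energy also controls the moment of order \<open>\<alpha>\<close>.\<close>

lemma kernel_profile_lower_bound:
  assumes \<alpha>: "\<alpha> > 0" and \<beta>: "\<beta> < \<alpha>"
  shows "\<exists>c\<ge>0. \<forall>\<rho>\<ge>0. power_potential \<alpha> \<rho> / 2 - c \<le> kernel_profile \<alpha> \<beta> \<rho>"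
proof -
  define q where "q \<rho> = power_potential \<alpha> \<rho> / 2 - power_potential \<beta> \<rho>" for \<rho>
  \<comment> \<open>The only critical point of \<open>q\<close>, where \<open>\<rho> powr (\<alpha> - \<beta>) = 2\<close>.\<close>
  define \<rho>0 where "\<rho>0 = 2 powr (1 / (\<alpha> - \<beta>))"
  have \<rho>0: "\<rho>0 > 0" by (simp add: \<rho>0_def)
  have \<rho>0p: "\<rho>0 powr (\<alpha> - \<beta>) = 2" using \<beta> by (simp add: \<rho>0_def powr_powr)
  have der: "(q has_real_derivative (t powr (\<beta> - 1) * (t powr (\<alpha> - \<beta>) - 2) / 2)) (at t)" if t: "t > 0" for t
  proof -
    have "(q has_real_derivative (t powr (\<alpha> - 1) / 2 - t powr (\<beta> - 1))) (at t)"
      unfolding q_def[abs_def] by (intro DERIV_diff DERIV_cdivide DERIV_power_potential t)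
    moreover have "t powr (\<alpha> - 1) = t powr (\<beta> - 1) * t powr (\<alpha> - \<beta>)" unfolding powr_add[symmetric] by simp
    moreover have "p * q / 2 - p = p * (q - 2) / 2" for p q :: real by (simp add: field_simps)
    ultimately show ?thesis by (simp only:)
  qed
  have min: "q \<rho>0 \<le> q \<rho>" if \<rho>: "\<rho> > 0" for \<rho>
  proof (cases "\<rho> \<le> \<rho>0")
    case True
    show ?thesis
    proof (rule DERIV_nonpos_imp_nonincreasing[where f=q and a=\<rho> and b=\<rho>0])
      fix t assume t: "\<rho> \<le> t" "t \<le> \<rho>0"
      have "t powr (\<alpha> - \<beta>) \<le> 2" unfolding \<rho>0p[symmetric] using t \<rho> \<beta> by (intro powr_mono2) auto
      then have "t powr (\<beta> - 1) * (t powr (\<alpha> - \<beta>) - 2) / 2 \<le> 0" by (simp add: mult_nonneg_nonpos)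
      moreover have "t > 0" using t \<rho> by linarith
      ultimately show "\<exists>y. DERIV q t :> y \<and> y \<le> 0" using der by blast
    qed (rule True)
  next
    case False
    show ?thesis
    proof (rule DERIV_nonneg_imp_nondecreasing[where f=q and a=\<rho>0 and b=\<rho>])
      fix t assume t: "\<rho>0 \<le> t" "t \<le> \<rho>"
      have "2 \<le> t powr (\<alpha> - \<beta>)" unfolding \<rho>0p[symmetric] using t \<rho>0 \<beta> by (intro powr_mono2) auto
      then have "t powr (\<beta> - 1) * (t powr (\<alpha> - \<beta>) - 2) / 2 \<ge> 0" by simp
      moreover have "t > 0" using t \<rho>0 by linarith
      ultimately show "\<exists>y. DERIV q t :> y \<and> y \<ge> 0" using der by blast
    qed (use False in simp)
  qed
  show ?thesis
  proof (intro exI[of _ "max 0 (- q \<rho>0)"] conjI allI impI)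
    fix \<rho> :: real assume "\<rho> \<ge> 0"
    then consider "\<rho> = 0" | "\<rho> > 0" by linarith
    then have "q \<rho> \<ge> - max 0 (- q \<rho>0)"
    proof cases
      case 2
      then show ?thesis using min[of \<rho>] by (simp add: max_def)
    qed (simp add: q_def)
    then show "power_potential \<alpha> \<rho> / 2 - max 0 (- q \<rho>0) \<le> kernel_profile \<alpha> \<beta> \<rho>"
      unfolding q_def by simp
  qed simp
qed

lemma pair_integrable_split:
  assumes \<alpha>: "\<alpha> > 0" and \<beta>: "\<beta> < \<alpha>"
    and A: "prob_space A" "sets A = sets borel" and B: "prob_space B" "sets B = sets borel"
    and k: "pair_integrable (kernel_profile \<alpha> \<beta>) A B"
  shows "pair_integrable (power_potential \<alpha>) A B" and "pair_integrable (power_potential \<beta>) A B"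
proof -
  interpret A: prob_space A by fact
  interpret B: prob_space B by fact
  interpret AB: pair_prob_space A B ..
  note [measurable_cong] = A(2) B(2)
  obtain c where c: "c \<ge> 0" "\<And>\<rho>. \<rho> \<ge> 0 \<Longrightarrow> power_potential \<alpha> \<rho> / 2 - c \<le> kernel_profile \<alpha> \<beta> \<rho>"
    using kernel_profile_lower_bound[OF \<alpha> \<beta>] by auto
  have "integrable (A \<Otimes>\<^sub>M B) (\<lambda>z. 2 * (kernel_profile \<alpha> \<beta> (dist (fst z) (snd z)) + c))"
    by (intro integrable_mult_right Bochner_Integration.integrable_add k) simp
  then show i: "pair_integrable (power_potential \<alpha>) A B"
  proof (rule Bochner_Integration.integrable_bound)
    show "AE z in A \<Otimes>\<^sub>M B. norm (power_potential \<alpha> (dist (fst z) (snd z))) \<le> norm (2 * (kernel_profile \<alpha> \<beta> (dist (fst z) (snd z)) + c))"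
    proof (rule AE_I2)
      fix z
      have "0 \<le> power_potential \<alpha> (dist (fst z) (snd z))" by (rule power_potential_nonneg[OF \<alpha>])
      then show "norm (power_potential \<alpha> (dist (fst z) (snd z))) \<le> norm (2 * (kernel_profile \<alpha> \<beta> (dist (fst z) (snd z)) + c))"
        using c(2)[of "dist (fst z) (snd z)"] by simp
    qed
  qed measurable
  show "pair_integrable (power_potential \<beta>) A B"
    using Bochner_Integration.integrable_diff[OF i k] by simp
qed

lemma ereal_integral_eq_integral:
  assumes g: "integrable M g" and eq: "AE x in M. f x = ereal (g x)"
  shows "ereal_integral M f = ereal (\<integral>x. g x \<partial>M)"
proof -
  have p: "(\<integral>\<^sup>+x. e2ennreal (f x) \<partial>M) = (\<integral>\<^sup>+x. ennreal (g x) \<partial>M)"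
    by (rule nn_integral_cong_AE) (use eq in eventually_elim, simp)
  have m: "(\<integral>\<^sup>+x. e2ennreal (- f x) \<partial>M) = (\<integral>\<^sup>+x. ennreal (- g x) \<partial>M)"
    by (rule nn_integral_cong_AE) (use eq in eventually_elim, simp)
  have fin: "(\<integral>\<^sup>+x. ennreal (g x) \<partial>M) \<noteq> \<infinity>" "(\<integral>\<^sup>+x. ennreal (- g x) \<partial>M) \<noteq> \<infinity>"
    using g by (auto simp: real_integrable_def)
  have e: "enn2ereal X = ereal (enn2real X)" if "X \<noteq> \<infinity>" for X
    using that by (cases X) auto
  show ?thesis
    unfolding ereal_integral_def p m e[OF fin(1)] e[OF fin(2)] real_lebesgue_integral_def[OF g] by simp
qed

lemma energy_eq_pair_int:
  fixes \<mu> :: "'a::euclidean_space measure"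
  assumes \<mu>: "prob_space \<mu>" "sets \<mu> = sets borel"
    and k: "pair_integrable (kernel_profile \<alpha> \<beta>) \<mu> \<mu>"
    and diag: "\<beta> \<le> 0 \<Longrightarrow> AE z in \<mu> \<Otimes>\<^sub>M \<mu>. fst z \<noteq> snd z"
  shows "energy \<alpha> \<beta> \<mu> = ereal (pair_int (kernel_profile \<alpha> \<beta>) \<mu> \<mu> / 2)"
proof -
  have "AE z in \<mu> \<Otimes>\<^sub>M \<mu>. (case z of (x, y) \<Rightarrow> kernel \<alpha> \<beta> x y) = ereal (kernel_profile \<alpha> \<beta> (dist (fst z) (snd z)))"
  proof (cases "\<beta> \<le> 0")
    case True
    show ?thesis using diag[OF True] by eventually_elim (simp add: kernel_def case_prod_beta)
  qed (simp add: kernel_def case_prod_beta)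
  from ereal_integral_eq_integral[OF k this] show ?thesis
    unfolding energy_def pair_int_def by simp
qed

text \<open>The negative part of the kernel is bounded, so finite energy bounds its positive part. The value \<open>\<infinity>\<close> on
the diagonal for \<open>\<beta> \<le> 0\<close> forces the diagonal to be a null set.\<close>

lemma finite_energyD:
  fixes \<mu> :: "'a::euclidean_space measure"
  assumes \<alpha>: "\<alpha> > 0" and \<beta>: "\<beta> < \<alpha>" and \<mu>: "prob_space \<mu>" "sets \<mu> = sets borel"
    and fin: "energy \<alpha> \<beta> \<mu> < \<infinity>"
  shows "pair_integrable (kernel_profile \<alpha> \<beta>) \<mu> \<mu>" and "\<beta> \<le> 0 \<Longrightarrow> AE z in \<mu> \<Otimes>\<^sub>M \<mu>. fst z \<noteq> snd z"
proof -
  interpret \<mu>: prob_space \<mu> by fact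
  interpret MM: pair_prob_space \<mu> \<mu> ..
  note [measurable_cong] = \<mu>(2)
  let ?k = "\<lambda>z::'a \<times> 'a. kernel_profile \<alpha> \<beta> (dist (fst z) (snd z))"
  let ?K = "\<lambda>z::'a \<times> 'a. case z of (x, y) \<Rightarrow> kernel \<alpha> \<beta> x y"
  obtain c where c: "c \<ge> 0" "\<And>\<rho>. \<rho> \<ge> 0 \<Longrightarrow> power_potential \<alpha> \<rho> / 2 - c \<le> kernel_profile \<alpha> \<beta> \<rho>"
    using kernel_profile_lower_bound[OF \<alpha> \<beta>] by auto
  have kc: "?k z \<ge> - c" for z
    using c(2)[of "dist (fst z) (snd z)"] power_potential_nonneg[OF \<alpha>, of "dist (fst z) (snd z)"] by simp
  have K: "?K z = (if fst z = snd z \<and> \<beta> \<le> 0 then \<infinity> else ereal (?k z))" for z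
    by (simp add: kernel_def case_prod_beta)
  have one: "emeasure (\<mu> \<Otimes>\<^sub>M \<mu>) (space (\<mu> \<Otimes>\<^sub>M \<mu>)) = 1" by (rule MM.P.emeasure_space_1)
  have neg: "(\<integral>\<^sup>+z. e2ennreal (- ?K z) \<partial>(\<mu> \<Otimes>\<^sub>M \<mu>)) < \<infinity>"
  proof -
    have "(\<integral>\<^sup>+z. e2ennreal (- ?K z) \<partial>(\<mu> \<Otimes>\<^sub>M \<mu>)) \<le> (\<integral>\<^sup>+z. ennreal c \<partial>(\<mu> \<Otimes>\<^sub>M \<mu>))"
    proof (rule nn_integral_mono)
      fix z :: "'a \<times> 'a"
      have "ennreal (- ?k z) \<le> ennreal c" using kc[of z] by (intro ennreal_leI) linarith
      then show "e2ennreal (- ?K z) \<le> ennreal c" unfolding K by (auto simp: e2ennreal_neg)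
    qed
    also have "\<dots> = ennreal c" by (simp add: one)
    finally show ?thesis by (rule le_less_trans) simp
  qed
  have pos: "(\<integral>\<^sup>+z. e2ennreal (?K z) \<partial>(\<mu> \<Otimes>\<^sub>M \<mu>)) < \<infinity>"
  proof (rule ccontr)
    assume "\<not> ?thesis"
    then have inf: "(\<integral>\<^sup>+z. e2ennreal (?K z) \<partial>(\<mu> \<Otimes>\<^sub>M \<mu>)) = \<infinity>" by (simp add: not_less top_unique)
    obtain r where r: "(\<integral>\<^sup>+z. e2ennreal (- ?K z) \<partial>(\<mu> \<Otimes>\<^sub>M \<mu>)) = ennreal r" "r \<ge> 0"
      using neg by (cases "\<integral>\<^sup>+z. e2ennreal (- ?K z) \<partial>(\<mu> \<Otimes>\<^sub>M \<mu>)") auto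
    have "energy \<alpha> \<beta> \<mu> = \<infinity>" unfolding energy_def ereal_integral_def inf r(1) using r(2) by simp
    then show False using fin by simp
  qed
  have "(\<integral>\<^sup>+z. ennreal (?k z) \<partial>(\<mu> \<Otimes>\<^sub>M \<mu>)) \<le> (\<integral>\<^sup>+z. e2ennreal (?K z) \<partial>(\<mu> \<Otimes>\<^sub>M \<mu>))"
    by (rule nn_integral_mono) (simp add: K)
  then have kp: "(\<integral>\<^sup>+z. ennreal (?k z) \<partial>(\<mu> \<Otimes>\<^sub>M \<mu>)) < \<infinity>" using pos by (rule le_less_trans)
  have "(\<integral>\<^sup>+z. ennreal (norm (?k z)) \<partial>(\<mu> \<Otimes>\<^sub>M \<mu>)) \<le> (\<integral>\<^sup>+z. ennreal (?k z) + ennreal c \<partial>(\<mu> \<Otimes>\<^sub>M \<mu>))"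
  proof (rule nn_integral_mono)
    fix z :: "'a \<times> 'a"
    show "ennreal (norm (?k z)) \<le> ennreal (?k z) + ennreal c"
    proof (cases "?k z \<ge> 0")
      case True
      then show ?thesis by simp
    next
      case False
      then have "ennreal (norm (?k z)) \<le> ennreal c" using kc[of z] by (intro ennreal_leI) simp
      also have "\<dots> \<le> ennreal (?k z) + ennreal c" by simp
      finally show ?thesis .
    qed
  qed
  also have "\<dots> = (\<integral>\<^sup>+z. ennreal (?k z) \<partial>(\<mu> \<Otimes>\<^sub>M \<mu>)) + ennreal c"
    by (subst nn_integral_add) (simp_all add: one)
  also have "\<dots> < \<infinity>" using kp by simp
  finally show "pair_integrable (kernel_profile \<alpha> \<beta>) \<mu> \<mu>"
    by (intro integrableI_bounded) measurable
  assume b: "\<beta> \<le> 0"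
  define D where "D = {z \<in> space (\<mu> \<Otimes>\<^sub>M \<mu>). dist (fst z) (snd z) = 0}"
  have [measurable]: "D \<in> sets (\<mu> \<Otimes>\<^sub>M \<mu>)" unfolding D_def by measurable
  have "(\<integral>\<^sup>+z. \<infinity> * indicator D z \<partial>(\<mu> \<Otimes>\<^sub>M \<mu>)) \<le> (\<integral>\<^sup>+z. e2ennreal (?K z) \<partial>(\<mu> \<Otimes>\<^sub>M \<mu>))"
    by (rule nn_integral_mono) (use b in \<open>auto simp: K D_def indicator_def\<close>)
  then have "\<infinity> * emeasure (\<mu> \<Otimes>\<^sub>M \<mu>) D < \<infinity>"
    using pos by (subst (asm) nn_integral_cmult_indicator) (auto intro: le_less_trans)
  then have "emeasure (\<mu> \<Otimes>\<^sub>M \<mu>) D = 0" by (simp add: ennreal_top_mult split: if_splits)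
  then show "AE z in \<mu> \<Otimes>\<^sub>M \<mu>. fst z \<noteq> snd z"
    by (subst AE_iff_null) (auto simp: null_sets_def D_def)
qed

lemma powr_sum_bound:
  fixes u v \<alpha> :: real
  assumes "0 \<le> u" "0 \<le> v" "0 \<le> \<alpha>"
  shows "(u + v) powr \<alpha> \<le> 2 powr \<alpha> * (u powr \<alpha> + v powr \<alpha>)"
proof -
  have "(u + v) powr \<alpha> \<le> (2 * max u v) powr \<alpha>" using assms by (intro powr_mono2) auto
  also have "\<dots> = 2 powr \<alpha> * max u v powr \<alpha>" by (rule powr_mult)
  also have "max u v powr \<alpha> \<le> u powr \<alpha> + v powr \<alpha>" by (simp add: max_def)
  finally show ?thesis by simp
qed

text \<open>By Fubini the moment about almost every \<open>x0\<close> is finite, and the triangle inequality moves it to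
any other point.\<close>

lemma finite_moment:
  fixes \<mu> :: "'a::euclidean_space measure"
  assumes \<alpha>: "\<alpha> > 0" and \<mu>: "prob_space \<mu>" "sets \<mu> = sets borel"
    and i: "pair_integrable (power_potential \<alpha>) \<mu> \<mu>"
  shows "integrable \<mu> (\<lambda>x. dist x a powr \<alpha>)"
proof -
  interpret \<mu>: prob_space \<mu> by fact
  interpret MM: pair_prob_space \<mu> \<mu> ..
  note [measurable_cong] = \<mu>(2)
  have "AE x in \<mu>. integrable \<mu> (\<lambda>y. power_potential \<alpha> (dist x y))"
    using MM.AE_integrable_fst'[OF i] by simp
  then obtain x0 where x0: "integrable \<mu> (\<lambda>y. power_potential \<alpha> (dist x0 y))"
    using eventually_happens'[OF \<mu>.ae_filter_bot] by blast
  have "integrable \<mu> (\<lambda>y. \<alpha> * power_potential \<alpha> (dist x0 y))" by (rule integrable_mult_right[OF x0])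
  then have x1: "integrable \<mu> (\<lambda>y. dist x0 y powr \<alpha>)" using \<alpha> by (simp add: power_potential_def)
  have "integrable \<mu> (\<lambda>y. 2 powr \<alpha> * (dist x0 y powr \<alpha> + dist x0 a powr \<alpha>))"
    by (intro integrable_mult_right Bochner_Integration.integrable_add x1) simp
  then show ?thesis
  proof (rule Bochner_Integration.integrable_bound)
    show "AE y in \<mu>. norm (dist y a powr \<alpha>) \<le> norm (2 powr \<alpha> * (dist x0 y powr \<alpha> + dist x0 a powr \<alpha>))"
    proof (rule AE_I2)
      fix y :: 'a
      have "dist y a \<le> dist x0 y + dist x0 a" by (rule dist_triangle3)
      then have "dist y a powr \<alpha> \<le> (dist x0 y + dist x0 a) powr \<alpha>" using \<alpha> by (intro powr_mono2) auto
      also have "\<dots> \<le> 2 powr \<alpha> * (dist x0 y powr \<alpha> + dist x0 a powr \<alpha>)" using \<alpha> by (intro powr_sum_bound) auto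
      finally show "norm (dist y a powr \<alpha>) \<le> norm (2 powr \<alpha> * (dist x0 y powr \<alpha> + dist x0 a powr \<alpha>))" by simp
    qed
  qed measurable
qed

lemma square_le_powr: "0 \<le> u \<Longrightarrow> 2 \<le> \<alpha> \<Longrightarrow> u\<^sup>2 \<le> 1 + u powr \<alpha>" for u \<alpha> :: real
proof (cases "u \<le> 1")
  case True
  assume "0 \<le> u"
  then have "u\<^sup>2 \<le> 1" using True by (simp add: power_le_one)
  then show ?thesis using powr_ge_zero[of u \<alpha>] by linarith
next
  case False
  assume "2 \<le> \<alpha>"
  then have "u powr 2 \<le> u powr \<alpha>" using False by (intro powr_mono) auto
  then show ?thesis using False by simp
qed

lemma
  fixes \<mu> :: "'a::euclidean_space measure"
  assumes \<mu>: "prob_space \<mu>" "sets \<mu> = sets borel" and \<alpha>: "2 \<le> \<alpha>" and m: "integrable \<mu> (\<lambda>x. dist x a powr \<alpha>)"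
  shows second_moment: "integrable \<mu> (\<lambda>x. (dist x a)\<^sup>2)" and first_moment: "integrable \<mu> (\<lambda>x. x - a)"
proof -
  interpret \<mu>: prob_space \<mu> by fact
  note [measurable_cong] = \<mu>(2)
  have "integrable \<mu> (\<lambda>x. 1 + dist x a powr \<alpha>)" using m by simp
  then show s: "integrable \<mu> (\<lambda>x. (dist x a)\<^sup>2)"
  proof (rule Bochner_Integration.integrable_bound)
    show "AE x in \<mu>. norm ((dist x a)\<^sup>2) \<le> norm (1 + dist x a powr \<alpha>)"
    proof (rule AE_I2)
      fix x :: 'a
      have "(dist x a)\<^sup>2 \<le> 1 + dist x a powr \<alpha>" by (rule square_le_powr[OF zero_le_dist \<alpha>])
      then show "norm ((dist x a)\<^sup>2) \<le> norm (1 + dist x a powr \<alpha>)" by simp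
    qed
  qed measurable
  have "integrable \<mu> (\<lambda>x. 1 + (dist x a)\<^sup>2)" using s by simp
  then show "integrable \<mu> (\<lambda>x. x - a)"
  proof (rule Bochner_Integration.integrable_bound)
    show "AE x in \<mu>. norm (x - a) \<le> norm (1 + (dist x a)\<^sup>2)"
    proof (rule AE_I2)
      fix x :: 'a
      have "0 \<le> (dist x a - 1)\<^sup>2" by simp
      then have "2 * dist x a \<le> 1 + (dist x a)\<^sup>2" by (simp add: power2_eq_square algebra_simps)
      then have "dist x a \<le> 1 + (dist x a)\<^sup>2" using zero_le_dist[of x a] by linarith
      then show "norm (x - a) \<le> norm (1 + (dist x a)\<^sup>2)" by (simp add: dist_norm)
    qed
  qed measurable
qed

text \<open>Expand \<open>(dist x y)\<^sup>2\<close> about \<open>a\<close>; the cross term vanishes after integration over \<open>B\<close>, whose mean is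
\<open>a\<close>. Hence \<open>defect\<close> of the squared distance vanishes for two measures with the same mean.\<close>

lemma
  fixes A B :: "'a::euclidean_space measure"
  assumes A: "prob_space A" "sets A = sets borel" and B: "prob_space B" "sets B = sets borel"
    and sA: "integrable A (\<lambda>x. (dist x a)\<^sup>2)" and sB: "integrable B (\<lambda>x. (dist x a)\<^sup>2)"
    and iB: "integrable B (\<lambda>x. x - a)" and mB: "(\<integral>x. x - a \<partial>B) = 0"
  shows pair_integrable_square: "pair_integrable (\<lambda>\<rho>. \<rho>\<^sup>2) A B"
    and pair_int_square: "pair_int (\<lambda>\<rho>. \<rho>\<^sup>2) A B = (\<integral>x. (dist x a)\<^sup>2 \<partial>A) + (\<integral>x. (dist x a)\<^sup>2 \<partial>B)"
proof -
  interpret A: prob_space A by fact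
  interpret B: prob_space B by fact
  interpret AB: pair_prob_space A B ..
  note [measurable_cong] = A(2) B(2)
  have ex: "(dist x y)\<^sup>2 = (dist x a)\<^sup>2 + (dist y a)\<^sup>2 - 2 * ((x - a) \<bullet> (y - a))" for x y :: 'a
    unfolding dist_norm power2_norm_eq_inner by (simp add: inner_diff_left inner_diff_right inner_commute)
  have j: "integrable B (\<lambda>y. (x - a) \<bullet> (y - a))" for x by (rule integrable_inner_right) (use iB in simp)
  have fe: "(\<lambda>y. (dist x y)\<^sup>2) = (\<lambda>y. (dist x a)\<^sup>2 + (dist y a)\<^sup>2 - 2 * ((x - a) \<bullet> (y - a)))" for x
    by (rule ext) (rule ex)
  have i1: "integrable B (\<lambda>y. (dist x y)\<^sup>2)" for x
    unfolding fe[of x] by (intro Bochner_Integration.integrable_diff Bochner_Integration.integrable_add integrable_mult_right j sB) simp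
  have v: "(\<integral>y. (dist x y)\<^sup>2 \<partial>B) = (dist x a)\<^sup>2 + (\<integral>y. (dist y a)\<^sup>2 \<partial>B)" for x
  proof -
    have "(\<integral>y. (x - a) \<bullet> (y - a) \<partial>B) = (x - a) \<bullet> (\<integral>y. y - a \<partial>B)" by (rule integral_inner_right) (use iB in simp)
    then show ?thesis unfolding fe[of x] using j[of x] sB mB B.prob_space by simp
  qed
  show i: "pair_integrable (\<lambda>\<rho>. \<rho>\<^sup>2) A B"
  proof (rule AB.Fubini_integrable)
    show "integrable A (\<lambda>x. \<integral>y. norm ((dist (fst (x, y)) (snd (x, y)))\<^sup>2) \<partial>B)" using sA by (simp add: v)
    show "AE x in A. integrable B (\<lambda>y. (dist (fst (x, y)) (snd (x, y)))\<^sup>2)" using i1 by simp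
  qed measurable
  have "pair_int (\<lambda>\<rho>. \<rho>\<^sup>2) A B = (\<integral>x. (\<integral>y. (dist (fst (x, y)) (snd (x, y)))\<^sup>2 \<partial>B) \<partial>A)"
    unfolding pair_int_def by (rule AB.integral_fst'[OF i, symmetric])
  also have "\<dots> = (\<integral>x. (dist x a)\<^sup>2 \<partial>A) + (\<integral>x. (dist x a)\<^sup>2 \<partial>B)"
    using sA A.prob_space by (simp add: v)
  finally show "pair_int (\<lambda>\<rho>. \<rho>\<^sup>2) A B = (\<integral>x. (dist x a)\<^sup>2 \<partial>A) + (\<integral>x. (dist x a)\<^sup>2 \<partial>B)" .
qed

section \<open>Minimal energy and minimizers\<close>

lemma Pot_upper_bound:
  assumes n: "n \<ge> 2" and \<alpha>: "\<alpha> > 0" and r: "r \<ge> 0"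
  shows "Pot n \<alpha> r \<le> (1 + r) powr \<alpha> / \<alpha>"
proof -
  interpret prob_space "angle_measure n" by (rule prob_space_angle_measure)
  have "Pot n \<alpha> r \<le> (\<integral>\<theta>. (1 + r) powr \<alpha> / \<alpha> \<partial>angle_measure n)"
    unfolding Pot_def
  proof (rule integral_mono)
    show "integrable (angle_measure n) (\<lambda>\<theta>. power_potential \<alpha> (sqrt (chord2 r \<theta>)))"
      using n \<alpha> r by (intro integrable_power_potential_chord) auto
    fix \<theta> :: real
    have "- (2 * r) \<le> 2 * r * cos \<theta>" using mult_left_mono[OF cos_ge_minus_one[of \<theta>], of "2 * r"] r by simp
    then have "chord2 r \<theta> \<le> (1 + r)\<^sup>2" by (simp add: chord2_def power2_eq_square algebra_simps)
    then have "sqrt (chord2 r \<theta>) \<le> 1 + r" using r by (intro real_le_lsqrt) auto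
    then have "sqrt (chord2 r \<theta>) powr \<alpha> \<le> (1 + r) powr \<alpha>" using \<alpha> chord2_nonneg[of r \<theta>] by (intro powr_mono2) auto
    then show "power_potential \<alpha> (sqrt (chord2 r \<theta>)) \<le> (1 + r) powr \<alpha> / \<alpha>"
      using \<alpha> by (simp add: power_potential_def divide_right_mono)
  qed simp
  then show ?thesis using prob_space by simp
qed

lemma Pot_lower_bound:
  assumes n: "n \<ge> 2" and \<gamma>: "\<gamma> > 1 - real n"
  shows "\<exists>B. \<forall>r\<ge>0. B \<le> Pot n \<gamma> r"
proof -
  have "continuous_on {0..1} (Pot n \<gamma>)"
    by (rule continuous_at_imp_continuous_on) (use isCont_Pot[OF n \<gamma>] in auto)
  then obtain x where x: "x \<in> {0..1}" "\<And>y. y \<in> {0..1} \<Longrightarrow> Pot n \<gamma> x \<le> Pot n \<gamma> y"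
    using continuous_attains_inf[of "{0..1::real}" "Pot n \<gamma>"] by auto
  have "Pot n \<gamma> x \<le> Pot n \<gamma> r" if r: "r \<ge> 0" for r
  proof (cases "r \<le> 1")
    case True
    then show ?thesis using x(2)[of r] r by simp
  next
    case False
    have "Pot n \<gamma> 1 \<le> Pot n \<gamma> r"
      unfolding Pot_def
    proof (rule integral_mono_AE)
      show "integrable (angle_measure n) (\<lambda>\<theta>. power_potential \<gamma> (sqrt (chord2 1 \<theta>)))"
        "integrable (angle_measure n) (\<lambda>\<theta>. power_potential \<gamma> (sqrt (chord2 r \<theta>)))"
        using r by (intro integrable_power_potential_chord n \<gamma>; simp)+
      show "AE \<theta> in angle_measure n. power_potential \<gamma> (sqrt (chord2 1 \<theta>)) \<le> power_potential \<gamma> (sqrt (chord2 r \<theta>))"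
        using chord2_pos_AE[where n=n and r=1]
      proof eventually_elim
        case (elim \<theta>)
        have "1 * (2 - 2 * cos \<theta>) \<le> r * (2 - 2 * cos \<theta>)" using False cos_le_one[of \<theta>] by (intro mult_right_mono) auto
        then have "chord2 1 \<theta> \<le> chord2 r \<theta>" using chord2_ge[of r \<theta>] r unfolding chord2_1 by simp
        then show ?case using elim by (intro power_potential_mono) auto
      qed
    qed
    then show ?thesis using x(2)[of 1] by simp
  qed
  then show ?thesis by blast
qed

definition sphere_potential :: "real \<Rightarrow> real \<Rightarrow> 'a::euclidean_space \<Rightarrow> real \<Rightarrow> 'a \<Rightarrow> real" where
  "sphere_potential \<alpha> \<beta> a R x = (\<integral>y. kernel_profile \<alpha> \<beta> (dist x y) \<partial>uniform_sphere a R)"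

lemma sphere_potential_eq:
  fixes x a :: "'a::euclidean_space"
  assumes d: "DIM('a) \<ge> 2" and R: "R > 0" and g: "\<alpha> > 0" "\<beta> > 1 - real DIM('a)"
  shows "sphere_potential \<alpha> \<beta> a R x =
    R powr \<alpha> * Pot DIM('a) \<alpha> (dist x a / R) - R powr \<beta> * Pot DIM('a) \<beta> (dist x a / R) - (if \<beta> = 0 then ln R else 0)"
proof -
  have a: "\<alpha> > 1 - real DIM('a)" using g d by simp
  have "sphere_potential \<alpha> \<beta> a R x =
    (\<integral>y. power_potential \<alpha> (dist x y) \<partial>uniform_sphere a R) - (\<integral>y. power_potential \<beta> (dist x y) \<partial>uniform_sphere a R)"
    unfolding sphere_potential_def by (intro Bochner_Integration.integral_diff integrable_power_potential_sphere d R a g)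
  also have "\<dots> = R powr \<alpha> * Pot DIM('a) \<alpha> (dist x a / R) - (R powr \<beta> * Pot DIM('a) \<beta> (dist x a / R) + (if \<beta> = 0 then ln R else 0))"
    unfolding integral_power_potential_sphere[OF d R a] integral_power_potential_sphere[OF d R g(2)] using g by simp
  finally show ?thesis by simp
qed

text \<open>The kernel is bounded below, and its average over the sphere grows at most like \<open>dist x a powr \<alpha>\<close>, so
a finite moment of order \<open>\<alpha>\<close> suffices for Fubini's theorem.\<close>

lemma sphere_cross_energy:
  fixes \<mu> :: "'a::euclidean_space measure"
  assumes d: "DIM('a) \<ge> 2" and R: "R > 0" and \<alpha>: "\<alpha> > 0" and \<beta>: "\<beta> < \<alpha>" "\<beta> > 1 - real DIM('a)"
    and \<mu>: "prob_space \<mu>" "sets \<mu> = sets borel" and m: "integrable \<mu> (\<lambda>x. dist x a powr \<alpha>)"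
  shows "pair_integrable (kernel_profile \<alpha> \<beta>) \<mu> (uniform_sphere a R)"
    and "integrable \<mu> (sphere_potential \<alpha> \<beta> a R)"
    and "pair_int (kernel_profile \<alpha> \<beta>) \<mu> (uniform_sphere a R) = (\<integral>x. sphere_potential \<alpha> \<beta> a R x \<partial>\<mu>)"
    and "AE z in \<mu> \<Otimes>\<^sub>M uniform_sphere a R. fst z \<noteq> snd z"
proof -
  define \<nu> where "\<nu> = uniform_sphere a R"
  interpret \<mu>: prob_space \<mu> by fact
  interpret \<nu>: prob_space \<nu> unfolding \<nu>_def by (rule prob_space_uniform_sphere[OF R])
  interpret MN: pair_prob_space \<mu> \<nu> ..
  have s\<nu>: "sets \<nu> = sets borel" by (simp add: \<nu>_def)
  note [measurable_cong] = \<mu>(2) s\<nu>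
  let ?k = "kernel_profile \<alpha> \<beta>"
  obtain c where c: "c \<ge> 0" "\<And>\<rho>. \<rho> \<ge> 0 \<Longrightarrow> power_potential \<alpha> \<rho> / 2 - c \<le> ?k \<rho>"
    using kernel_profile_lower_bound[OF \<alpha> \<beta>(1)] by auto
  have kc: "0 \<le> ?k (dist x y) + c" for x y :: 'a
    using c(2)[of "dist x y"] power_potential_nonneg[OF \<alpha>, of "dist x y"] by simp
  have \<alpha>': "\<alpha> > 1 - real DIM('a)" using \<alpha> d by simp
  have ik: "integrable \<nu> (\<lambda>y. ?k (dist x y))" for x
    unfolding \<nu>_def by (intro Bochner_Integration.integrable_diff integrable_power_potential_sphere d R \<alpha>' \<beta>)
  have inner: "(\<integral>\<^sup>+y. ennreal (?k (dist x y) + c) \<partial>\<nu>) = ennreal (sphere_potential \<alpha> \<beta> a R x + c)" for x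
  proof -
    have "integrable \<nu> (\<lambda>y. ?k (dist x y) + c)" by (intro Bochner_Integration.integrable_add ik) simp
    then have "(\<integral>\<^sup>+y. ennreal (?k (dist x y) + c) \<partial>\<nu>) = ennreal (\<integral>y. ?k (dist x y) + c \<partial>\<nu>)"
      by (rule nn_integral_eq_integral) (use kc in auto)
    also have "(\<integral>y. ?k (dist x y) + c \<partial>\<nu>) = sphere_potential \<alpha> \<beta> a R x + c"
      unfolding sphere_potential_def \<nu>_def[symmetric] using ik[of x] \<nu>.prob_space by simp
    finally show ?thesis .
  qed
  obtain B where B: "\<And>r. r \<ge> 0 \<Longrightarrow> B \<le> Pot DIM('a) \<beta> r" using Pot_lower_bound[OF d \<beta>(2)] by auto
  define K0 where "K0 = c + \<bar>R powr \<beta> * B\<bar> + \<bar>if \<beta> = 0 then ln R else 0\<bar>"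
  define K1 where "K1 = R powr \<alpha> * 2 powr \<alpha> / \<alpha>"
  have upper: "sphere_potential \<alpha> \<beta> a R x + c \<le> K0 + K1 * (1 + (dist x a / R) powr \<alpha>)" for x
  proof -
    define r where "r = dist x a / R"
    have r: "r \<ge> 0" using R by (simp add: r_def)
    have "Pot DIM('a) \<alpha> r \<le> (1 + r) powr \<alpha> / \<alpha>" by (rule Pot_upper_bound[OF d \<alpha> r])
    also have "\<dots> \<le> 2 powr \<alpha> * (1 powr \<alpha> + r powr \<alpha>) / \<alpha>"
      using \<alpha> r by (intro divide_right_mono powr_sum_bound) auto
    finally have "R powr \<alpha> * Pot DIM('a) \<alpha> r \<le> R powr \<alpha> * (2 powr \<alpha> * (1 powr \<alpha> + r powr \<alpha>) / \<alpha>)"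
      by (rule mult_left_mono) simp
    also have "\<dots> = K1 * (1 + r powr \<alpha>)" by (simp add: K1_def)
    finally have 1: "R powr \<alpha> * Pot DIM('a) \<alpha> r \<le> K1 * (1 + r powr \<alpha>)" .
    have 2: "R powr \<beta> * B \<le> R powr \<beta> * Pot DIM('a) \<beta> r" using B[OF r] by (intro mult_left_mono) auto
    show ?thesis
      unfolding sphere_potential_eq[OF d R \<alpha> \<beta>(2)] r_def[symmetric] K0_def
      using 1 2 abs_ge_minus_self[of "R powr \<beta> * B"] abs_ge_minus_self[of "if \<beta> = 0 then ln R else 0"] by linarith
  qed
  have mr: "integrable \<mu> (\<lambda>x. K0 + K1 * (1 + (dist x a / R) powr \<alpha>))"
  proof -
    have "(\<lambda>x. (dist x a / R) powr \<alpha>) = (\<lambda>x. dist x a powr \<alpha> / R powr \<alpha>)" using R by (auto simp: powr_divide)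
    moreover have "integrable \<mu> (\<lambda>x. dist x a powr \<alpha> / R powr \<alpha>)" by (rule integrable_divide) (rule m)
    ultimately show ?thesis by simp
  qed
  have "(\<integral>\<^sup>+z. ennreal (?k (dist (fst z) (snd z)) + c) \<partial>(\<mu> \<Otimes>\<^sub>M \<nu>)) = (\<integral>\<^sup>+x. (\<integral>\<^sup>+y. ennreal (?k (dist x y) + c) \<partial>\<nu>) \<partial>\<mu>)"
    by (subst \<nu>.nn_integral_fst[symmetric]) simp_all
  also have "\<dots> \<le> (\<integral>\<^sup>+x. ennreal (K0 + K1 * (1 + (dist x a / R) powr \<alpha>)) \<partial>\<mu>)"
    unfolding inner by (intro nn_integral_mono ennreal_leI upper)
  also have "\<dots> \<le> (\<integral>\<^sup>+x. ennreal (norm (K0 + K1 * (1 + (dist x a / R) powr \<alpha>))) \<partial>\<mu>)"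
    by (intro nn_integral_mono ennreal_leI) simp
  also have "\<dots> < \<infinity>" using mr unfolding integrable_iff_bounded by blast
  finally have fin: "(\<integral>\<^sup>+z. ennreal (?k (dist (fst z) (snd z)) + c) \<partial>(\<mu> \<Otimes>\<^sub>M \<nu>)) < \<infinity>" .
  have "integrable (\<mu> \<Otimes>\<^sub>M \<nu>) (\<lambda>z. ?k (dist (fst z) (snd z)) + c)"
    by (rule integrableI_nonneg) (use fin kc in auto)
  then have "integrable (\<mu> \<Otimes>\<^sub>M \<nu>) (\<lambda>z. (?k (dist (fst z) (snd z)) + c) - c)"
    by (rule Bochner_Integration.integrable_diff) simp
  then show i: "pair_integrable ?k \<mu> (uniform_sphere a R)" unfolding \<nu>_def[symmetric] by simp
  show "integrable \<mu> (sphere_potential \<alpha> \<beta> a R)"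
    using MN.integrable_fst'[OF i[folded \<nu>_def]] unfolding sphere_potential_def \<nu>_def by simp
  show "pair_int ?k \<mu> (uniform_sphere a R) = (\<integral>x. sphere_potential \<alpha> \<beta> a R x \<partial>\<mu>)"
    using MN.integral_fst'[OF i[folded \<nu>_def]] unfolding sphere_potential_def \<nu>_def pair_int_def by simp
  have "AE z in \<mu> \<Otimes>\<^sub>M \<nu>. dist (fst z) (snd z) \<noteq> 0"
  proof (rule MN.AE_pair_measure)
    show "{z \<in> space (\<mu> \<Otimes>\<^sub>M \<nu>). dist (fst z) (snd z) \<noteq> 0} \<in> sets (\<mu> \<Otimes>\<^sub>M \<nu>)" by measurable
    show "AE x in \<mu>. AE y in \<nu>. dist (fst (x, y)) (snd (x, y)) \<noteq> 0"
      unfolding \<nu>_def using AE_uniform_sphere_neq[OF d R] by simp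
  qed
  then show "AE z in \<mu> \<Otimes>\<^sub>M uniform_sphere a R. fst z \<noteq> snd z"
    unfolding \<nu>_def by eventually_elim auto
qed

text \<open>The numerator of \<open>\<beta>_* - \<beta>\<close>, cleared of its denominator, is \<open>(n - 1) - (\<alpha> + n - 3) (\<beta> + n - 3)\<close>.\<close>

lemma beta_star_condition:
  assumes n: "n \<ge> 2" and \<alpha>: "2 \<le> \<alpha>" and star: "beta_star n \<alpha> \<le> \<beta>"
  shows "(\<alpha> + real n - 3) * (\<beta> + real n - 3) \<ge> real n - 1" and "\<beta> + real n - 3 > 0"
proof -
  have u: "real n + \<alpha> - 3 > 0" using n \<alpha> by simp
  have "- 10 + 3 * \<alpha> + 7 * real n - \<alpha> * real n - (real n)\<^sup>2 \<le> \<beta> * (real n + \<alpha> - 3)"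
    using star u unfolding beta_star_def by (simp add: divide_le_eq)
  then show 1: "(\<alpha> + real n - 3) * (\<beta> + real n - 3) \<ge> real n - 1"
    by (simp add: algebra_simps power2_eq_square)
  have "(\<alpha> + real n - 3) * (\<beta> + real n - 3) > 0" using 1 n by linarith
  then show "\<beta> + real n - 3 > 0" using u by (simp add: zero_less_mult_iff)
qed

context
  fixes \<alpha> \<beta> R :: real
  assumes d: "DIM('a::euclidean_space) \<ge> 2" and \<alpha>: "2 \<le> \<alpha>" "\<alpha> \<le> 4" and star: "beta_star DIM('a) \<alpha> \<le> \<beta>"
    and \<beta>: "\<beta> \<le> 2" "\<beta> < \<alpha>" and R: "R = sphere_radius DIM('a) \<alpha> \<beta>"
begin

text \<open>The value of the potential of the sphere on the sphere, which is twice the minimal energy.\<close>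

definition optimal_value :: real where
  "optimal_value = R powr \<alpha> * Pot DIM('a) \<alpha> 1 - R powr \<beta> * Pot DIM('a) \<beta> 1 - (if \<beta> = 0 then ln R else 0)"

lemma exponents_sub: "\<beta> + real DIM('a) - 3 > 0" "\<beta> > 1 - real DIM('a)" "\<alpha> > 1 - real DIM('a)" "\<alpha> > 0"
  using beta_star_condition(2)[OF d \<alpha>(1) star] \<alpha> d by auto

lemma R_pos: "R > 0"
  unfolding R by (rule sphere_radius_pos[OF d exponents_sub(3,2)])

lemma R_powr: "R powr \<alpha> = R powr \<beta> * (sphere_moment DIM('a) \<beta> / sphere_moment DIM('a) \<alpha>)"
proof -
  have "R powr \<alpha> = R powr \<beta> * R powr (\<alpha> - \<beta>)" unfolding powr_add[symmetric] by simp
  then show ?thesis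
    using sphere_radius_powr[OF d exponents_sub(3,2)] \<beta> unfolding R by simp
qed

lemma sphere_potential_ge: "optimal_value \<le> sphere_potential \<alpha> \<beta> a R (x :: 'a)"
proof -
  define C where "C = sphere_moment DIM('a) \<beta> / sphere_moment DIM('a) \<alpha>"
  have "C * Pot DIM('a) \<alpha> 1 - Pot DIM('a) \<beta> 1 \<le> C * Pot DIM('a) \<alpha> (dist x a / R) - Pot DIM('a) \<beta> (dist x a / R)"
    using R_pos
    by (intro sphere_potential_minimal d \<alpha> \<beta> exponents_sub beta_star_condition(1)[OF d \<alpha>(1) star] C_def) simp
  then have "R powr \<beta> * (C * Pot DIM('a) \<alpha> 1 - Pot DIM('a) \<beta> 1) \<le> R powr \<beta> * (C * Pot DIM('a) \<alpha> (dist x a / R) - Pot DIM('a) \<beta> (dist x a / R))"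
    by (rule mult_left_mono) simp
  then show ?thesis
    unfolding optimal_value_def sphere_potential_eq[OF d R_pos exponents_sub(4,2)] R_powr C_def[symmetric]
    by (simp add: right_diff_distrib mult.assoc)
qed

lemma sphere_potential_on_sphere: "dist x a = R \<Longrightarrow> sphere_potential \<alpha> \<beta> a R (x :: 'a) = optimal_value"
  unfolding optimal_value_def sphere_potential_eq[OF d R_pos exponents_sub(4,2)] using R_pos by simp

lemma uniform_sphere_moment: "integrable (uniform_sphere a R) (\<lambda>x::'a. dist x a powr \<alpha>)"
proof -
  interpret prob_space "uniform_sphere a R" by (rule prob_space_uniform_sphere[OF R_pos])
  show ?thesis
  proof (rule integrable_const_bound[where B="R powr \<alpha>"])
    show "AE x in uniform_sphere a R. norm (dist x a powr \<alpha>) \<le> R powr \<alpha>"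
      using AE_uniform_sphere_dist_center[OF R_pos, of a] by eventually_elim simp
  qed measurable
qed

lemma sphere_self_energy:
  shows "pair_integrable (kernel_profile \<alpha> \<beta>) (uniform_sphere (a::'a) R) (uniform_sphere a R)"
    and "pair_int (kernel_profile \<alpha> \<beta>) (uniform_sphere (a::'a) R) (uniform_sphere a R) = optimal_value"
    and "AE z in uniform_sphere (a::'a) R \<Otimes>\<^sub>M uniform_sphere a R. fst z \<noteq> snd z"
    and "energy \<alpha> \<beta> (uniform_sphere (a::'a) R) = ereal (optimal_value / 2)"
proof -
  interpret prob_space "uniform_sphere a R" by (rule prob_space_uniform_sphere[OF R_pos])
  note c = sphere_cross_energy[OF d R_pos exponents_sub(4) \<beta>(2) exponents_sub(2) prob_space_axioms sets_uniform_sphere uniform_sphere_moment]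
  show 1: "pair_integrable (kernel_profile \<alpha> \<beta>) (uniform_sphere a R) (uniform_sphere a R)"
    and 3: "AE z in uniform_sphere a R \<Otimes>\<^sub>M uniform_sphere a R. fst z \<noteq> snd z"
    by (rule c)+
  have "(\<integral>x. sphere_potential \<alpha> \<beta> a R x \<partial>uniform_sphere a R) = (\<integral>x. optimal_value \<partial>uniform_sphere a R)"
  proof (rule integral_cong_AE)
    show "AE x in uniform_sphere a R. sphere_potential \<alpha> \<beta> a R x = optimal_value"
      using AE_uniform_sphere_dist_center[OF R_pos, of a] by eventually_elim (rule sphere_potential_on_sphere)
    show "sphere_potential \<alpha> \<beta> a R \<in> borel_measurable (uniform_sphere a R)"
      using c(2) by (rule borel_measurable_integrable)
  qed simp
  then show 2: "pair_int (kernel_profile \<alpha> \<beta>) (uniform_sphere a R) (uniform_sphere a R) = optimal_value"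
    unfolding c(3) using prob_space by simp
  show "energy \<alpha> \<beta> (uniform_sphere a R) = ereal (optimal_value / 2)"
    using energy_eq_pair_int[OF prob_space_axioms sets_uniform_sphere 1] 3 unfolding 2 by blast
qed

text \<open>The comparison with the sphere of radius \<open>R\<close> about the mean of \<open>\<mu>\<close>. The defect of the kernel and the
pointwise bound on the potential give the inequality; in case of equality the defect vanishes.\<close>

lemma energy_ge_optimal:
  fixes \<mu> :: "'a measure"
  assumes \<mu>: "prob_space \<mu>" "sets \<mu> = sets borel" and fin: "energy \<alpha> \<beta> \<mu> < \<infinity>"
  shows "ereal (optimal_value / 2) \<le> energy \<alpha> \<beta> \<mu>"
    and "(\<alpha>, \<beta>) \<noteq> (4, 2) \<Longrightarrow> energy \<alpha> \<beta> \<mu> \<le> ereal (optimal_value / 2) \<Longrightarrow> \<exists>a. \<mu> = uniform_sphere a R"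
proof -
  interpret \<mu>: prob_space \<mu> by fact
  note k\<mu> = finite_energyD(1)[OF exponents_sub(4) \<beta>(2) \<mu> fin]
  note diag\<mu> = finite_energyD(2)[OF exponents_sub(4) \<beta>(2) \<mu> fin]
  have e\<mu>: "energy \<alpha> \<beta> \<mu> = ereal (pair_int (kernel_profile \<alpha> \<beta>) \<mu> \<mu> / 2)"
    by (rule energy_eq_pair_int[OF \<mu> k\<mu>]) (rule diag\<mu>)
  note split\<mu> = pair_integrable_split[OF exponents_sub(4) \<beta>(2) \<mu> \<mu> k\<mu>]
  have mom: "integrable \<mu> (\<lambda>x. dist x a powr \<alpha>)" for a
    by (rule finite_moment[OF exponents_sub(4) \<mu> split\<mu>(1)])
  define a where "a = (\<integral>x. x \<partial>\<mu>)"
  define \<nu> where "\<nu> = uniform_sphere a R"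
  interpret \<nu>: prob_space \<nu> unfolding \<nu>_def by (rule prob_space_uniform_sphere[OF R_pos])
  have \<nu>: "prob_space \<nu>" "sets \<nu> = sets borel" by (rule \<nu>.prob_space_axioms) (simp add: \<nu>_def)
  have mom\<nu>: "integrable \<nu> (\<lambda>x. dist x a powr \<alpha>)" unfolding \<nu>_def by (rule uniform_sphere_moment)
  note c = sphere_cross_energy[OF d R_pos exponents_sub(4) \<beta>(2) exponents_sub(2) \<mu> mom[of a], folded \<nu>_def]
  note s = sphere_self_energy[of a, folded \<nu>_def]
  note split\<nu> = pair_integrable_split[OF exponents_sub(4) \<beta>(2) \<nu> \<nu> s(1)]
  note splitc = pair_integrable_split[OF exponents_sub(4) \<beta>(2) \<mu> \<nu> c(1)]
  note m2\<mu> = second_moment[OF \<mu> \<alpha>(1) mom[of a]] first_moment[OF \<mu> \<alpha>(1) mom[of a]]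
  note m2\<nu> = second_moment[OF \<nu> \<alpha>(1) mom\<nu>] first_moment[OF \<nu> \<alpha>(1) mom\<nu>]
  have mean\<mu>: "(\<integral>x. x - a \<partial>\<mu>) = 0"
  proof -
    have "integrable \<mu> (\<lambda>x. (x - a) + a)" by (intro Bochner_Integration.integrable_add m2\<mu>(2)) simp
    then have "integrable \<mu> (\<lambda>x. x)" by simp
    then show ?thesis using \<mu>.prob_space by (simp add: a_def)
  qed
  have mean\<nu>: "(\<integral>x. x - a \<partial>\<nu>) = 0" unfolding \<nu>_def by (rule uniform_sphere_mean[OF R_pos])
  note sq = pair_integrable_square[OF \<mu> \<mu> m2\<mu>(1) m2\<mu>(1,2) mean\<mu>] pair_integrable_square[OF \<nu> \<nu> m2\<nu>(1) m2\<nu>(1,2) mean\<nu>]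
    pair_integrable_square[OF \<mu> \<nu> m2\<mu>(1) m2\<nu>(1,2) mean\<nu>]
  note sqi = pair_int_square[OF \<mu> \<mu> m2\<mu>(1) m2\<mu>(1,2) mean\<mu>] pair_int_square[OF \<nu> \<nu> m2\<nu>(1) m2\<nu>(1,2) mean\<nu>]
    pair_int_square[OF \<mu> \<nu> m2\<mu>(1) m2\<nu>(1,2) mean\<nu>]
  interpret P: same_mean \<mu> \<nu>
    by (rule same_mean.intro[OF \<mu> \<nu> sq]) (simp add: defect_def sqi)
  have int: "P.all_integrable (power_potential \<alpha>)" "P.all_integrable (power_potential \<beta>)"
    unfolding P.all_integrable_def using split\<mu> split\<nu> splitc by simp_all
  have diag: "AE z in A \<Otimes>\<^sub>M B. fst z \<noteq> snd z" if "(A, B) \<in> {(\<mu>, \<mu>), (\<nu>, \<nu>), (\<mu>, \<nu>)}" "\<beta> \<le> 0" for A B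
  proof -
    have "(A = \<mu> \<and> B = \<mu>) \<or> (A = \<nu> \<and> B = \<nu>) \<or> (A = \<mu> \<and> B = \<nu>)" using that(1) by simp
    then show ?thesis using diag\<mu>[OF that(2)] s(3) c(4) by (elim disjE conjE) (simp_all only:)
  qed
  have D: "0 \<le> defect (kernel_profile \<alpha> \<beta>) \<mu> \<nu>" by (rule P.defect_kernel(1)[OF \<alpha> \<beta> int]) (rule diag)
  have pot: "optimal_value \<le> pair_int (kernel_profile \<alpha> \<beta>) \<mu> \<nu>"
  proof -
    have "(\<integral>x. optimal_value \<partial>\<mu>) \<le> (\<integral>x. sphere_potential \<alpha> \<beta> a R x \<partial>\<mu>)"
      by (rule integral_mono[OF _ c(2)]) (simp_all add: sphere_potential_ge)
    then show ?thesis unfolding c(3) using \<mu>.prob_space by simp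
  qed
  have ge: "optimal_value \<le> pair_int (kernel_profile \<alpha> \<beta>) \<mu> \<mu>"
    using D pot unfolding defect_def s(2) by linarith
  then show "ereal (optimal_value / 2) \<le> energy \<alpha> \<beta> \<mu>" unfolding e\<mu> by simp
  assume ne: "(\<alpha>, \<beta>) \<noteq> (4, 2)" and le: "energy \<alpha> \<beta> \<mu> \<le> ereal (optimal_value / 2)"
  have "pair_int (kernel_profile \<alpha> \<beta>) \<mu> \<mu> \<le> optimal_value" using le unfolding e\<mu> by simp
  then have "defect (kernel_profile \<alpha> \<beta>) \<mu> \<nu> = 0"
    using D pot unfolding defect_def s(2) by linarith
  have "\<mu> = \<nu>" by (rule P.defect_kernel(2)[OF \<alpha> \<beta> int _ ne \<open>defect (kernel_profile \<alpha> \<beta>) \<mu> \<nu> = 0\<close>]) (rule diag)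
  then show "\<exists>a. \<mu> = uniform_sphere a R" unfolding \<nu>_def by blast
qed

lemma minimal_energy_eq: "minimal_energy TYPE('a) \<alpha> \<beta> = ereal (optimal_value / 2)"
proof (rule antisym)
  have "uniform_sphere (0::'a) R \<in> borel_prob_measures"
    using prob_space_uniform_sphere[OF R_pos] by (simp add: borel_prob_measures_def)
  then have "minimal_energy TYPE('a) \<alpha> \<beta> \<le> energy \<alpha> \<beta> (uniform_sphere (0::'a) R)"
    unfolding minimal_energy_def by (rule INF_lower)
  then show "minimal_energy TYPE('a) \<alpha> \<beta> \<le> ereal (optimal_value / 2)" unfolding sphere_self_energy(4) .
  show "ereal (optimal_value / 2) \<le> minimal_energy TYPE('a) \<alpha> \<beta>"
    unfolding minimal_energy_def
  proof (rule INF_greatest)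
    fix \<mu> :: "'a measure" assume "\<mu> \<in> borel_prob_measures"
    then have \<mu>: "prob_space \<mu>" "sets \<mu> = sets borel" by (auto simp: borel_prob_measures_def)
    show "ereal (optimal_value / 2) \<le> energy \<alpha> \<beta> \<mu>"
    proof (cases "energy \<alpha> \<beta> \<mu> < \<infinity>")
      case True
      show ?thesis by (rule energy_ge_optimal(1)[OF \<mu> True])
    qed simp
  qed
qed

lemma uniform_sphere_minimizer: "minimizer \<alpha> \<beta> (uniform_sphere (a::'a) R)"
  unfolding minimizer_def minimal_energy_eq sphere_self_energy(4)
  using prob_space_uniform_sphere[OF R_pos, of a] by (simp add: borel_prob_measures_def)

lemma minimizer_unique:
  assumes "(\<alpha>, \<beta>) \<noteq> (4, 2)" "minimizer \<alpha> \<beta> (\<mu> :: 'a measure)"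
  shows "\<exists>a. \<mu> = uniform_sphere a R"
proof -
  have \<mu>: "prob_space \<mu>" "sets \<mu> = sets borel" and e: "energy \<alpha> \<beta> \<mu> = ereal (optimal_value / 2)"
    using assms(2) unfolding minimizer_def minimal_energy_eq by (auto simp: borel_prob_measures_def)
  show ?thesis by (rule energy_ge_optimal(2)[OF \<mu> _ assms(1)]) (simp_all add: e)
qed

lemma optimal_value_nonzero:
  assumes "\<beta> \<noteq> 0"
  shows "optimal_value / 2 = - (pi powr (- 1 / 2)) * 2 powr (real DIM('a) + \<alpha> - 3) *
    (Gamma (real DIM('a) / 2) * Gamma ((real DIM('a) + \<alpha> - 1) / 2) / Gamma ((2 * real DIM('a) + \<alpha> - 2) / 2)) *
    (1 / \<beta> - 1 / \<alpha>) * R powr \<alpha>"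
proof -
  define A where "A = sphere_moment DIM('a) \<alpha>"
  define B where "B = sphere_moment DIM('a) \<beta>"
  have pos: "A > 0" "B > 0" unfolding A_def B_def by (intro sphere_moment_pos d exponents_sub)+
  have pa: "Pot DIM('a) \<alpha> 1 = A / \<alpha>"
    using Pot_eq_Psi[of \<alpha> "DIM('a)" 1] Psi_1[OF d exponents_sub(3)] \<alpha> by (simp add: A_def)
  have pb: "Pot DIM('a) \<beta> 1 = B / \<beta>"
    using Pot_eq_Psi[OF assms, of "DIM('a)" 1] Psi_1[OF d exponents_sub(2)] by (simp add: B_def)
  have rb: "R powr \<beta> * B = R powr \<alpha> * A"
    unfolding R_powr A_def[symmetric] B_def[symmetric] using pos by simp
  have "optimal_value / 2 = (R powr \<alpha> * A / \<alpha> - R powr \<beta> * B / \<beta>) / 2"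
    unfolding optimal_value_def pa pb using assms by simp
  also have "\<dots> = - (A / 2) * (1 / \<beta> - 1 / \<alpha>) * R powr \<alpha>"
  proof -
    have "(x * y / p - x * y / q) / 2 = - (y / 2) * (1 / q - 1 / p) * x" if "p \<noteq> 0" "q \<noteq> 0" for x y p q :: real
      using that by (simp add: field_simps)
    from this[of \<alpha> \<beta>] show ?thesis unfolding rb using assms \<alpha> by simp
  qed
  also have "A / 2 = pi powr (- 1 / 2) * 2 powr (real DIM('a) + \<alpha> - 3) *
    (Gamma (real DIM('a) / 2) * Gamma ((real DIM('a) + \<alpha> - 1) / 2) / Gamma ((2 * real DIM('a) + \<alpha> - 2) / 2))"
    unfolding A_def by (rule sphere_moment_duplication[OF d])
  finally show ?thesis by (simp only: mult_minus_left)
qed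

lemma optimal_value_zero:
  assumes "\<beta> = 0"
  shows "optimal_value / 2 = 1 / (2 * \<alpha>) *
           (1 - ln ((Gamma ((real DIM('a) - 1) / 2) * Gamma ((2 * real DIM('a) + \<alpha> - 2) / 2)) /
                    (Gamma (real DIM('a) - 1) * Gamma ((real DIM('a) + \<alpha> - 1) / 2)))) +
         1 / 4 * (deriv Gamma (real DIM('a) - 1) / Gamma (real DIM('a) - 1) -
                  deriv Gamma ((real DIM('a) - 1) / 2) / Gamma ((real DIM('a) - 1) / 2))"
proof -
  let ?d = "real DIM('a)"
  define A where "A = sphere_moment DIM('a) \<alpha>"
  define Q where "Q = (Gamma ((?d - 1) / 2) * Gamma ((2 * ?d + \<alpha> - 2) / 2)) / (Gamma (?d - 1) * Gamma ((?d + \<alpha> - 1) / 2))"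
  have G: "Gamma ((?d - 1) / 2) > 0" "Gamma (?d - 1) > 0" "Gamma ((2 * ?d + \<alpha> - 2) / 2) > 0" "Gamma ((?d + \<alpha> - 1) / 2) > 0"
    using d exponents_sub by (auto intro!: Gamma_real_pos)
  have Q: "Q > 0" unfolding Q_def using G by simp
  have A: "A > 0" unfolding A_def by (intro sphere_moment_pos d exponents_sub)
  have s0: "sphere_moment DIM('a) 0 = 1"
  proof -
    have e: "(0 + ?d - 1) / 2 = (?d - 1) / 2" "(0 + 2 * ?d - 2) / 2 = ?d - 1" by simp_all
    show ?thesis using G unfolding sphere_moment_def e by simp
  qed
  have pa: "Pot DIM('a) \<alpha> 1 = A / \<alpha>"
    using Pot_eq_Psi[of \<alpha> "DIM('a)" 1] Psi_1[OF d exponents_sub(3)] \<alpha> by (simp add: A_def)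
  have RA: "R powr \<alpha> * A = 1"
    using A R_pos unfolding R_powr A_def assms s0 by simp
  have lnR: "ln R = - ln 2 + ln Q / \<alpha>"
  proof -
    have e: "Gamma ((?d + 0 - 1) / 2) = Gamma ((?d - 1) / 2)" "Gamma ((2 * ?d + 0 - 2) / 2) = Gamma (?d - 1)"
      by (simp_all add: diff_divide_distrib)
    have "R = 1 / 2 * Q powr (1 / (\<alpha> - 0))"
      unfolding R assms sphere_radius_def e Q_def by (simp only: mult.commute)
    then have "ln R = ln (1 / 2 * Q powr (1 / \<alpha>))" by (simp only: diff_zero)
    also have "\<dots> = ln (1 / 2) + ln (Q powr (1 / \<alpha>))" using Q by (intro ln_mult_pos) auto
    finally show ?thesis using Q by (simp add: ln_powr ln_div)
  qed
  have npos: "(?d - 1) / 2 \<notin> \<int>\<^sub>\<le>\<^sub>0" "?d - 1 \<notin> \<int>\<^sub>\<le>\<^sub>0" using d by (auto dest: nonpos_Ints_nonpos)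
  have dg: "deriv Gamma x / Gamma x = Digamma x" if "x \<notin> \<int>\<^sub>\<le>\<^sub>0" for x :: real
  proof -
    have "deriv Gamma x = Gamma x * Digamma x" by (rule DERIV_imp_deriv) (rule has_field_derivative_Gamma[OF that])
    moreover have "Gamma x \<noteq> 0" using that by (simp add: Gamma_eq_zero_iff)
    ultimately show ?thesis by simp
  qed
  have "optimal_value = R powr \<alpha> * A / \<alpha> - Pot DIM('a) 0 1 - ln R"
    unfolding optimal_value_def pa using assms R_pos by simp
  also have "\<dots> = 1 / \<alpha> - (ln 2 + (Digamma ((?d - 1) / 2) - Digamma (?d - 1)) / 2) - (- ln 2 + ln Q / \<alpha>)"
    unfolding RA lnR sphere_log_moment[OF d] ..
  finally have "optimal_value / 2 = (1 / \<alpha> - (ln 2 + (Digamma ((?d - 1) / 2) - Digamma (?d - 1)) / 2) - (- ln 2 + ln Q / \<alpha>)) / 2"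
    by simp
  also have "\<dots> = 1 / (2 * \<alpha>) * (1 - ln Q) + 1 / 4 * (Digamma (?d - 1) - Digamma ((?d - 1) / 2))"
    using \<alpha> by (simp add: field_simps)
  finally show ?thesis unfolding Q_def dg[OF npos(1)] dg[OF npos(2)] .
qed

end

theorem theorem1:
  fixes \<alpha> \<beta> d R :: real
  defines "d \<equiv> real DIM('a::euclidean_space)"
    and "R \<equiv> sphere_radius DIM('a) \<alpha> \<beta>"
  assumes "DIM('a) \<ge> 2"
    and "2 \<le> \<alpha>" and "\<alpha> \<le> 4"
    and "beta_star DIM('a) \<alpha> \<le> \<beta>" and "\<beta> \<le> 2" and "\<beta> < \<alpha>"
  shows "minimal_energy TYPE('a) \<alpha> \<beta> = ereal
      (if \<beta> \<noteq> 0 then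
         - (pi powr (- 1 / 2)) * 2 powr (d + \<alpha> - 3) *
           (Gamma (d / 2) * Gamma ((d + \<alpha> - 1) / 2) / Gamma ((2 * d + \<alpha> - 2) / 2)) *
           (1 / \<beta> - 1 / \<alpha>) * R powr \<alpha>
       else
         1 / (2 * \<alpha>) *
           (1 - ln ((Gamma ((d - 1) / 2) * Gamma ((2 * d + \<alpha> - 2) / 2)) /
                    (Gamma (d - 1) * Gamma ((d + \<alpha> - 1) / 2)))) +
         1 / 4 * (deriv Gamma (d - 1) / Gamma (d - 1) -
                  deriv Gamma ((d - 1) / 2) / Gamma ((d - 1) / 2))) \<and>
    (\<forall>a :: 'a. minimizer \<alpha> \<beta> (uniform_sphere a R)) \<and>
    ((\<alpha>, \<beta>) \<noteq> (4, 2) \<longrightarrow>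
       (\<forall>\<mu> :: 'a measure. minimizer \<alpha> \<beta> \<mu> \<longrightarrow> (\<exists>a. \<mu> = uniform_sphere a R)))"
proof -
  note h = assms(3-8)
  have R: "R = sphere_radius DIM('a) \<alpha> \<beta>" by (simp add: R_def)
  have "minimal_energy TYPE('a) \<alpha> \<beta> = ereal
      (if \<beta> \<noteq> 0 then
         - (pi powr (- 1 / 2)) * 2 powr (d + \<alpha> - 3) *
           (Gamma (d / 2) * Gamma ((d + \<alpha> - 1) / 2) / Gamma ((2 * d + \<alpha> - 2) / 2)) *
           (1 / \<beta> - 1 / \<alpha>) * R powr \<alpha>
       else
         1 / (2 * \<alpha>) *
           (1 - ln ((Gamma ((d - 1) / 2) * Gamma ((2 * d + \<alpha> - 2) / 2)) /
                    (Gamma (d - 1) * Gamma ((d + \<alpha> - 1) / 2)))) +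
         1 / 4 * (deriv Gamma (d - 1) / Gamma (d - 1) -
                  deriv Gamma ((d - 1) / 2) / Gamma ((d - 1) / 2)))"
  proof (cases "\<beta> = 0")
    case True
    show ?thesis
      unfolding minimal_energy_eq[OF h R] optimal_value_zero[OF h R True] d_def using True by simp
  next
    case False
    show ?thesis
      unfolding minimal_energy_eq[OF h R] optimal_value_nonzero[OF h R False] d_def using False by simp
  qed
  then show ?thesis
    using uniform_sphere_minimizer[OF h R] minimizer_unique[OF h R] by blast
qed

end
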